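(* Assume $P_{\rm avg}>0$, and let $F^\star$ be a maximizer of $\mathcal I(F)$ over $F\in\mathcal P_A(P_{\rm avg})$. Then there exist constants $\lambda\ge0$ and $\gamma\in\mathbb R$ such that $$\psi_{F^\star}(x)-\lambda x\le\gamma,\qquad x\in[0,A],$$ and $$\psi_{F^\star}(x)-\lambda x=\gamma,\qquad x\in\operatorname{supp}(F^\star).$$ Moreover, $$\lambda\left(\int x\,dF^\star(x)-P_{\rm avg}\right)=0.$$
   Context: Setting: $L\ge0$ an integer, $\lambda_0>0$, $h_0>0$, $h_\ell\ge0$, $\sum_{\ell=0}^L h_\ell=1$, $0\le A<\infty$; $\mathcal P_A(P_{\rm avg})$ is the set of Borel probability measures on $[0,A]$ with mean at most $P_{\rm avg}$. For any Borel probability law $F$ on $[0,A]$, the subscript $F$ refers to the stationary process with $(X_k)_{k\in\mathbb Z}$ i.i.d. of law $F$ and, given the inputs, conditionally independent $Y_k\sim\operatorname{Poisson}(Z_k)$, $Z_k=\lambda_0+\sum_{\ell=0}^L h_\ell X_{k-\ell}$. The stationary mutual information rate is $$\mathcal I(F)=\lim_{n\to\infty}\frac1n I_F(X_1^n;Y_1^n)=H_F(Y_0\mid Y_{-\infty}^{-1})-\mathbb E_F[\phi(Z_0)],$$ where $\phi(z)=z-z\log z+\sum_{m\ge0}\frac{e^{-z}z^m}{m!}\log(m!)$ is the entropy of a Poisson variable of mean $z$. Logarithms are natural; $X_i^j=(X_i,\dots,X_j)$, $Y_i^j=(Y_i,\dots,Y_j)$. The point-mass influence function is $\psi_F(x)=\left.\frac{d}{d\epsilon}\mathcal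 I((1-\epsilon)F+\epsilon\delta_x)\right|_{\epsilon=0^+}$ for $x\in[0,A]$ (this derivative exists for every $F\in\mathcal P_A(P_{\rm avg})$ and $x\in[0,A]$). $\operatorname{supp}$ denotes closed support. *)

theory Defs
  imports "HOL-Probability.Probability"
begin

text \<open>
  A peak-limited input law is a probability measure whose space is the interval \<open>[0,A]\<close>
  itself, not a measure on the whole real line. With nonnegative taps, every Poisson mean is
  therefore at least \<open>lam0 > 0\<close> on the whole input space. This matters because
  \<^const>\<open>poisson_pmf\<close> is unspecified at nonpositive means, and kernel measurability would not
  be provable there.
\<close>

definition amplitudes :: "real \<Rightarrow> real measure" where
  "amplitudes A = restrict_space borel {0..A}"

definition input_laws :: "real \<Rightarrow> real measure set" where
  "input_laws A = {F. prob_space F \<and> sets F = sets (amplitudes A)}"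

definition admissible_laws :: "real \<Rightarrow> real \<Rightarrow> real measure set" where
  "admissible_laws A Pavg = {F \<in> input_laws A. (\<integral>x. x \<partial>F) \<le> Pavg}"

definition closed_support :: "real measure \<Rightarrow> real set" where
  "closed_support F = {x \<in> space F. \<forall>U. open U \<and> x \<in> U \<longrightarrow> emeasure F (U \<inter> space F) > 0}"

definition intensity :: "nat \<Rightarrow> real \<Rightarrow> (nat \<Rightarrow> real) \<Rightarrow> (int \<Rightarrow> real) \<Rightarrow> int \<Rightarrow> real" where
  "intensity L lam0 h x k = lam0 + (\<Sum>l=0..L. h l * x (k - int l))"

definition input_paths :: "real \<Rightarrow> (int \<Rightarrow> real) measure" where
  "input_paths A = (\<Pi>\<^sub>M k\<in>UNIV. amplitudes A)"

definition output_paths :: "(int \<Rightarrow> nat) measure" where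
  "output_paths = (\<Pi>\<^sub>M k\<in>UNIV. count_space UNIV)"

definition output_kernel ::
  "nat \<Rightarrow> real \<Rightarrow> (nat \<Rightarrow> real) \<Rightarrow> (int \<Rightarrow> real) \<Rightarrow> (int \<Rightarrow> nat) measure" where
  "output_kernel L lam0 h x =
     (\<Pi>\<^sub>M k\<in>UNIV. measure_pmf (poisson_pmf (intensity L lam0 h x k)))"

text \<open>Joint law of the two-sided input and output sequences \<open>(X, Y)\<close>.\<close>

definition stationary_law ::
  "nat \<Rightarrow> real \<Rightarrow> (nat \<Rightarrow> real) \<Rightarrow> real \<Rightarrow> real measure
     \<Rightarrow> ((int \<Rightarrow> real) \<times> (int \<Rightarrow> nat)) measure" where
  "stationary_law L lam0 h A F =
     (\<Pi>\<^sub>M k\<in>UNIV. F) \<bind>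
       (\<lambda>x. distr (output_kernel L lam0 h x) (input_paths A \<Otimes>\<^sub>M output_paths) (\<lambda>y. (x, y)))"

text \<open>Base \<open>exp 1\<close> gives natural logarithms.\<close>

definition block_information ::
  "nat \<Rightarrow> real \<Rightarrow> (nat \<Rightarrow> real) \<Rightarrow> real \<Rightarrow> real measure \<Rightarrow> nat \<Rightarrow> real" where
  "block_information L lam0 h A F n =
     prob_space.mutual_information (stationary_law L lam0 h A F) (exp 1)
       (\<Pi>\<^sub>M k\<in>{1..int n}. amplitudes A) (\<Pi>\<^sub>M k\<in>{1..int n}. count_space UNIV)
       (\<lambda>\<omega>. restrict (fst \<omega>) {1..int n}) (\<lambda>\<omega>. restrict (snd \<omega>) {1..int n})"

definition information_rate ::
  "nat \<Rightarrow> real \<Rightarrow> (nat \<Rightarrow> real) \<Rightarrow> real \<Rightarrow> real measure \<Rightarrow> real" where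
  "information_rate L lam0 h A F = lim (\<lambda>n. block_information L lam0 h A F n / real n)"

definition mixture :: "real \<Rightarrow> real measure \<Rightarrow> real measure \<Rightarrow> real measure" where
  "mixture \<epsilon> F G = measure_of (space F) (sets F)
     (\<lambda>B. ennreal (1 - \<epsilon>) * emeasure F B + ennreal \<epsilon> * emeasure G B)"

definition influence ::
  "nat \<Rightarrow> real \<Rightarrow> (nat \<Rightarrow> real) \<Rightarrow> real \<Rightarrow> real measure \<Rightarrow> real \<Rightarrow> real" where
  "influence L lam0 h A F x =
     vector_derivative
       (\<lambda>\<epsilon>. information_rate L lam0 h A (mixture \<epsilon> F (return (amplitudes A) x))) (at_right 0)"


text \<open>Well-definedness of the mixtures and of the joint law.\<close>

lemma emeasure_mixture:
  assumes "sets G = sets F" and B: "B \<in> sets F"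
  shows "emeasure (mixture \<epsilon> F G) B = ennreal (1 - \<epsilon>) * emeasure F B + ennreal \<epsilon> * emeasure G B"
proof -
  have G: "countably_additive (sets F) (emeasure G)"
    using emeasure_countably_additive[of G] assms(1) by simp
  have "countably_additive (sets F)
      (\<lambda>B. ennreal (1 - \<epsilon>) * emeasure F B + ennreal \<epsilon> * emeasure G B)"
  proof (rule countably_additiveI)
    fix C :: "nat \<Rightarrow> _"
    assume C: "range C \<subseteq> sets F" "disjoint_family C"
    have "(\<Sum>i. emeasure F (C i)) = emeasure F (\<Union>i. C i)"
      "(\<Sum>i. emeasure G (C i)) = emeasure G (\<Union>i. C i)"
      using C assms(1) by (auto intro!: suminf_emeasure)
    then show "(\<Sum>i. ennreal (1 - \<epsilon>) * emeasure F (C i) + ennreal \<epsilon> * emeasure G (C i)) =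
        ennreal (1 - \<epsilon>) * emeasure F (\<Union>i. C i) + ennreal \<epsilon> * emeasure G (\<Union>i. C i)"
      by (simp add: suminf_add[symmetric])
  qed
  moreover have "positive (sets F)
      (\<lambda>B. ennreal (1 - \<epsilon>) * emeasure F B + ennreal \<epsilon> * emeasure G B)"
    by (simp add: positive_def)
  ultimately show ?thesis
    unfolding mixture_def
    using B by (intro emeasure_measure_of_sigma) (auto simp: sets.sigma_algebra_axioms)
qed

lemma mixture_in_input_laws:
  assumes "F \<in> input_laws A" "G \<in> input_laws A" "0 \<le> \<epsilon>" "\<epsilon> \<le> 1"
  shows "mixture \<epsilon> F G \<in> input_laws A"
proof -
  have s: "sets G = sets F" "sets F = sets (amplitudes A)" "prob_space F" "prob_space G"
    using assms by (auto simp: input_laws_def)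
  have sm: "sets (mixture \<epsilon> F G) = sets F"
    by (simp add: mixture_def)
  then have sp: "space (mixture \<epsilon> F G) = space F" "space G = space F"
    using s sets_eq_imp_space_eq by blast+
  have "emeasure (mixture \<epsilon> F G) (space F) = ennreal (1 - \<epsilon>) + ennreal \<epsilon>"
    using emeasure_mixture[OF s(1) sets.top[of F], of \<epsilon>]
      prob_space.emeasure_space_1[OF s(3)] prob_space.emeasure_space_1[OF s(4)] sp by simp
  also have "\<dots> = 1"
    using assms(3,4) by (simp flip: ennreal_plus)
  finally show ?thesis
    using sm sp s by (auto simp: input_laws_def intro!: prob_spaceI)
qed

lemma return_in_input_laws:
  "x \<in> {0..A} \<Longrightarrow> return (amplitudes A) x \<in> input_laws A"
  by (auto simp: input_laws_def amplitudes_def space_restrict_space intro!: prob_space_return)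

lemma sets_output_kernel [simp, measurable_cong]:
  "sets (output_kernel L lam0 h x) = sets output_paths"
  unfolding output_kernel_def output_paths_def by (intro sets_PiM_cong) auto

lemma intensity_pos:
  assumes "lam0 > 0" "\<forall>l\<le>L. h l \<ge> 0" "x \<in> space (input_paths A)"
  shows "intensity L lam0 h x k > 0"
proof -
  have "x j \<ge> 0" for j
    using assms(3) by (auto simp: input_paths_def amplitudes_def space_PiM space_restrict_space)
  then have "(\<Sum>l=0..L. h l * x (k - int l)) \<ge> 0"
    using assms(2) by (intro sum_nonneg) auto
  then show ?thesis
    using assms(1) by (simp add: intensity_def)
qed

lemma measurable_output_kernel:
  assumes "lam0 > 0" "\<forall>l\<le>L. h l \<ge> 0"
  shows "output_kernel L lam0 h \<in> input_paths A \<rightarrow>\<^sub>M prob_algebra output_paths"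
proof (rule measurable_prob_algebra_generated)
  show "sets output_paths = sigma_sets (\<Pi>\<^sub>E i\<in>UNIV. space (count_space UNIV))
      (prod_algebra UNIV (\<lambda>_::int. count_space (UNIV::nat set)))"
    unfolding output_paths_def by (rule sets_PiM)
  show "Int_stable (prod_algebra UNIV (\<lambda>_::int. count_space (UNIV::nat set)))"
    by (rule Int_stable_prod_algebra)
  show "prod_algebra UNIV (\<lambda>_::int. count_space (UNIV::nat set))
      \<subseteq> Pow (\<Pi>\<^sub>E i\<in>UNIV. space (count_space UNIV))"
    by (rule prod_algebra_sets_into_space)
  show "prob_space (output_kernel L lam0 h x)" for x
    unfolding output_kernel_def by (intro prob_space_PiM prob_space_measure_pmf)
  show "sets (output_kernel L lam0 h x) = sets output_paths" for x
    by simp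
  fix B assume "B \<in> prod_algebra UNIV (\<lambda>_::int. count_space (UNIV::nat set))"
  then obtain J E where B: "B = prod_emb UNIV (\<lambda>_. count_space UNIV) J (\<Pi>\<^sub>E j\<in>J. E j)"
    and J: "finite J"
    by (auto elim!: prod_algebraE)
  have [measurable]: "(\<lambda>x. intensity L lam0 h x j) \<in> borel_measurable (input_paths A)" for j
  proof -
    have [measurable]: "(\<lambda>x. x i) \<in> borel_measurable (input_paths A)" for i :: int
    proof -
      have "(\<lambda>x. x i) \<in> input_paths A \<rightarrow>\<^sub>M amplitudes A"
        unfolding input_paths_def by measurable
      then show ?thesis
        by (simp add: amplitudes_def measurable_restrict_space2_iff)
    qed
    show ?thesis unfolding intensity_def by measurable
  qed
  have "emeasure (output_kernel L lam0 h x) B =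
      (\<Prod>j\<in>J. \<Sum>n. ennreal (indicator (E j) n *
        (intensity L lam0 h x j ^ n / fact n * exp (- intensity L lam0 h x j))))"
    if x: "x \<in> space (input_paths A)" for x
  proof -
    have emb: "B = prod_emb UNIV (\<lambda>k. measure_pmf (poisson_pmf (intensity L lam0 h x k))) J
        (\<Pi>\<^sub>E j\<in>J. E j)"
      unfolding B by (simp add: prod_emb_def)
    have "emeasure (output_kernel L lam0 h x) B =
        (\<Prod>j\<in>J. emeasure (measure_pmf (poisson_pmf (intensity L lam0 h x j))) (E j))"
      unfolding output_kernel_def emb
      by (rule emeasure_PiM_emb) (use J in \<open>auto intro: prob_space_measure_pmf\<close>)
    also have "\<dots> = (\<Prod>j\<in>J. \<Sum>n. ennreal (indicator (E j) n *
        (intensity L lam0 h x j ^ n / fact n * exp (- intensity L lam0 h x j))))"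
    proof (rule prod.cong[OF refl])
      fix j
      have "emeasure (measure_pmf (poisson_pmf (intensity L lam0 h x j))) (E j) =
          (\<integral>\<^sup>+n. ennreal (pmf (poisson_pmf (intensity L lam0 h x j)) n) * indicator (E j) n
            \<partial>count_space UNIV)"
        by (simp add: nn_integral_pmf[symmetric] nn_integral_count_space_indicator)
      then show "emeasure (measure_pmf (poisson_pmf (intensity L lam0 h x j))) (E j) =
          (\<Sum>n. ennreal (indicator (E j) n *
            (intensity L lam0 h x j ^ n / fact n * exp (- intensity L lam0 h x j))))"
        using intensity_pos[OF assms x, of j]
        by (auto simp: nn_integral_count_space_nat indicator_def intro!: suminf_cong)
    qed
    finally show ?thesis .
  qed
  then show "(\<lambda>x. emeasure (output_kernel L lam0 h x) B) \<in> borel_measurable (input_paths A)"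
    by (subst measurable_cong) (assumption, measurable)
qed

lemma prob_space_stationary_law:
  assumes "lam0 > 0" "\<forall>l\<le>L. h l \<ge> 0" "F \<in> input_laws A"
  shows "prob_space (stationary_law L lam0 h A F)"
    and "sets (stationary_law L lam0 h A F) = sets (input_paths A \<Otimes>\<^sub>M output_paths)"
proof -
  have F: "prob_space F" "sets F = sets (amplitudes A)"
    using assms(3) by (auto simp: input_laws_def)
  have s: "sets (\<Pi>\<^sub>M k\<in>(UNIV::int set). F) = sets (input_paths A)"
    unfolding input_paths_def using F by (intro sets_PiM_cong) auto
  have "(\<Pi>\<^sub>M k\<in>(UNIV::int set). F) \<in> space (prob_algebra (input_paths A))"
    using F s by (auto simp: space_prob_algebra intro!: prob_space_PiM)
  moreover have "(\<lambda>x. distr (output_kernel L lam0 h x) (input_paths A \<Otimes>\<^sub>M output_paths)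
      (\<lambda>y. (x, y))) \<in> input_paths A \<rightarrow>\<^sub>M prob_algebra (input_paths A \<Otimes>\<^sub>M output_paths)"
    by (rule measurable_distr_prob_space2[OF measurable_output_kernel[OF assms(1,2)]]) measurable
  note * = calculation this
  show "prob_space (stationary_law L lam0 h A F)"
    unfolding stationary_law_def by (rule prob_space_bind'[OF *])
  show "sets (stationary_law L lam0 h A F) = sets (input_paths A \<Otimes>\<^sub>M output_paths)"
    unfolding stationary_law_def by (rule sets_bind'[OF *])
qed

end

theory Submission
  imports Defs
begin

text \<open>
  The noise part \<open>E[\<phi>(Z\<^sub>0)]\<close> of the rate is the integral of a bounded continuous function of \<open>L + 1\<close>
  inputs; replacing the input law by a mixture one coordinate at a time differentiates it.
  For the entropy rate of the output, observe that a Poisson variable of mean \<open>z\<close> vanishes with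
  probability \<open>exp (- z)\<close>, which factorises over the inputs. A run of \<open>L + 1\<close> zero outputs therefore makes
  the past and the future of the output exactly independent, so the second differences of the block entropies only
  involve words without such a run. The probability of these words decays geometrically in their length, uniformly in
  the input law, and the entropy rate becomes a series of terms \<open>p ln p\<close> that can be differentiated
  termwise.

  The resulting directional derivative is \<open>\<integral>\<psi> dG\<close> in every direction \<open>G\<close>, with \<open>\<psi>\<close> continuous. At a
  maximiser it is nonpositive for point masses and two-point laws of admissible mean, which yields a line
  \<open>x \<mapsto> lam (x - Pavg)\<close> above \<open>\<psi>\<close>; it vanishes in the direction of the maximiser itself,
  which gives complementary slackness and equality on the support.
\<close>

section \<open>Product laws of input paths\<close>

text \<open>The obstacle is the logarithm: at rare words the derivative \<open>1 + ln p\<close> of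
  \<open>p ln p\<close> is unbounded, and each length has infinitely many words. Since all
  intensities lie between \<open>lam0 > 0\<close> and \<open>zmax\<close>, a letter \<open>y\<close>
  has conditional probability at least \<open>exp (- cost y)\<close>, so the absolute value of
  \<open>ln p\<close> is at most the additive cost of the word, uniformly in the input law. This
  cost is absorbed into a multiplicative weight small enough to preserve the geometric decay.
  Knowing the rate only as a limit of block quantities would not suffice, as limits and derivatives
  need not commute; one fixed series is needed. This is why second differences appear: up to sign
  they are conditional mutual informations of the two outer outputs given the middle ones, to which
  middle words with a run of zeros contribute nothing. A block of inputs does not determine the
  conditional law of the outputs at the same times, as the first \<open>L\<close> of them also read
  earlier inputs. The resulting error is bounded independently of the block length and disappears in
  the rate.\<close>

lemma prod_emb_UNIV_PiE:
  "prod_emb UNIV M J (\<Pi>\<^sub>E j\<in>J. F j) = {x. (\<forall>i. x i \<in> space (M i)) \<and> (\<forall>j\<in>J. x j \<in> F j)}"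
  by (auto simp: prod_emb_def PiE_iff)

text \<open>Product measures are determined on cylinders, and the preimage of a cylinder under the
  merge is a rectangle of two cylinders. Ignoring unread coordinates, resampling one coordinate and
  splitting a path into independent parts are all derived from this.\<close>

lemma distr_PiM_merge:
  fixes M1 M2 N :: "'i \<Rightarrow> 'a measure"
  assumes p: "\<And>i. prob_space (M1 i)" "\<And>i. prob_space (M2 i)"
    and s1: "\<And>i. sets (M1 i) = sets (N i)" and s2: "\<And>i. sets (M2 i) = sets (N i)"
  shows "distr (PiM UNIV M1 \<Otimes>\<^sub>M PiM UNIV M2) (PiM UNIV N) (\<lambda>w i. if i \<in> K then fst w i else snd w i)
     = PiM UNIV (\<lambda>i. if i \<in> K then M1 i else M2 i)" (is "distr ?P _ ?m = PiM UNIV ?M")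
proof -
  have pM: "prob_space (?M i)" for i using p by auto
  interpret M: product_prob_space ?M UNIV
    by (intro product_prob_spaceI pM)
  interpret M1: product_prob_space M1 UNIV
    by (intro product_prob_spaceI p)
  interpret M2: product_prob_space M2 UNIV
    by (intro product_prob_spaceI p)
  interpret P2: pair_prob_space "PiM UNIV M1" "PiM UNIV M2" ..
  have sM: "sets (?M i) = sets (N i)" for i using s1 s2 by auto
  have sp: "space (M1 i) = space (N i)" "space (M2 i) = space (N i)" "space (?M i) = space (N i)" for i
    by (intro sets_eq_imp_space_eq s1 s2 sM)+
  have sP: "sets (PiM UNIV M1) = sets (PiM UNIV N)" "sets (PiM UNIV M2) = sets (PiM UNIV N)"
     "sets (PiM UNIV ?M) = sets (PiM UNIV N)"
    using s1 s2 sM by (auto intro!: sets_PiM_cong)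
  note [measurable_cong] = sP(1,2)
  have meas: "?m \<in> ?P \<rightarrow>\<^sub>M PiM UNIV N"
  proof (rule measurable_PiM_single')
    fix i
    show "(\<lambda>w. ?m w i) \<in> ?P \<rightarrow>\<^sub>M N i"
    proof (cases "i \<in> K")
      case True
      have "(\<lambda>w. fst w i) \<in> ?P \<rightarrow>\<^sub>M N i" by measurable
      then show ?thesis using True by simp
    next
      case False
      have "(\<lambda>w. snd w i) \<in> ?P \<rightarrow>\<^sub>M N i" by measurable
      then show ?thesis using False by simp
    qed
  next
    show "?m \<in> space ?P \<rightarrow> (\<Pi>\<^sub>E i\<in>UNIV. space (N i))"
      by (auto simp: space_pair_measure space_PiM sp PiE_iff)
  qed
  show ?thesis
  proof (rule M.PiM_eq)
    show "sets (distr ?P (PiM UNIV N) ?m) = sets (PiM UNIV ?M)"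
      by (simp add: sP)
    fix J F assume J: "finite J" "J \<subseteq> UNIV" "\<And>j. j \<in> J \<Longrightarrow> F j \<in> sets (?M j)"
    have F: "j \<in> J \<Longrightarrow> F j \<in> sets (N j)" "j \<in> J \<Longrightarrow> F j \<in> sets (M1 j)" "j \<in> J \<Longrightarrow> F j \<in> sets (M2 j)" for j
      using J(3)[of j] sM[of j] s1[of j] s2[of j] by auto
    let ?B = "prod_emb UNIV ?M J (\<Pi>\<^sub>E j\<in>J. F j)"
    let ?B1 = "prod_emb UNIV M1 (J \<inter> K) (\<Pi>\<^sub>E j\<in>J\<inter>K. F j)"
    let ?B2 = "prod_emb UNIV M2 (J - K) (\<Pi>\<^sub>E j\<in>J-K. F j)"
    have B: "?B \<in> sets (PiM UNIV N)"
      unfolding sP(3)[symmetric] using J by (intro sets_PiM_I) auto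
    have "?m -` ?B \<inter> space ?P = ?B1 \<times> ?B2"
      by (force simp: prod_emb_UNIV_PiE space_pair_measure space_PiM sp PiE_iff)
    then have "emeasure (distr ?P (PiM UNIV N) ?m) ?B = emeasure ?P (?B1 \<times> ?B2)"
      using B meas by (subst emeasure_distr) auto
    also have "\<dots> = emeasure (PiM UNIV M1) ?B1 * emeasure (PiM UNIV M2) ?B2"
      by (rule M2.P.emeasure_pair_measure_Times) (use F J in \<open>auto intro!: sets_PiM_I\<close>)
    also have "\<dots> = (\<Prod>j\<in>J\<inter>K. emeasure (?M j) (F j)) * (\<Prod>j\<in>J-K. emeasure (?M j) (F j))"
      using J F by (subst M1.emeasure_PiM_emb, simp_all, subst M2.emeasure_PiM_emb, simp_all)
    also have "\<dots> = (\<Prod>j\<in>J. emeasure (?M j) (F j))"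
      using J(1) prod.Int_Diff[of J "\<lambda>j. emeasure (?M j) (F j)" K] by simp
    finally show "emeasure (distr ?P (PiM UNIV N) ?m) ?B = (\<Prod>j\<in>J. emeasure (?M j) (F j))" .
  qed
qed

section \<open>Input laws, path space and integration over merged paths\<close>

lemma space_law: "F \<in> input_laws A \<Longrightarrow> space F = {0..A}"
  using sets_eq_imp_space_eq[of F "amplitudes A"]
  by (auto simp: input_laws_def amplitudes_def space_restrict_space)

lemma space_input_paths: "space (input_paths A) = {x. \<forall>i. 0 \<le> x i \<and> x i \<le> A}"
  by (auto simp: input_paths_def space_PiM amplitudes_def space_restrict_space PiE_iff)

lemma prob_law: "F \<in> input_laws A \<Longrightarrow> prob_space F"
  and sets_law: "F \<in> input_laws A \<Longrightarrow> sets F = sets (amplitudes A)"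
  by (auto simp: input_laws_def)

lemma sets_PiM_laws: "(\<And>i. M i \<in> input_laws A) \<Longrightarrow> sets (PiM UNIV M) = sets (input_paths A)"
  unfolding input_paths_def by (intro sets_PiM_cong) (auto simp: input_laws_def)

lemma space_PiM_laws: "(\<And>i. M i \<in> input_laws A) \<Longrightarrow> space (PiM UNIV M) = space (input_paths A)"
  using sets_PiM_laws by (rule sets_eq_imp_space_eq)

lemma prob_PiM_laws: "(\<And>i. M i \<in> input_laws A) \<Longrightarrow> prob_space (PiM UNIV M)"
  by (intro prob_space_PiM prob_law)

lemma merge_in_space:
  "x \<in> space (input_paths A) \<Longrightarrow> y \<in> space (input_paths A) \<Longrightarrow>
     (\<lambda>i. if i \<in> K then x i else y i) \<in> space (input_paths A)"
  by (auto simp: space_input_paths)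

lemma measurable_merge_paths:
  "(\<lambda>w i. if i \<in> K then fst w i else snd w i) \<in> input_paths A \<Otimes>\<^sub>M input_paths A \<rightarrow>\<^sub>M input_paths A"
proof -
  have "(\<lambda>w. if i \<in> K then fst w i else snd w i) \<in> input_paths A \<Otimes>\<^sub>M input_paths A \<rightarrow>\<^sub>M amplitudes A" for i
    unfolding input_paths_def by (cases "i \<in> K"; simp)
  then show ?thesis
    unfolding input_paths_def
    by (intro measurable_PiM_single') (auto simp: space_pair_measure space_PiM PiE_iff)
qed

lemma distr_merge_laws:
  assumes M1: "\<And>i. M1 i \<in> input_laws A" and M2: "\<And>i. M2 i \<in> input_laws A"
  shows "(\<lambda>w i. if i \<in> K then fst w i else snd w i) \<in> PiM UNIV M1 \<Otimes>\<^sub>M PiM UNIV M2 \<rightarrow>\<^sub>M input_paths A"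
    and "PiM UNIV (\<lambda>i. if i \<in> K then M1 i else M2 i) =
      distr (PiM UNIV M1 \<Otimes>\<^sub>M PiM UNIV M2) (input_paths A) (\<lambda>w i. if i \<in> K then fst w i else snd w i)"
proof -
  have pm: "sets (PiM UNIV M1 \<Otimes>\<^sub>M PiM UNIV M2) = sets (input_paths A \<Otimes>\<^sub>M input_paths A)"
    by (intro sets_pair_measure_cong sets_PiM_laws[of M1, OF M1] sets_PiM_laws[of M2, OF M2])
  show "(\<lambda>w i. if i \<in> K then fst w i else snd w i) \<in> PiM UNIV M1 \<Otimes>\<^sub>M PiM UNIV M2 \<rightarrow>\<^sub>M input_paths A"
    using measurable_merge_paths by (simp add: measurable_cong_sets[OF pm refl])
  show "PiM UNIV (\<lambda>i. if i \<in> K then M1 i else M2 i) =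
      distr (PiM UNIV M1 \<Otimes>\<^sub>M PiM UNIV M2) (input_paths A) (\<lambda>w i. if i \<in> K then fst w i else snd w i)"
    unfolding input_paths_def
    by (rule distr_PiM_merge[symmetric])
      (simp_all add: prob_law[OF M1] prob_law[OF M2] sets_law[OF M1] sets_law[OF M2])
qed

lemma nn_integral_merge:
  assumes M1: "\<And>i. M1 i \<in> input_laws A" and M2: "\<And>i. M2 i \<in> input_laws A"
    and f: "f \<in> borel_measurable (input_paths A)"
  shows "(\<integral>\<^sup>+x. f x \<partial>PiM UNIV (\<lambda>i. if i \<in> K then M1 i else M2 i)) =
    (\<integral>\<^sup>+x. \<integral>\<^sup>+y. f (\<lambda>i. if i \<in> K then x i else y i) \<partial>PiM UNIV M2 \<partial>PiM UNIV M1)"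
proof -
  interpret P2: prob_space "PiM UNIV M2" by (rule prob_PiM_laws[OF M2])
  note m = distr_merge_laws(1)[where K=K, OF M1 M2]
  have "(\<integral>\<^sup>+x. f x \<partial>PiM UNIV (\<lambda>i. if i \<in> K then M1 i else M2 i)) =
     (\<integral>\<^sup>+w. f (\<lambda>i. if i \<in> K then fst w i else snd w i) \<partial>(PiM UNIV M1 \<Otimes>\<^sub>M PiM UNIV M2))"
    unfolding distr_merge_laws(2)[where K=K, OF M1 M2] using f m by (simp add: nn_integral_distr)
  also have "\<dots> = (\<integral>\<^sup>+x. \<integral>\<^sup>+y. f (\<lambda>i. if i \<in> K then x i else y i) \<partial>PiM UNIV M2 \<partial>PiM UNIV M1)"
    using measurable_comp[OF m f] by (subst P2.nn_integral_fst[symmetric]) (simp_all add: comp_def cong: if_cong)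
  finally show ?thesis .
qed

lemma integrable_bounded_prob:
  fixes f :: "'a \<Rightarrow> real"
  assumes "prob_space P" "f \<in> borel_measurable P" "\<And>x. x \<in> space P \<Longrightarrow> \<bar>f x\<bar> \<le> B"
  shows "integrable P f"
proof -
  interpret prob_space P by fact
  show ?thesis using assms by (intro integrable_const_bound[where B=B]) auto
qed

lemma integral_bounded_prob:
  fixes f :: "'a \<Rightarrow> real"
  assumes "prob_space P" "\<And>x. x \<in> space P \<Longrightarrow> \<bar>f x\<bar> \<le> B"
  shows "\<bar>\<integral>x. f x \<partial>P\<bar> \<le> B"
proof (cases "integrable P f")
  case True
  interpret prob_space P by fact
  have "\<bar>\<integral>x. f x \<partial>P\<bar> \<le> (\<integral>x. \<bar>f x\<bar> \<partial>P)" by (rule integral_abs_bound)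
  also have "\<dots> \<le> (\<integral>x. B \<partial>P)" using True assms by (intro integral_mono) auto
  finally show ?thesis by (simp add: prob_space)
next
  case False
  obtain x where "x \<in> space P" using prob_space.not_empty[OF assms(1)] by auto
  then have "B \<ge> 0" using assms(2)[of x] by linarith
  then show ?thesis using False by (simp add: not_integrable_integral_eq)
qed

lemma integral_merge:
  fixes f :: "(int \<Rightarrow> real) \<Rightarrow> real"
  assumes M1: "\<And>i. M1 i \<in> input_laws A" and M2: "\<And>i. M2 i \<in> input_laws A"
    and f: "f \<in> borel_measurable (input_paths A)" and B: "\<And>x. x \<in> space (input_paths A) \<Longrightarrow> \<bar>f x\<bar> \<le> B"
  shows "(\<integral>x. f x \<partial>PiM UNIV (\<lambda>i. if i \<in> K then M1 i else M2 i)) =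
    (\<integral>x. \<integral>y. f (\<lambda>i. if i \<in> K then x i else y i) \<partial>PiM UNIV M2 \<partial>PiM UNIV M1)"
proof -
  interpret P1: prob_space "PiM UNIV M1" by (rule prob_PiM_laws[OF M1])
  interpret P2: prob_space "PiM UNIV M2" by (rule prob_PiM_laws[OF M2])
  interpret P: pair_prob_space "PiM UNIV M1" "PiM UNIV M2" ..
  note m = distr_merge_laws(1)[where K=K, OF M1 M2]
  have "(\<integral>x. f x \<partial>PiM UNIV (\<lambda>i. if i \<in> K then M1 i else M2 i)) =
     (\<integral>w. f (\<lambda>i. if i \<in> K then fst w i else snd w i) \<partial>(PiM UNIV M1 \<Otimes>\<^sub>M PiM UNIV M2))"
    unfolding distr_merge_laws(2)[where K=K, OF M1 M2] using f m by (simp add: integral_distr)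
  also have "\<dots> = (\<integral>x. \<integral>y. f (\<lambda>i. if i \<in> K then x i else y i) \<partial>PiM UNIV M2 \<partial>PiM UNIV M1)"
  proof (subst P.integral_fst'[symmetric])
    show "integrable (PiM UNIV M1 \<Otimes>\<^sub>M PiM UNIV M2) (\<lambda>w. f (\<lambda>i. if i \<in> K then fst w i else snd w i))"
      using measurable_comp[OF m f] measurable_space[OF m]
      by (intro integrable_bounded_prob[where B=B] B P.prob_space_axioms) (auto simp: comp_def)
  qed (simp cong: if_cong)
  finally show ?thesis .
qed

text \<open>Relative to a set \<open>S\<close> of paths, so that nothing is demanded off the input
  space.\<close>

definition depends_on :: "('i \<Rightarrow> 'a) set \<Rightarrow> 'i set \<Rightarrow> (('i \<Rightarrow> 'a) \<Rightarrow> 'b) \<Rightarrow> bool" where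
  "depends_on S K f \<longleftrightarrow> (\<forall>x\<in>S. \<forall>y\<in>S. (\<forall>k\<in>K. x k = y k) \<longrightarrow> f x = f y)"

text \<open>Merging \<open>M1\<close> on \<open>K\<close> with \<open>M2\<close> elsewhere gives
  \<open>M2\<close>, while \<open>f\<close> sees only the coordinates drawn from
  \<open>M1\<close>.\<close>

lemma integral_depends_on:
  fixes f :: "(int \<Rightarrow> real) \<Rightarrow> real"
  assumes M1: "\<And>i. M1 i \<in> input_laws A" and M2: "\<And>i. M2 i \<in> input_laws A"
    and f: "f \<in> borel_measurable (input_paths A)" and B: "\<And>x. x \<in> space (input_paths A) \<Longrightarrow> \<bar>f x\<bar> \<le> B"
    and dep: "depends_on (space (input_paths A)) K f" and eq: "\<And>i. i \<in> K \<Longrightarrow> M1 i = M2 i"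
  shows "(\<integral>x. f x \<partial>PiM UNIV M1) = (\<integral>x. f x \<partial>PiM UNIV M2)"
proof -
  interpret P2: prob_space "PiM UNIV M2" by (rule prob_PiM_laws[OF M2])
  have e: "(\<lambda>i. if i \<in> K then M1 i else M2 i) = M2" using eq by auto
  have "(\<integral>x. f x \<partial>PiM UNIV M2) =
    (\<integral>x. \<integral>y. f (\<lambda>i. if i \<in> K then x i else y i) \<partial>PiM UNIV M2 \<partial>PiM UNIV M1)"
    using integral_merge[where K=K and ?M1.0=M1 and ?M2.0=M2, OF M1 M2 f B] e by simp
  also have "\<dots> = (\<integral>x. \<integral>y. f x \<partial>PiM UNIV M2 \<partial>PiM UNIV M1)"
  proof (intro Bochner_Integration.integral_cong refl)
    fix x y assume "x \<in> space (PiM UNIV M1)" "y \<in> space (PiM UNIV M2)"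
    then have "x \<in> space (input_paths A)" "y \<in> space (input_paths A)"
      by (simp_all add: space_PiM_laws[of M1, OF M1] space_PiM_laws[of M2, OF M2])
    then show "f (\<lambda>i. if i \<in> K then x i else y i) = f x"
      by (intro dep[unfolded depends_on_def, rule_format] merge_in_space) simp_all
  qed
  finally show ?thesis by (simp add: P2.prob_space)
qed

section \<open>Resampling one coordinate, and shifts\<close>

lemma measurable_upd_paths:
  "(\<lambda>w. (snd w)(j := fst w)) \<in> amplitudes A \<Otimes>\<^sub>M input_paths A \<rightarrow>\<^sub>M input_paths A"
proof -
  have "(\<lambda>w. ((snd w)(j := fst w)) i) \<in> amplitudes A \<Otimes>\<^sub>M input_paths A \<rightarrow>\<^sub>M amplitudes A" for i
    unfolding input_paths_def by (cases "i = j"; simp)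
  then show ?thesis
    unfolding input_paths_def
    by (intro measurable_PiM_single') (auto simp: space_pair_measure space_PiM PiE_iff)
qed

lemma upd_in_space:
  "x \<in> space (input_paths A) \<Longrightarrow> a \<in> {0..A} \<Longrightarrow> x(j := a) \<in> space (input_paths A)"
  by (auto simp: space_input_paths)

lemma measurable_upd_const:
  assumes "f \<in> borel_measurable (input_paths A)" "a \<in> {0..A}"
  shows "(\<lambda>x. f (x(j := a))) \<in> borel_measurable (input_paths A)"
proof -
  have "(\<lambda>x. (a, x)) \<in> input_paths A \<rightarrow>\<^sub>M amplitudes A \<Otimes>\<^sub>M input_paths A"
    using assms(2) by (intro measurable_Pair1') (auto simp: amplitudes_def space_restrict_space)
  from measurable_comp[OF this measurable_comp[OF measurable_upd_paths assms(1)]]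
  show ?thesis by (simp add: comp_def)
qed

lemma measurable_integral_upd:
  fixes f :: "(int \<Rightarrow> real) \<Rightarrow> real"
  assumes M: "\<And>i. M i \<in> input_laws A" and f: "f \<in> borel_measurable (input_paths A)"
  shows "(\<lambda>a. \<integral>x. f (x(j := a)) \<partial>PiM UNIV M) \<in> borel_measurable (amplitudes A)"
proof -
  interpret P: prob_space "PiM UNIV M" by (rule prob_PiM_laws[OF M])
  have pm: "sets (amplitudes A \<Otimes>\<^sub>M PiM UNIV M) = sets (amplitudes A \<Otimes>\<^sub>M input_paths A)"
    by (intro sets_pair_measure_cong refl sets_PiM_laws M)
  have "(\<lambda>w. f ((snd w)(j := fst w))) \<in> borel_measurable (amplitudes A \<Otimes>\<^sub>M PiM UNIV M)"
    using measurable_comp[OF measurable_upd_paths f] by (simp add: measurable_cong_sets[OF pm refl] comp_def)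
  then show ?thesis
    by (intro P.borel_measurable_lebesgue_integral) (simp add: split_beta')
qed

text \<open>Merging along \<open>K = {j}\<close>: only coordinate \<open>j\<close> of the first
  family is read, and its law is \<open>G\<close>.\<close>

lemma integral_upd:
  fixes f :: "(int \<Rightarrow> real) \<Rightarrow> real"
  assumes M: "\<And>i. M i \<in> input_laws A" and G: "G \<in> input_laws A"
    and f: "f \<in> borel_measurable (input_paths A)" and B: "\<And>x. x \<in> space (input_paths A) \<Longrightarrow> \<bar>f x\<bar> \<le> B"
  shows "(\<integral>x. f x \<partial>PiM UNIV (M(j := G))) = (\<integral>a. \<integral>x. f (x(j := a)) \<partial>PiM UNIV M \<partial>G)"
proof -
  interpret GG: product_prob_space "\<lambda>_::int. G" UNIV
    by (intro product_prob_spaceI prob_law[OF G])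
  have e: "(\<lambda>i. if i \<in> {j} then G else M i) = M(j := G)" by auto
  have "(\<integral>x. f x \<partial>PiM UNIV (M(j := G))) =
    (\<integral>x. \<integral>y. f (\<lambda>i. if i \<in> {j} then x i else y i) \<partial>PiM UNIV M \<partial>PiM UNIV (\<lambda>_. G))"
    using integral_merge[where K="{j}" and ?M1.0="\<lambda>_. G" and ?M2.0=M, OF G M f B] e by simp
  also have "\<dots> = (\<integral>x. (\<integral>y. f (y(j := x j)) \<partial>PiM UNIV M) \<partial>PiM UNIV (\<lambda>_. G))"
    by (intro Bochner_Integration.integral_cong refl arg_cong[where f=f]) auto
  also have "\<dots> = (\<integral>a. (\<integral>y. f (y(j := a)) \<partial>PiM UNIV M) \<partial>distr (PiM UNIV (\<lambda>_. G)) G (\<lambda>x. x j))"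
    using measurable_integral_upd[where M=M and j=j, OF M f] sets_law[OF G]
    by (subst integral_distr) (auto cong: measurable_cong_sets)
  also have "distr (PiM UNIV (\<lambda>_. G)) G (\<lambda>x. x j) = G"
    by (rule GG.PiM_component) simp
  finally show ?thesis .
qed

lemma distr_shift_paths:
  assumes F: "F \<in> input_laws A"
  shows "distr (PiM UNIV (\<lambda>_::int. F)) (PiM UNIV (\<lambda>_::int. F)) (\<lambda>x i. x (i + s)) = PiM UNIV (\<lambda>_::int. F)"
  using distr_PiM_reindex[of UNIV "\<lambda>_::int. F" "\<lambda>i. i + s" UNIV] prob_law[OF F]
  by (simp add: inj_on_def restrict_UNIV)

lemma integral_shift_paths:
  fixes f :: "(int \<Rightarrow> real) \<Rightarrow> real"
  assumes F: "F \<in> input_laws A" and f: "f \<in> borel_measurable (input_paths A)"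
  shows "(\<integral>x. f (\<lambda>i. x (i + s)) \<partial>PiM UNIV (\<lambda>_::int. F)) = (\<integral>x. f x \<partial>PiM UNIV (\<lambda>_::int. F))"
proof -
  have s: "sets (PiM UNIV (\<lambda>_::int. F)) = sets (input_paths A)" by (intro sets_PiM_laws F)
  have m: "(\<lambda>x i. x (i + s)) \<in> PiM UNIV (\<lambda>_::int. F) \<rightarrow>\<^sub>M PiM UNIV (\<lambda>_::int. F)"
    by (intro measurable_PiM_single') (auto simp: space_PiM PiE_iff)
  have "(\<integral>x. f x \<partial>distr (PiM UNIV (\<lambda>_::int. F)) (PiM UNIV (\<lambda>_::int. F)) (\<lambda>x i. x (i + s))) =
      (\<integral>x. f (\<lambda>i. x (i + s)) \<partial>PiM UNIV (\<lambda>_::int. F))"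
    using m f by (intro integral_distr) (auto simp: measurable_cong_sets[OF s refl])
  then show ?thesis by (simp only: distr_shift_paths[OF F])
qed

section \<open>Integrals against mixtures\<close>

lemma sets_mixture [simp]: "sets (mixture \<epsilon> F G) = sets F"
  and space_mixture [simp]: "space (mixture \<epsilon> F G) = space F"
  by (simp_all add: mixture_def)

text \<open>Measure-theoretic induction, starting from indicators, where it is
  \<open>emeasure_mixture\<close>.\<close>

lemma nn_integral_mixture:
  assumes s: "sets G = sets F" and f: "f \<in> borel_measurable F"
  shows "(\<integral>\<^sup>+x. f x \<partial>mixture \<epsilon> F G) =
    ennreal (1 - \<epsilon>) * (\<integral>\<^sup>+x. f x \<partial>F) + ennreal \<epsilon> * (\<integral>\<^sup>+x. f x \<partial>G)"
proof -
  have sp: "space G = space F" using s by (rule sets_eq_imp_space_eq)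
  have mF: "u \<in> borel_measurable F \<Longrightarrow> u \<in> borel_measurable (mixture \<epsilon> F G)"
    and mG: "u \<in> borel_measurable F \<Longrightarrow> u \<in> borel_measurable G" for u :: "real \<Rightarrow> ennreal"
    using s by (simp_all cong: measurable_cong_sets)
  show ?thesis
    using f
  proof (induct rule: borel_measurable_induct)
    case (cong f g)
    have "(\<integral>\<^sup>+x. f x \<partial>N) = (\<integral>\<^sup>+x. g x \<partial>N)" if "space N = space F" for N
      using cong(3) that by (intro nn_integral_cong) auto
    then show ?case using cong(4) sp by simp
  next
    case (set B)
    then show ?case using s by (simp add: emeasure_mixture)
  next
    case (mult u c)
    have "(\<integral>\<^sup>+x. c * u x \<partial>N) = c * (\<integral>\<^sup>+x. u x \<partial>N)" if "u \<in> borel_measurable N" for N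
      using that by (rule nn_integral_cmult)
    note this[OF mF[OF mult(2)]] this[OF mult(2)] this[OF mG[OF mult(2)]] mult(4)
    then show ?case by (simp add: distrib_left mult.left_commute)
  next
    case (add u v)
    have "(\<integral>\<^sup>+x. v x + u x \<partial>N) = (\<integral>\<^sup>+x. v x \<partial>N) + (\<integral>\<^sup>+x. u x \<partial>N)"
      if "u \<in> borel_measurable N" "v \<in> borel_measurable N" for N
      using that by (simp add: nn_integral_add)
    note this[OF mF[OF add(1)] mF[OF add(4)]] this[OF add(1) add(4)] this[OF mG[OF add(1)] mG[OF add(4)]] add(3) add(7)
    then show ?case by (simp add: distrib_left add.assoc add.left_commute)
  next
    case (seq U)
    have mono: "(\<integral>\<^sup>+x. U i x \<partial>N) \<le> (\<integral>\<^sup>+x. U j x \<partial>N)" if "i \<le> j" for i j N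
      using incseqD[OF seq(4) that] by (intro nn_integral_mono) (simp add: le_fun_def)
    have inc: "incseq (\<lambda>i. ennreal (1 - \<epsilon>) * (\<integral>\<^sup>+x. U i x \<partial>F))" "incseq (\<lambda>i. ennreal \<epsilon> * (\<integral>\<^sup>+x. U i x \<partial>G))"
      by (rule incseq_SucI, rule mult_left_mono[OF mono], simp, simp)+
    have *: "(\<integral>\<^sup>+x. Sup (range U) x \<partial>N) = (SUP i. \<integral>\<^sup>+x. U i x \<partial>N)"
      if "\<And>i. U i \<in> borel_measurable N" for N
      using nn_integral_monotone_convergence_SUP[OF seq(4) that] by (simp add: SUP_apply image_comp)
    show ?case
      unfolding *[of "mixture \<epsilon> F G", OF mF[OF seq(1)]] *[of F, OF seq(1)] *[of G, OF mG[OF seq(1)]]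
        seq(3) ennreal_SUP_add[OF inc] SUP_mult_left_ennreal ..
  qed
qed

lemma integral_mixture:
  fixes f :: "real \<Rightarrow> real"
  assumes F: "F \<in> input_laws A" and G: "G \<in> input_laws A" and \<epsilon>: "0 \<le> \<epsilon>" "\<epsilon> \<le> 1"
    and f: "f \<in> borel_measurable (amplitudes A)" and B: "\<And>x. x \<in> {0..A} \<Longrightarrow> \<bar>f x\<bar> \<le> B"
  shows "(\<integral>x. f x \<partial>mixture \<epsilon> F G) = (1 - \<epsilon>) * (\<integral>x. f x \<partial>F) + \<epsilon> * (\<integral>x. f x \<partial>G)"
proof -
  have m: "f \<in> borel_measurable N" if "N \<in> input_laws A" for N
    using f sets_law[OF that] by (simp cong: measurable_cong_sets)
  have i: "integrable N f" if "N \<in> input_laws A" for N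
    using B that by (intro integrable_bounded_prob[where B=B] prob_law[OF that] m) (auto simp: space_law)
  note M = mixture_in_input_laws[OF F G \<epsilon>]
  have fin: "(\<integral>\<^sup>+x. ennreal (f x) \<partial>N) < \<infinity>" "(\<integral>\<^sup>+x. ennreal (- f x) \<partial>N) < \<infinity>" if "N \<in> input_laws A" for N
    using i[OF that] by (auto simp: real_integrable_def less_top)
  have e: "enn2real (ennreal (1 - \<epsilon>) * a + ennreal \<epsilon> * b) = (1 - \<epsilon>) * enn2real a + \<epsilon> * enn2real b"
    if "a < \<infinity>" "b < \<infinity>" for a b
    using that \<epsilon> by (subst enn2real_plus) (auto simp: ennreal_mult_less_top enn2real_mult)
  have sG: "sets G = sets F" using F G by (simp add: input_laws_def)
  have n1: "(\<integral>\<^sup>+x. ennreal (f x) \<partial>mixture \<epsilon> F G) =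
     ennreal (1 - \<epsilon>) * (\<integral>\<^sup>+x. ennreal (f x) \<partial>F) + ennreal \<epsilon> * (\<integral>\<^sup>+x. ennreal (f x) \<partial>G)"
    using m[OF F] by (intro nn_integral_mixture sG) auto
  have n2: "(\<integral>\<^sup>+x. ennreal (- f x) \<partial>mixture \<epsilon> F G) =
     ennreal (1 - \<epsilon>) * (\<integral>\<^sup>+x. ennreal (- f x) \<partial>F) + ennreal \<epsilon> * (\<integral>\<^sup>+x. ennreal (- f x) \<partial>G)"
    using m[OF F] by (intro nn_integral_mixture sG) auto
  show ?thesis
    unfolding real_lebesgue_integral_def[OF i[OF M]] real_lebesgue_integral_def[OF i[OF F]]
      real_lebesgue_integral_def[OF i[OF G]] n1 n2 e[OF fin(1)[OF F] fin(1)[OF G]] e[OF fin(2)[OF F] fin(2)[OF G]]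
    by (simp add: algebra_simps)
qed

text \<open>Lets the difference quotients along mixtures be read as one-sided derivatives at
  0.\<close>

lemma mixture_0:
  assumes "F \<in> input_laws A" "G \<in> input_laws A"
  shows "mixture 0 F G = F"
proof (intro measure_eqI)
  have sG: "sets G = sets F" using assms by (simp add: input_laws_def)
  show "emeasure (mixture 0 F G) B = emeasure F B" if "B \<in> sets (mixture 0 F G)" for B
    using that emeasure_mixture[OF sG, of B 0] by simp
qed simp

lemma mixture_self:
  assumes "F \<in> input_laws A" "0 \<le> \<epsilon>" "\<epsilon> \<le> 1"
  shows "mixture \<epsilon> F F = F"
proof (intro measure_eqI)
  fix B assume "B \<in> sets (mixture \<epsilon> F F)"
  then have "emeasure (mixture \<epsilon> F F) B = (ennreal (1 - \<epsilon>) + ennreal \<epsilon>) * emeasure F B"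
    by (simp add: emeasure_mixture distrib_right)
  also have "ennreal (1 - \<epsilon>) + ennreal \<epsilon> = 1"
    using assms by (simp flip: ennreal_plus)
  finally show "emeasure (mixture \<epsilon> F F) B = emeasure F B" by simp
qed simp

section \<open>Words and their weighted likelihoods\<close>

definition words :: "nat \<Rightarrow> nat list set" where
  "words n = {w. length w = n}"

abbreviation Words :: "nat \<Rightarrow> nat list measure" where
  "Words n \<equiv> count_space (words n)"

lemma countable_words [simp]: "countable (words n)"
  by (rule countableI_type)

lemma words_0: "words 0 = {[]}"
  by (auto simp: words_def)

lemma bij_words_add: "bij_betw (\<lambda>(u, v). u @ v) (words m \<times> words n) (words (m + n))"
proof (rule bij_betw_byWitness[where f' = "\<lambda>w. (take m w, drop m w)"])
qed (auto simp: words_def)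

lemma bij_words_1: "bij_betw (\<lambda>a. [a]) UNIV (words 1)"
  by (rule bij_betw_byWitness[where f' = hd]) (auto simp: words_def length_Suc_conv)

lemma nn_integral_words_add:
  "(\<integral>\<^sup>+w. g w \<partial>Words (m + n)) =
    (\<integral>\<^sup>+u. \<integral>\<^sup>+v. g (u @ v) \<partial>Words n \<partial>Words m)"
proof -
  interpret sigma_finite_measure "Words n"
    by (rule sigma_finite_measure_count_space_countable) simp
  have "(\<integral>\<^sup>+w. g w \<partial>Words (m + n)) =
      (\<integral>\<^sup>+p. g (fst p @ snd p) \<partial>count_space (words m \<times> words n))"
    using nn_integral_bij_count_space[OF bij_words_add[of m n], of g] by (simp add: split_beta')
  also have "\<dots> = (\<integral>\<^sup>+p. g (fst p @ snd p) \<partial>(Words m \<Otimes>\<^sub>M Words n))"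
    by (simp add: pair_measure_countable)
  also have "\<dots> = (\<integral>\<^sup>+u. \<integral>\<^sup>+v. g (u @ v) \<partial>Words n \<partial>Words m)"
    by (subst nn_integral_fst[symmetric]) (simp_all add: pair_measure_countable)
  finally show ?thesis .
qed

lemma nn_integral_words_1:
  "(\<integral>\<^sup>+w. g w \<partial>Words 1) = (\<integral>\<^sup>+a. g [a] \<partial>count_space UNIV)"
  using nn_integral_bij_count_space[OF bij_words_1, of g] by simp

lemma nn_integral_words_Suc:
  "(\<integral>\<^sup>+w. g w \<partial>Words (Suc n)) =
    (\<integral>\<^sup>+a. \<integral>\<^sup>+v. g (a # v) \<partial>Words n \<partial>count_space UNIV)"
  using nn_integral_words_add[where g=g and m=1 and n=n] unfolding nn_integral_words_1 by simp

lemma nn_integral_words_prod_list: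
  fixes f :: "nat \<Rightarrow> real"
  assumes "\<And>a. f a \<ge> 0"
  shows "(\<integral>\<^sup>+w. ennreal (prod_list (map f w)) \<partial>Words n) =
    (\<integral>\<^sup>+a. ennreal (f a) \<partial>count_space UNIV) ^ n"
proof (induction n)
  case 0
  then show ?case by (simp add: words_0 nn_integral_count_space_finite)
next
  case (Suc n)
  have "prod_list (map f w) \<ge> 0" for w
    by (induction w) (auto simp: assms)
  then show ?case
    by (simp add: nn_integral_words_Suc ennreal_mult assms nn_integral_cmult nn_integral_multc Suc)
qed

section \<open>Poisson weights and their generating function\<close>

definition pois :: "real \<Rightarrow> nat \<Rightarrow> real" where
  "pois z y = z ^ y / fact y * exp (- z)"

lemma pois_nonneg: "z \<ge> 0 \<Longrightarrow> pois z y \<ge> 0"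
  by (simp add: pois_def)

text \<open>The Poisson generating function: \<open>r = 1\<close> gives the total mass,
  \<open>r = 4\<close> the mean of \<open>cost\<close>.\<close>

lemma pois_weighted_sums: "(\<lambda>y. pois z y * r ^ y) sums exp (r * z - z)"
proof -
  have "(\<lambda>y. exp (- z) * ((r * z) ^ y /\<^sub>R fact y)) sums (exp (- z) * exp (r * z))"
    by (intro sums_mult exp_converges)
  then show ?thesis
    by (simp add: pois_def power_mult_distrib divide_inverse mult_ac exp_diff exp_minus)
qed

lemma pois_sums_1: "pois z sums 1"
  using pois_weighted_sums[of z 1] by simp

lemma pois_le_1: "z \<ge> 0 \<Longrightarrow> pois z y \<le> 1"
  using sum_le_suminf[OF sums_summable[OF pois_sums_1[of z]], of "{y}"] sums_unique[OF pois_sums_1[of z]]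
  by (simp add: pois_nonneg)

text \<open>\<open>poisson_pmf\<close> is meaningful only at positive means, whereas the formula
  \<open>pois\<close> is total and smooth in \<open>z\<close>. The analysis is carried out with
  \<open>pois\<close>.\<close>

lemma pmf_poisson_pois: "z > 0 \<Longrightarrow> pmf (poisson_pmf z) y = pois z y"
  by (simp add: pois_def)

lemma nn_integral_count_space_sums:
  assumes "f sums s" "\<And>y. f y \<ge> (0::real)"
  shows "(\<integral>\<^sup>+y. ennreal (f y) \<partial>count_space UNIV) = ennreal s"
  using assms by (simp add: nn_integral_count_space_nat suminf_ennreal_eq[OF assms(2,1)])

text \<open>Deliberately crude: \<open>y * 2 ^ y\<close> is at most \<open>4 ^ y\<close>, and an
  exponential in \<open>y\<close> has a Poisson mean given by the generating function.\<close>

lemma ln_fact_le: "ln (fact y :: real) \<le> real y * 2 ^ y"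
proof (induction y)
  case (Suc y)
  have "ln (fact (Suc y) :: real) = ln (real (Suc y)) + ln (fact y)"
    by (simp add: ln_mult)
  also have "ln (real (Suc y)) \<le> real y" using ln_le_minus_one[of "real (Suc y)"] by simp
  also have "real y \<le> 2 ^ y" using of_nat_less_two_power[of y, where 'a=real] by linarith
  also have "2 ^ y + ln (fact y :: real) \<le> 2 ^ y + real y * 2 ^ y" using Suc by simp
  also have "\<dots> \<le> real (Suc y) * 2 ^ Suc y" by (simp add: algebra_simps)
  finally show ?case by simp
qed simp

section \<open>Bounds uniform in the input path\<close>

locale poisson_isi =
  fixes L :: nat and lam0 A :: real and h :: "nat \<Rightarrow> real"
  assumes lam0_pos: "lam0 > 0" and h_nonneg: "\<forall>l\<le>L. h l \<ge> 0"
    and h_sum: "(\<Sum>l=0..L. h l) = 1" and A_nonneg: "A \<ge> 0"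
begin

abbreviation Z :: "(int \<Rightarrow> real) \<Rightarrow> int \<Rightarrow> real" where "Z \<equiv> intensity L lam0 h"
abbreviation paths :: "(int \<Rightarrow> real) measure" where "paths \<equiv> input_paths A"
abbreviation zmax :: real where "zmax \<equiv> lam0 + A"

text \<open>The taps are nonnegative with sum 1, so the intensity is \<open>lam0\<close> plus a
  weighted average of inputs.\<close>

lemma Z_bounds:
  assumes "x \<in> space paths"
  shows "lam0 \<le> Z x k" "Z x k \<le> zmax"
proof -
  have x: "0 \<le> x i" "x i \<le> A" for i using assms by (auto simp: space_input_paths)
  have "(\<Sum>l=0..L. h l * x (k - int l)) \<ge> 0"
    using h_nonneg x by (intro sum_nonneg) auto
  then show "lam0 \<le> Z x k" by (simp add: intensity_def)
  have "(\<Sum>l=0..L. h l * x (k - int l)) \<le> (\<Sum>l=0..L. h l * A)"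
    using h_nonneg x by (intro sum_mono mult_left_mono) auto
  also have "\<dots> = A" using h_sum by (simp flip: sum_distrib_right)
  finally show "Z x k \<le> zmax" by (simp add: intensity_def)
qed

text \<open>\<open>exp (- cost y)\<close> bounds the Poisson weights of \<open>y\<close> from below, uniformly in the admissible means. The crude
  geometric growth of \<open>cost\<close> makes its Poisson means explicit.\<close>

definition cost_const :: real where "cost_const = 1 + zmax + \<bar>ln lam0\<bar>"

lemma cost_const_pos: "cost_const > 0" using lam0_pos A_nonneg by (simp add: cost_const_def add_pos_nonneg)

definition cost :: "nat \<Rightarrow> real" where "cost y = cost_const * 4 ^ y"

text \<open>In \<open>y * ln z - ln (fact y) - z\<close> each term is at least a constant times
  \<open>- (4 ^ y)\<close>. The constants are the absolute value of \<open>ln lam0\<close>, then 1,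
  then \<open>zmax\<close>, which add up to \<open>cost_const\<close>.\<close>

lemma pois_lower:
  assumes "lam0 \<le> z" "z \<le> zmax"
  shows "pois z y \<ge> exp (- cost y)"
proof -
  have z: "z > 0" using lam0_pos assms by simp
  have y2: "real y \<le> 2 ^ y" using of_nat_less_two_power[of y, where 'a=real] by linarith
  have "real y * \<bar>ln lam0\<bar> \<le> 2 ^ y * \<bar>ln lam0\<bar>" by (intro mult_right_mono y2) auto
  moreover have "real y * ln lam0 \<ge> - (real y * \<bar>ln lam0\<bar>)"
    by (metis abs_ge_minus_self abs_mult abs_of_nat minus_le_iff)
  moreover have "real y * ln lam0 \<le> real y * ln z" using lam0_pos assms by (intro mult_left_mono) auto
  moreover have "real y * 2 ^ y \<le> 2 ^ y * 2 ^ y" by (intro mult_right_mono y2) auto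
  moreover have "(2::real) ^ y * 2 ^ y = 4 ^ y" by (simp flip: power_mult_distrib)
  moreover have "2 ^ y * \<bar>ln lam0\<bar> \<le> 4 ^ y * \<bar>ln lam0\<bar>" by (intro mult_right_mono power_mono) auto
  moreover have "z \<le> zmax * 4 ^ y"
  proof -
    have "zmax * 1 \<le> zmax * 4 ^ y"
      using lam0_pos A_nonneg by (intro mult_left_mono) auto
    with assms(2) show ?thesis by (metis mult_1_right order_trans)
  qed
  moreover have "(0::real) \<le> 4 ^ y" by simp
  ultimately have "- cost y \<le> real y * ln z - ln (fact y) - z"
    using ln_fact_le[of y] unfolding cost_def cost_const_def by (simp add: algebra_simps)
  also have "\<dots> = ln (pois z y)"
    using z by (simp add: pois_def ln_mult ln_div ln_realpow)
  finally show ?thesis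
    using z by (subst ln_ge_iff[symmetric]) (auto simp: pois_def)
qed

text \<open>The weight \<open>theta\<close> is multiplicative over letters and still dominates the additive cost of a word. For small
  \<open>tau\<close> the weighted mass of the nonzero words of length \<open>L + 1\<close> stays below \<open>1\<close>.\<close>

definition tau :: real where
  "tau = (SOME t. t > 0 \<and> (1 + t * (cost_const * exp (3 * zmax))) ^ Suc L - exp (- zmax) ^ Suc L < 1)"

text \<open>The expression is continuous in \<open>t\<close>, and at \<open>t = 0\<close> it equals
  \<open>1 - exp (- zmax) ^ Suc L < 1\<close>.\<close>

lemma tau: "tau > 0" "(1 + tau * (cost_const * exp (3 * zmax))) ^ Suc L - exp (- zmax) ^ Suc L < 1"
proof -
  let ?f = "\<lambda>t. (1 + t * (cost_const * exp (3 * zmax))) ^ Suc L - exp (- zmax) ^ Suc L"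
  have "(?f \<longlongrightarrow> ?f 0) (at_right 0)" by (intro tendsto_intros)
  moreover have "?f 0 < 1" by simp
  ultimately have "eventually (\<lambda>t. ?f t < 1) (at_right 0)" by (rule order_tendstoD)
  moreover have "eventually (\<lambda>t::real. t > 0) (at_right 0)" by (rule eventually_at_right_less)
  ultimately have "eventually (\<lambda>t. t > 0 \<and> ?f t < 1) (at_right 0)" by eventually_elim simp
  then have "\<exists>t. t > 0 \<and> ?f t < 1" by (rule eventually_happens'[rotated]) simp
  from someI_ex[OF this] show "tau > 0" "?f tau < 1" unfolding tau_def by blast+
qed

definition theta :: "nat \<Rightarrow> real" where "theta y = 1 + tau * cost y"

definition mass_const :: real where "mass_const = 1 + tau * (cost_const * exp (3 * zmax))"

lemma cost_pos: "cost y > 0" using cost_const_pos by (simp add: cost_def)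

lemma theta_ge_1: "theta y \<ge> 1" using tau(1) cost_pos[of y] by (simp add: theta_def)

lemma mass_const_ge_1: "mass_const \<ge> 1" using tau(1) cost_const_pos by (simp add: mass_const_def)

text \<open>The generating function at 4 contributes \<open>exp (4 * z - z)\<close>; this is the
  origin of \<open>exp (3 * zmax)\<close> in \<open>mass_const\<close>.\<close>

lemma nn_pois_theta:
  assumes "lam0 \<le> z" "z \<le> zmax"
  shows "(\<integral>\<^sup>+y. ennreal (pois z y * theta y) \<partial>count_space UNIV) \<le> ennreal mass_const"
proof -
  have "(\<lambda>y. pois z y + tau * cost_const * (pois z y * 4 ^ y)) sums (1 + tau * cost_const * exp (4 * z - z))"
    by (intro sums_add sums_mult pois_sums_1 pois_weighted_sums)
  then have "(\<lambda>y. pois z y * theta y) sums (1 + tau * cost_const * exp (3 * z))"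
    by (simp add: theta_def cost_def algebra_simps)
  then have "(\<integral>\<^sup>+y. ennreal (pois z y * theta y) \<partial>count_space UNIV) = ennreal (1 + tau * cost_const * exp (3 * z))"
    using assms lam0_pos theta_ge_1
    by (intro nn_integral_count_space_sums) (auto intro!: mult_nonneg_nonneg pois_nonneg order_trans[OF zero_le_one theta_ge_1])
  also have "\<dots> \<le> ennreal mass_const"
    using assms tau(1) cost_const_pos unfolding mass_const_def
    by (intro ennreal_leI) (auto simp: mult.assoc intro!: mult_left_mono)
  finally show ?thesis .
qed

section \<open>Likelihoods of output words given the inputs\<close>

fun lik :: "int \<Rightarrow> nat list \<Rightarrow> (int \<Rightarrow> real) \<Rightarrow> real" where
  "lik s [] x = 1"
| "lik s (a # w) x = pois (Z x s) a * lik (s + 1) w x"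

lemma lik_append: "lik s (u @ v) x = lik s u x * lik (s + int (length u)) v x"
  by (induction u arbitrary: s) (auto simp: ac_simps)

definition Cost :: "nat list \<Rightarrow> real" where "Cost w = sum_list (map cost w)"
definition Theta :: "nat list \<Rightarrow> real" where "Theta w = prod_list (map theta w)"

lemma Theta_simps [simp]: "Theta [] = 1" "Theta (a # w) = theta a * Theta w" "Theta (u @ v) = Theta u * Theta v"
  by (auto simp: Theta_def)

lemma Cost_simps [simp]: "Cost [] = 0" "Cost (a # w) = cost a + Cost w" "Cost (u @ v) = Cost u + Cost v"
  by (auto simp: Cost_def)

lemma Cost_nonneg: "Cost w \<ge> 0"
  by (induction w) (auto intro: add_nonneg_nonneg less_imp_le cost_pos)

lemma Cost_take: "Cost (take m w) \<le> Cost w" and Cost_drop: "Cost (drop m w) \<le> Cost w"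
proof -
  have "Cost w = Cost (take m w) + Cost (drop m w)" by (metis Cost_simps(3) append_take_drop_id)
  then show "Cost (take m w) \<le> Cost w" "Cost (drop m w) \<le> Cost w" using Cost_nonneg[of "take m w"] Cost_nonneg[of "drop m w"] by auto
qed

text \<open>Expanding a product of factors \<open>1 + tau * cost a\<close> and dropping the
  nonnegative mixed terms.\<close>

lemma Theta_ge: "Theta w \<ge> 1 + tau * Cost w"
proof (induction w)
  case (Cons a w)
  have "1 + tau * Cost (a # w) \<le> (1 + tau * cost a) * (1 + tau * Cost w)"
    using tau(1) cost_pos[of a] Cost_nonneg[of w] by (simp add: algebra_simps)
  also have "\<dots> \<le> theta a * Theta w"
    using Cons theta_ge_1[of a] Cost_nonneg[of w] tau(1) by (intro mult_mono) (auto simp: theta_def)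
  finally show ?case by simp
qed simp

lemma Theta_ge_1: "Theta w \<ge> 1"
  using Theta_ge[of w] tau(1) Cost_nonneg[of w] by (meson add_increasing2 less_imp_le mult_nonneg_nonneg order_refl order_trans)

lemma Cost_le_Theta: "1 + 2 * Cost w \<le> (1 + 2 / tau) * Theta w"
proof -
  have "Cost w \<le> Theta w / tau" using Theta_ge[of w] tau(1) by (simp add: field_simps)
  then show ?thesis using Theta_ge_1[of w] by (simp add: algebra_simps)
qed

context
  fixes x assumes x: "x \<in> space paths"
begin

lemma pois_Z: "exp (- cost a) \<le> pois (Z x s) a"
  by (rule pois_lower[OF Z_bounds(1)[OF x] Z_bounds(2)[OF x]])

lemma lik_pos: "lik s w x > 0"
proof (induction w arbitrary: s)
  case (Cons a w)
  have "pois (Z x s) a > 0" using pois_Z[of a s] by (meson exp_gt_zero less_le_trans)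
  then show ?case using Cons by simp
qed simp

lemma lik_nonneg: "lik s w x \<ge> 0" using lik_pos less_imp_le by blast

lemma Z_nonneg: "Z x k \<ge> 0" using Z_bounds[OF x] lam0_pos by (meson less_imp_le order_trans)

lemma lik_le_1: "lik s w x \<le> 1"
  by (induction w arbitrary: s) (auto intro!: mult_le_one pois_le_1 Z_nonneg lik_nonneg)

lemma lik_lower: "lik s w x \<ge> exp (- Cost w)"
proof (induction w arbitrary: s)
  case (Cons a w)
  have "exp (- Cost (a # w)) = exp (- cost a) * exp (- Cost w)" by (simp flip: exp_add)
  also have "\<dots> \<le> lik s (a # w) x"
    using Cons pois_Z[of a s] by (auto intro!: mult_mono pois_nonneg Z_nonneg)
  finally show ?case .
qed simp

lemma nn_lik_1: "(\<integral>\<^sup>+w. ennreal (lik s w x) \<partial>Words n) = 1"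
proof (induction n arbitrary: s)
  case 0 then show ?case by (simp add: words_0 nn_integral_count_space_finite)
next
  case (Suc n)
  then show ?case
    using nn_integral_count_space_sums[OF pois_sums_1 pois_nonneg[OF Z_nonneg[of s]]]
    by (simp add: nn_integral_words_Suc ennreal_mult pois_nonneg Z_nonneg lik_nonneg nn_integral_cmult nn_integral_multc)
qed

definition wlik :: "int \<Rightarrow> nat list \<Rightarrow> real" where "wlik s w = lik s w x * Theta w"

lemma wlik_nonneg: "wlik s w \<ge> 0"
  unfolding wlik_def by (intro mult_nonneg_nonneg lik_nonneg order_trans[OF zero_le_one Theta_ge_1])

lemma wlik_append: "wlik s (u @ v) = wlik s u * wlik (s + int (length u)) v"
  by (simp add: wlik_def lik_append)

text \<open>Given the inputs, the letters are independent, and the weight is multiplicative, so each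
  letter contributes at most one factor \<open>mass_const\<close>.\<close>

lemma nn_wlik_le: "(\<integral>\<^sup>+w. ennreal (wlik s w) \<partial>Words n) \<le> ennreal (mass_const ^ n)"
proof (induction n arbitrary: s)
  case 0 then show ?case by (simp add: words_0 nn_integral_count_space_finite wlik_def)
next
  case (Suc n)
  have "(\<integral>\<^sup>+w. ennreal (wlik s w) \<partial>Words (Suc n)) =
    (\<integral>\<^sup>+a. ennreal (wlik s [a]) * (\<integral>\<^sup>+v. ennreal (wlik (s + 1) v) \<partial>Words n) \<partial>count_space UNIV)"
  proof -
    have "wlik s (a # v) = wlik s [a] * wlik (s + 1) v" for a v
      using wlik_append[of s "[a]" v] by simp
    then have "(\<integral>\<^sup>+v. ennreal (wlik s (a # v)) \<partial>Words n) =
        (\<integral>\<^sup>+v. ennreal (wlik s [a]) * ennreal (wlik (s + 1) v) \<partial>Words n)" for a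
      unfolding ennreal_mult[OF wlik_nonneg wlik_nonneg, symmetric]
      by (intro nn_integral_cong arg_cong[where f=ennreal])
    then have "(\<integral>\<^sup>+v. ennreal (wlik s (a # v)) \<partial>Words n) =
        ennreal (wlik s [a]) * (\<integral>\<^sup>+v. ennreal (wlik (s + 1) v) \<partial>Words n)" for a
      by (simp only:) (rule nn_integral_cmult, simp)
    then show ?thesis by (simp only: nn_integral_words_Suc)
  qed
  also have "\<dots> \<le> (\<integral>\<^sup>+a. ennreal (wlik s [a]) * ennreal (mass_const ^ n) \<partial>count_space UNIV)"
    by (intro nn_integral_mono mult_left_mono Suc) auto
  also have "\<dots> = (\<integral>\<^sup>+a. ennreal (pois (Z x s) a * theta a) \<partial>count_space UNIV) * ennreal (mass_const ^ n)"
    by (simp add: nn_integral_multc wlik_def)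
  also have "\<dots> \<le> ennreal mass_const * ennreal (mass_const ^ n)"
    by (intro mult_right_mono nn_pois_theta Z_bounds[OF x]) auto
  also have "\<dots> = ennreal (mass_const ^ Suc n)" using mass_const_ge_1 by (simp add: ennreal_mult)
  finally show ?case .
qed

end


section \<open>Words without a run of zeros\<close>

text \<open>An output reads \<open>L + 1\<close> consecutive inputs, so the outputs before and after
  \<open>L + 1\<close> zeros have no input in common.\<close>

definition regen :: "nat list \<Rightarrow> bool" where
  "regen w \<longleftrightarrow> (\<exists>u v. w = u @ replicate (Suc L) 0 @ v)"

lemma regen_append: "regen u \<Longrightarrow> regen (u @ v)" "regen v \<Longrightarrow> regen (u @ v)"
  unfolding regen_def by (metis append.assoc)+

lemma regen_replicate: "regen (replicate (Suc L) 0)"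
  unfolding regen_def by (intro exI[of _ "[]"]) simp

definition rho0 :: real where "rho0 = mass_const ^ Suc L - exp (- zmax) ^ Suc L"

lemma rho0: "0 \<le> rho0" "rho0 < 1"
proof -
  have "exp (- zmax) ^ Suc L \<le> 1"
    using lam0_pos A_nonneg by (intro power_le_one) auto
  moreover have "1 \<le> mass_const ^ Suc L" by (rule one_le_power[OF mass_const_ge_1])
  ultimately show "0 \<le> rho0" by (simp only: rho0_def)
  show "rho0 < 1" using tau(2) by (simp only: rho0_def mass_const_def)
qed

definition mass :: "nat list set \<Rightarrow> (int \<Rightarrow> real) \<Rightarrow> int \<Rightarrow> nat \<Rightarrow> ennreal" where
  "mass \<Omega> x s n = (\<integral>\<^sup>+w. indicator \<Omega> w * ennreal (wlik x s w) \<partial>Words n)"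

lemma mass_le: "x \<in> space paths \<Longrightarrow> mass \<Omega> x s n \<le> ennreal (mass_const ^ n)"
  unfolding mass_def
  by (intro order_trans[OF _ nn_wlik_le[of x n s]] nn_integral_mono) (auto simp: indicator_def)

lemma wlik_replicate_ge:
  assumes x: "x \<in> space paths"
  shows "exp (- zmax) ^ n \<le> wlik x s (replicate n 0)"
proof (induction n arbitrary: s)
  case (Suc n)
  have "exp (- zmax) \<le> exp (- Z x s)" using Z_bounds[OF x, of s] by simp
  also have "\<dots> \<le> exp (- Z x s) * theta 0" using theta_ge_1[of 0] by (simp add: mult_le_cancel_left1)
  also have "\<dots> = wlik x s [0]" using x by (simp add: wlik_def pois_def)
  finally have "exp (- zmax) ^ Suc n \<le> wlik x s [0] * wlik x (s + 1) (replicate n 0)"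
    using Suc wlik_nonneg[OF x] by (auto intro!: mult_mono)
  then show ?case using wlik_append[OF x, of s "[0]" "replicate n 0"] by simp
qed (use x in \<open>simp add: wlik_def\<close>)

text \<open>In a word without a run, the first \<open>L + 1\<close> letters are not all zero and the
  rest contains no run either. Weighted likelihoods are multiplicative over this cut.\<close>

lemma mass_regen_step:
  assumes x: "x \<in> space paths"
  shows "mass {w. \<not> regen w} x s (Suc L + n) \<le> ennreal rho0 * mass {w. \<not> regen w} x (s + int (Suc L)) n"
proof -
  let ?z = "replicate (Suc L) (0::nat)"
  let ?N = "{w. \<not> regen w}"
  let ?W = "Words (Suc L)"
  have "mass ?N x s (Suc L + n) =
     (\<integral>\<^sup>+u. \<integral>\<^sup>+v. indicator ?N (u @ v) * ennreal (wlik x s (u @ v)) \<partial>Words n \<partial>?W)"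
    unfolding mass_def by (rule nn_integral_words_add)
  also have "\<dots> \<le> (\<integral>\<^sup>+u. indicator (- {?z}) u * ennreal (wlik x s u) * mass ?N x (s + int (Suc L)) n \<partial>?W)"
  proof (rule nn_integral_mono)
    fix u assume "u \<in> space ?W"
    then have u: "length u = Suc L" by (simp add: words_def)
    have "(\<integral>\<^sup>+v. indicator ?N (u @ v) * ennreal (wlik x s (u @ v)) \<partial>Words n)
       \<le> (\<integral>\<^sup>+v. (indicator (- {?z}) u * ennreal (wlik x s u)) *
            (indicator ?N v * ennreal (wlik x (s + int (Suc L)) v)) \<partial>Words n)"
    proof (rule nn_integral_mono)
      fix v
      have "indicator ?N (u @ v) \<le> (indicator (- {?z}) u * indicator ?N v :: ennreal)"
        using regen_append[of ?z v] regen_append(2)[of v u] regen_replicate by (auto simp: indicator_def)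
      moreover have "ennreal (wlik x s (u @ v)) = ennreal (wlik x s u) * ennreal (wlik x (s + int (Suc L)) v)"
        using u by (simp only: wlik_append[OF x] ennreal_mult[OF wlik_nonneg[OF x] wlik_nonneg[OF x]])
      ultimately show "indicator ?N (u @ v) * ennreal (wlik x s (u @ v))
        \<le> (indicator (- {?z}) u * ennreal (wlik x s u)) * (indicator ?N v * ennreal (wlik x (s + int (Suc L)) v))"
      proof -
        assume i: "indicator ?N (u @ v) \<le> (indicator (- {?z}) u * indicator ?N v :: ennreal)"
          and e: "ennreal (wlik x s (u @ v)) = ennreal (wlik x s u) * ennreal (wlik x (s + int (Suc L)) v)"
        have "indicator ?N (u @ v) * ennreal (wlik x s (u @ v)) \<le>
           (indicator (- {?z}) u * indicator ?N v) * (ennreal (wlik x s u) * ennreal (wlik x (s + int (Suc L)) v))"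
          unfolding e by (rule mult_right_mono[OF i]) simp
        then show ?thesis by (simp only: mult_ac)
      qed
    qed
    also have "\<dots> = indicator (- {?z}) u * ennreal (wlik x s u) * mass ?N x (s + int (Suc L)) n"
      unfolding mass_def by (rule nn_integral_cmult) simp
    finally show "(\<integral>\<^sup>+v. indicator ?N (u @ v) * ennreal (wlik x s (u @ v)) \<partial>Words n)
       \<le> indicator (- {?z}) u * ennreal (wlik x s u) * mass ?N x (s + int (Suc L)) n" .
  qed
  also have "\<dots> = (\<integral>\<^sup>+u. indicator (- {?z}) u * ennreal (wlik x s u) \<partial>?W) * mass ?N x (s + int (Suc L)) n"
    by (rule nn_integral_multc) simp
  \<comment> \<open>Total weighted mass of the blocks minus that of the zero block, which is at
    least \<open>exp (- zmax) ^ Suc L\<close>. The subtraction is done in the reals, after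
    finiteness is established.\<close>
  also have "(\<integral>\<^sup>+u. indicator (- {?z}) u * ennreal (wlik x s u) \<partial>?W) \<le> ennreal rho0"
  proof -
    let ?a = "\<integral>\<^sup>+u. indicator (- {?z}) u * ennreal (wlik x s u) \<partial>?W"
    have "(\<integral>\<^sup>+u. indicator {?z} u * ennreal (wlik x s u) \<partial>?W) = (\<integral>\<^sup>+u. ennreal (wlik x s ?z) * indicator {?z} u \<partial>?W)"
      by (intro nn_integral_cong) (auto simp: indicator_def)
    also have "\<dots> = ennreal (wlik x s ?z)"
      by (subst nn_integral_cmult_indicator) (auto simp: words_def)
    finally have z: "(\<integral>\<^sup>+u. indicator {?z} u * ennreal (wlik x s u) \<partial>?W) = ennreal (wlik x s ?z)" .
    have "?a + ennreal (wlik x s ?z) = (\<integral>\<^sup>+u. ennreal (wlik x s u) \<partial>?W)"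
      unfolding z[symmetric]
      by (subst nn_integral_add[symmetric]) (auto simp: indicator_def intro!: nn_integral_cong)
    also have "\<dots> \<le> ennreal (mass_const ^ Suc L)" by (rule nn_wlik_le[OF x])
    finally have le: "?a + ennreal (wlik x s ?z) \<le> ennreal (mass_const ^ Suc L)" .
    then have "?a \<noteq> top" by (auto simp: top_unique)
    then obtain a where a: "?a = ennreal a" "a \<ge> 0" by (cases ?a) auto
    have "a + wlik x s ?z \<le> mass_const ^ Suc L"
      using le a wlik_nonneg[OF x, of s ?z] mass_const_ge_1 by (simp flip: ennreal_plus add: ennreal_le_iff del: power_Suc)
    then have "a \<le> rho0" using wlik_replicate_ge[OF x, of "Suc L" s] by (simp only: rho0_def)
    then show ?thesis unfolding a by (rule ennreal_leI)
  qed
  finally show ?thesis by (simp add: mult_right_mono)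
qed

text \<open>Strong induction removing \<open>L + 1\<close> letters at a time; a shorter remainder
  costs at most \<open>mass_const ^ Suc L\<close>.\<close>

lemma mass_regen_le:
  assumes x: "x \<in> space paths"
  shows "mass {w. \<not> regen w} x s n \<le> ennreal (mass_const ^ Suc L * rho0 ^ (n div Suc L))"
proof (induction n arbitrary: s rule: less_induct)
  case (less n)
  show ?case
  proof (cases "n < Suc L")
    case True
    have "mass {w. \<not> regen w} x s n \<le> ennreal (mass_const ^ n)" by (rule mass_le[OF x])
    also have "\<dots> \<le> ennreal (mass_const ^ Suc L)"
      using True mass_const_ge_1 by (intro ennreal_leI power_increasing) auto
    finally show ?thesis using True by (simp del: power_Suc)
  next
    case False
    define k where "k = n - Suc L"
    have n: "n = Suc L + k" using False by (simp add: k_def)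
    have "mass {w. \<not> regen w} x s n \<le> ennreal rho0 * mass {w. \<not> regen w} x (s + int (Suc L)) k"
      unfolding n by (rule mass_regen_step[OF x])
    also have "\<dots> \<le> ennreal rho0 * ennreal (mass_const ^ Suc L * rho0 ^ (k div Suc L))"
      by (intro mult_left_mono less) (auto simp: n)
    also have "\<dots> = ennreal (mass_const ^ Suc L * rho0 ^ (n div Suc L))"
    proof -
      have "n div Suc L = Suc (k div Suc L)"
        unfolding n using div_add_self1[of "Suc L" k] by simp
      then show ?thesis
        using rho0 mass_const_ge_1 by (simp add: ennreal_mult[symmetric] mult_ac del: power_Suc) (simp add: mult_ac)
    qed
    finally show ?thesis .
  qed
qed

text \<open>The constants are uniform over paths and starting times. This is all that the
  differentiation of the series uses about a set of words.\<close>

definition decaying :: "nat list set \<Rightarrow> bool" where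
  "decaying \<Omega> \<longleftrightarrow> (\<exists>C r. 0 \<le> C \<and> 0 < r \<and> r < 1 \<and>
     (\<forall>x\<in>space paths. \<forall>s n. mass \<Omega> x s n \<le> ennreal (C * r ^ n)))"

lemma decaying_not_regen: "decaying {w. \<not> regen w}"
proof -
  \<comment> \<open>The maximum with \<open>1 / 2\<close> keeps \<open>q\<close> positive. The root
    in \<open>r\<close> spreads the decay of a block over its letters, and a factor
    \<open>1 / q\<close> pays for the rounding in \<open>n div Suc L\<close>.\<close>
  define q where "q = max rho0 (1 / 2)"
  define r where "r = q powr (1 / real (Suc L))"
  have q: "0 < q" "q < 1" "rho0 \<le> q" using rho0(2) unfolding q_def by (simp_all add: less_max_iff_disj)
  have r: "0 < r" "r < 1"
  proof -
    have "q powr (1 / real (Suc L)) < 1 powr (1 / real (Suc L))"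
      using q by (intro powr_less_mono2) auto
    then show "r < 1" by (simp add: r_def)
  qed (use q in \<open>simp add: r_def\<close>)
  have le: "q ^ (n div Suc L) \<le> 1 / q * r ^ n" for n
  proof -
    have "real n \<le> real (Suc L) * (real (n div Suc L) + 1)"
    proof -
      have "n \<le> Suc L * (n div Suc L) + Suc L"
        by (metis add_le_cancel_left mod_less_divisor mult_div_mod_eq less_imp_le zero_less_Suc)
      then have "real n \<le> real (Suc L * (n div Suc L) + Suc L)" by (simp only: of_nat_le_iff)
      then show ?thesis by (simp add: algebra_simps)
    qed
    then have "real n / real (Suc L) - 1 \<le> real (n div Suc L)" by (simp add: field_simps)
    then have "q powr real (n div Suc L) \<le> q powr (real n / real (Suc L) - 1)"
      using q by (intro powr_mono') auto
    also have "\<dots> = 1 / q * r ^ n"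
      using q by (simp add: powr_diff r_def powr_powr flip: powr_realpow)
    finally show ?thesis using q by (simp add: powr_realpow)
  qed
  show ?thesis
    unfolding decaying_def
  proof (intro exI conjI ballI allI)
    show "0 \<le> mass_const ^ Suc L * (1 / q)" "0 < r" "r < 1" using mass_const_ge_1 q r by auto
    fix x s n assume x: "x \<in> space paths"
    have "mass {w. \<not> regen w} x s n \<le> ennreal (mass_const ^ Suc L * rho0 ^ (n div Suc L))"
      by (rule mass_regen_le[OF x])
    also have "rho0 ^ (n div Suc L) \<le> q ^ (n div Suc L)" using q rho0 by (intro power_mono) auto
    also have "\<dots> \<le> 1 / q * r ^ n" by (rule le)
    finally show "mass {w. \<not> regen w} x s n \<le> ennreal (mass_const ^ Suc L * (1 / q) * r ^ n)"
      using mass_const_ge_1 by (simp add: mult.assoc mult_left_mono ennreal_leI del: power_Suc)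
  qed
qed

text \<open>A second difference compares blocks of lengths \<open>k\<close>, \<open>k + 1\<close>
  and \<open>k + 2\<close> around the same middle word; the margins are the free outer
  letters.\<close>

definition margins :: "nat \<Rightarrow> nat \<Rightarrow> nat list set \<Rightarrow> nat list set" where
  "margins i j \<Omega> = {u @ m @ v | u m v. length u = i \<and> m \<in> \<Omega> \<and> length v = j}"

text \<open>Each free letter costs a factor \<open>mass_const\<close>, and the shift of the length
  by \<open>i + j\<close> costs a factor \<open>1 / r ^ (i + j)\<close>; both go into the
  constant.\<close>

lemma decaying_margins:
  assumes "decaying \<Omega>"
  shows "decaying (margins i j \<Omega>)"
proof -
  obtain C r where C: "0 \<le> C" "0 < r" "r < 1" "\<And>x s n. x \<in> space paths \<Longrightarrow> mass \<Omega> x s n \<le> ennreal (C * r ^ n)"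
    using assms unfolding decaying_def by blast
  show ?thesis
    unfolding decaying_def
  proof (intro exI conjI ballI allI)
    show "0 \<le> mass_const ^ (i + j) * C / r ^ (i + j)" "0 < r" "r < 1" using mass_const_ge_1 C by auto
    fix x s n assume x: "x \<in> space paths"
    show "mass (margins i j \<Omega>) x s n \<le> ennreal (mass_const ^ (i + j) * C / r ^ (i + j) * r ^ n)"
    proof (cases "i + j \<le> n")
      case False
      then have "mass (margins i j \<Omega>) x s n = (\<integral>\<^sup>+w. 0 \<partial>Words n)"
        unfolding mass_def by (intro nn_integral_cong) (auto simp: indicator_def margins_def words_def)
      then show ?thesis by simp
    next
      case True
      define k where "k = n - i - j"
      have n: "n = i + (k + j)" using True by (simp add: k_def)
      let ?s1 = "s + int i" and ?s2 = "s + int i + int k"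
      have "mass (margins i j \<Omega>) x s n =
        (\<integral>\<^sup>+u. \<integral>\<^sup>+m. \<integral>\<^sup>+v. indicator (margins i j \<Omega>) (u @ m @ v) * ennreal (wlik x s (u @ m @ v))
           \<partial>Words j \<partial>Words k \<partial>Words i)"
        unfolding mass_def n nn_integral_words_add ..
      also have "\<dots> = (\<integral>\<^sup>+u. \<integral>\<^sup>+m. \<integral>\<^sup>+v. ennreal (wlik x s u) * ((indicator \<Omega> m * ennreal (wlik x ?s1 m)) * ennreal (wlik x ?s2 v))
           \<partial>Words j \<partial>Words k \<partial>Words i)"
      proof (intro nn_integral_cong)
        fix u m v assume "u \<in> space (Words i)" "m \<in> space (Words k)"
          "v \<in> space (Words j)"
        then have l: "length u = i" "length m = k" "length v = j" by (auto simp: words_def)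
        have "u @ m @ v \<in> margins i j \<Omega> \<longleftrightarrow> m \<in> \<Omega>"
        proof
          assume "u @ m @ v \<in> margins i j \<Omega>"
          then obtain u' m' v' where e: "u @ m @ v = u' @ m' @ v'" "length u' = i" "m' \<in> \<Omega>" "length v' = j"
            unfolding margins_def by blast
          have "m @ v = m' @ v'" using e l by simp
          then show "m \<in> \<Omega>" using e l by simp
        qed (use l in \<open>auto simp: margins_def\<close>)
        then have 1: "indicator (margins i j \<Omega>) (u @ m @ v) = (indicator \<Omega> m :: ennreal)"
          by (simp add: indicator_def)
        have 2: "ennreal (wlik x s (u @ m @ v)) = ennreal (wlik x s u) * (ennreal (wlik x ?s1 m) * ennreal (wlik x ?s2 v))"
          using l by (simp only: wlik_append[OF x] ennreal_mult[OF wlik_nonneg[OF x] wlik_nonneg[OF x]]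
             ennreal_mult[OF wlik_nonneg[OF x] mult_nonneg_nonneg[OF wlik_nonneg[OF x] wlik_nonneg[OF x]]])
        show "indicator (margins i j \<Omega>) (u @ m @ v) * ennreal (wlik x s (u @ m @ v)) =
           ennreal (wlik x s u) * ((indicator \<Omega> m * ennreal (wlik x ?s1 m)) * ennreal (wlik x ?s2 v))"
          unfolding 1 2 by (simp only: mult_ac)
      qed
      also have "\<dots> = (\<integral>\<^sup>+u. ennreal (wlik x s u) \<partial>Words i) *
          (mass \<Omega> x ?s1 k * (\<integral>\<^sup>+v. ennreal (wlik x ?s2 v) \<partial>Words j))"
        unfolding mass_def
        by (subst nn_integral_cmult, simp, subst nn_integral_cmult, simp, subst nn_integral_cmult, simp,
            subst nn_integral_multc, simp, subst nn_integral_multc, simp, rule refl)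
      also have "\<dots> \<le> ennreal (mass_const ^ i) * (ennreal (C * r ^ k) * ennreal (mass_const ^ j))"
        by (intro mult_mono nn_wlik_le x C) auto
      also have "\<dots> = ennreal (mass_const ^ (i + j) * C / r ^ (i + j) * r ^ n)"
        using C mass_const_ge_1 by (simp add: ennreal_mult[symmetric] n power_add field_simps)
      finally show ?thesis .
    qed
  qed
qed

text \<open>Only the length \<open>k\<close> has mass, so any rate will do. The entropy of a single
  output thereby becomes a series of the same kind as the others.\<close>

lemma decaying_words: "decaying (words k)"
  unfolding decaying_def
proof (intro exI conjI ballI allI)
  show "0 \<le> mass_const ^ k * 2 ^ k" "0 < 1 / (2::real)" "1 / (2::real) < 1" using mass_const_ge_1 by auto
  fix x s n assume x: "x \<in> space paths"
  show "mass (words k) x s n \<le> ennreal (mass_const ^ k * 2 ^ k * (1 / 2) ^ n)"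
  proof (cases "n = k")
    case True
    then show ?thesis using mass_le[OF x, of "words k" s n] by (simp add: power_divide)
  next
    case False
    then have "mass (words k) x s n = (\<integral>\<^sup>+w. 0 \<partial>Words n)"
      unfolding mass_def by (intro nn_integral_cong) (auto simp: indicator_def words_def)
    then show ?thesis by simp
  qed
qed

text \<open>A majorant of weighted likelihoods that is free of the path, from
  \<open>z ^ y / fact y \<le> zmax ^ y / fact y\<close>. It is summable over each single length, but
  the sum grows with the length, so it serves dominated convergence within a length only.\<close>

definition env :: "nat list \<Rightarrow> real" where
  "env w = prod_list (map (\<lambda>y. exp zmax * (pois zmax y * theta y)) w)"

lemma wlik_le_env:
  assumes x: "x \<in> space paths"
  shows "wlik x s w \<le> env w"
proof (induction w arbitrary: s)
  case (Cons a w)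
  have "pois (Z x s) a \<le> exp zmax * pois zmax a"
  proof -
    have "Z x s ^ a * exp (- Z x s) \<le> zmax ^ a * 1"
      using Z_bounds[OF x, of s] Z_nonneg[OF x, of s] by (intro mult_mono power_mono) auto
    then have "pois (Z x s) a \<le> zmax ^ a / fact a"
      unfolding pois_def by (simp add: divide_right_mono)
    also have "t ^ a / fact a = exp t * pois t a" for t :: real
      by (simp add: pois_def exp_minus)
    finally show ?thesis .
  qed
  then have "wlik x s [a] \<le> exp zmax * (pois zmax a * theta a)"
    using theta_ge_1[of a] x by (simp add: wlik_def mult_right_mono flip: mult.assoc)
  then have "wlik x s [a] * wlik x (s + 1) w \<le> env (a # w)"
    using Cons[of "s + 1"] wlik_nonneg[OF x] unfolding env_def
    by (simp) (intro mult_mono, auto intro: order_trans[OF wlik_nonneg[OF x]])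
  then show ?case using wlik_append[OF x, of s "[a]" w] by simp
qed (use x in \<open>simp add: wlik_def env_def\<close>)

lemma env_nonneg: "env w \<ge> 0"
  using lam0_pos A_nonneg unfolding env_def
  by (induction w) (auto intro!: mult_nonneg_nonneg pois_nonneg order_trans[OF zero_le_one theta_ge_1])

lemma nn_env_finite: "(\<integral>\<^sup>+w. ennreal (env w) \<partial>Words n) < \<infinity>"
proof -
  have z: "lam0 \<le> zmax" "zmax \<ge> 0" using A_nonneg lam0_pos by auto
  have nn: "pois zmax a * theta a \<ge> 0" for a
    using z by (intro mult_nonneg_nonneg pois_nonneg order_trans[OF zero_le_one theta_ge_1]) auto
  have "(\<integral>\<^sup>+a. ennreal (exp zmax * (pois zmax a * theta a)) \<partial>count_space UNIV)
     = ennreal (exp zmax) * (\<integral>\<^sup>+a. ennreal (pois zmax a * theta a) \<partial>count_space UNIV)"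
    using nn by (simp add: ennreal_mult nn_integral_cmult)
  also have "\<dots> \<le> ennreal (exp zmax) * ennreal mass_const"
    by (intro mult_left_mono nn_pois_theta z) auto
  also have "\<dots> < \<infinity>" by (simp add: ennreal_mult_less_top)
  finally show ?thesis
    unfolding env_def using nn by (subst nn_integral_words_prod_list) (auto simp: power_less_top_ennreal)
qed

lemma integrable_env: "integrable (Words n) env"
  using nn_env_finite[of n] env_nonneg by (intro integrableI_nonneg) auto

end

section \<open>Derivatives along mixtures\<close>

lemma measurable_law: "G \<in> input_laws A \<Longrightarrow> f \<in> borel_measurable (amplitudes A) \<Longrightarrow> f \<in> borel_measurable G"
  by (metis measurable_cong_sets sets_law)

lemma continuous_on_measurable_amplitudes:
  "continuous_on {0..A} f \<Longrightarrow> f \<in> borel_measurable (amplitudes A)"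
  for f :: "real \<Rightarrow> real"
  unfolding amplitudes_def by (rule borel_measurable_continuous_on_restrict)

lemma integrable_law_bounded:
  fixes f :: "real \<Rightarrow> real"
  assumes "G \<in> input_laws A" "f \<in> borel_measurable (amplitudes A)" "\<And>y. y \<in> {0..A} \<Longrightarrow> \<bar>f y\<bar> \<le> B"
  shows "integrable G f"
  using assms by (intro integrable_bounded_prob[where B=B] prob_law[OF assms(1)] measurable_law[OF assms(1)])
    (simp_all add: space_law[OF assms(1)])

lemma integrable_law_continuous:
  fixes f :: "real \<Rightarrow> real"
  assumes "G \<in> input_laws A" "continuous_on {0..A} f"
  shows "integrable G f"
proof -
  have "compact (f ` {0..A})" by (intro compact_continuous_image assms compact_Icc)
  then obtain B where "\<forall>z\<in>f ` {0..A}. norm z \<le> B"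
    using compact_imp_bounded bounded_iff by metis
  then have "\<And>y. y \<in> {0..A} \<Longrightarrow> \<bar>f y\<bar> \<le> B" by simp
  then show ?thesis
    by (intro integrable_law_bounded[OF assms(1)] continuous_on_measurable_amplitudes assms)
qed

section \<open>First variation of expectations under product laws\<close>

abbreviation PF :: "real measure \<Rightarrow> (int \<Rightarrow> real) measure" where
  "PF F \<equiv> PiM UNIV (\<lambda>_. F)"

definition expect :: "real measure \<Rightarrow> ((int \<Rightarrow> real) \<Rightarrow> real) \<Rightarrow> real" where
  "expect F f = (\<integral>x. f x \<partial>PF F)"

definition replaced :: "real measure \<Rightarrow> int \<Rightarrow> ((int \<Rightarrow> real) \<Rightarrow> real) \<Rightarrow> real \<Rightarrow> real" where
  "replaced F i f y = (\<integral>x. f (x(i := y)) \<partial>PF F)"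

text \<open>The product rule for the i.i.d. law: one term for each of the \<open>n\<close>
  coordinates read by \<open>f\<close>, in which that coordinate alone is replaced by the point
  \<open>y\<close>.\<close>

definition expect_deriv :: "real measure \<Rightarrow> int \<Rightarrow> nat \<Rightarrow> ((int \<Rightarrow> real) \<Rightarrow> real) \<Rightarrow> real \<Rightarrow> real" where
  "expect_deriv F a n f y = (\<Sum>j<n. replaced F (a + int j) f y - expect F f)"

definition hybrid :: "real measure \<Rightarrow> real measure \<Rightarrow> real \<Rightarrow> int \<Rightarrow> int \<Rightarrow> real measure" where
  "hybrid F G \<epsilon> i k = (if k < i then mixture \<epsilon> F G else F)"

text \<open>The law of a path is moved from \<open>F\<close> to the mixture one coordinate at a time, from left to right.\<close>

context
  fixes A \<epsilon> B :: real and F G :: "real measure" and f :: "(int \<Rightarrow> real) \<Rightarrow> real" and a :: int and n :: nat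
  assumes F: "F \<in> input_laws A" and G: "G \<in> input_laws A" and \<epsilon>: "0 \<le> \<epsilon>" "\<epsilon> \<le> 1"
    and f: "f \<in> borel_measurable (input_paths A)" and B: "\<And>x. x \<in> space (input_paths A) \<Longrightarrow> \<bar>f x\<bar> \<le> B"
    and dep: "depends_on (space (input_paths A)) {a..<a + int n} f"
begin

lemma hybrid_law: "hybrid F G \<epsilon> i k \<in> input_laws A"
  using mixture_in_input_laws[OF F G \<epsilon>] F by (simp add: hybrid_def)

lemma hybrid_prob: "prob_space (PiM UNIV (hybrid F G \<epsilon> i))"
  by (rule prob_PiM_laws[OF hybrid_law])

lemma hybrid_inner_bound:
  assumes "y \<in> {0..A}"
  shows "\<bar>\<integral>x. f (x(j := y)) \<partial>PiM UNIV (hybrid F G \<epsilon> i)\<bar> \<le> B"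
  using assms space_PiM_laws[where M="hybrid F G \<epsilon> i", OF hybrid_law]
  by (intro integral_bounded_prob hybrid_prob B upd_in_space) simp_all

lemma hybrid_inner_measurable:
  "(\<lambda>y. \<integral>x. f (x(j := y)) \<partial>PiM UNIV (hybrid F G \<epsilon> i)) \<in> borel_measurable (amplitudes A)"
  by (rule measurable_integral_upd[OF hybrid_law f])

text \<open>Consecutive hybrids differ in the law of one coordinate only, and the integral is affine
  in that law.\<close>

lemma hybrid_step:
  "(\<integral>x. f x \<partial>PiM UNIV (hybrid F G \<epsilon> (i + 1))) - (\<integral>x. f x \<partial>PiM UNIV (hybrid F G \<epsilon> i)) =
    \<epsilon> * ((\<integral>y. \<integral>x. f (x(i := y)) \<partial>PiM UNIV (hybrid F G \<epsilon> i) \<partial>G) -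
         (\<integral>y. \<integral>x. f (x(i := y)) \<partial>PiM UNIV (hybrid F G \<epsilon> i) \<partial>F))"
proof -
  let ?T = "hybrid F G \<epsilon> i"
  let ?r = "\<lambda>y. \<integral>x. f (x(i := y)) \<partial>PiM UNIV ?T"
  have 1: "hybrid F G \<epsilon> (i + 1) = ?T(i := mixture \<epsilon> F G)" and 2: "?T = ?T(i := F)"
    by (auto simp: hybrid_def fun_eq_iff)
  have "(\<integral>x. f x \<partial>PiM UNIV (hybrid F G \<epsilon> (i + 1))) = (\<integral>y. ?r y \<partial>mixture \<epsilon> F G)"
    unfolding 1 by (rule integral_upd[OF hybrid_law mixture_in_input_laws[OF F G \<epsilon>] f B])
  also have "\<dots> = (1 - \<epsilon>) * (\<integral>y. ?r y \<partial>F) + \<epsilon> * (\<integral>y. ?r y \<partial>G)"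
    by (rule integral_mixture[OF F G \<epsilon> hybrid_inner_measurable hybrid_inner_bound])
  finally have e: "(\<integral>x. f x \<partial>PiM UNIV (hybrid F G \<epsilon> (i + 1))) =
     (1 - \<epsilon>) * (\<integral>y. ?r y \<partial>F) + \<epsilon> * (\<integral>y. ?r y \<partial>G)" .
  have "(\<integral>x. f x \<partial>PiM UNIV (?T(i := F))) = (\<integral>y. ?r y \<partial>F)"
    by (rule integral_upd[OF hybrid_law F f B])
  with e show ?thesis unfolding 2[symmetric] by (simp add: algebra_simps)
qed

lemma hybrid_integral_bound:
  assumes "H \<in> input_laws A"
  shows "\<bar>\<integral>y. \<integral>x. f (x(i := y)) \<partial>PiM UNIV (hybrid F G \<epsilon> i) \<partial>H\<bar> \<le> B"
  using assms by (intro integral_bounded_prob[OF prob_law[OF assms]] hybrid_inner_bound)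
    (simp add: space_law[OF assms])

text \<open>Left of \<open>a\<close> the hybrid carries the mixture, but \<open>f\<close> does not
  read these coordinates.\<close>

lemma hybrid_start: "(\<integral>x. f x \<partial>PiM UNIV (hybrid F G \<epsilon> a)) = expect F f"
  unfolding expect_def
  by (rule integral_depends_on[OF hybrid_law F f B dep]) (auto simp: hybrid_def)

lemma hybrid_end: "(\<integral>x. f x \<partial>PiM UNIV (hybrid F G \<epsilon> (a + int n))) = expect (mixture \<epsilon> F G) f"
  unfolding expect_def
  by (rule integral_depends_on[OF hybrid_law mixture_in_input_laws[OF F G \<epsilon>] f B dep])
    (auto simp: hybrid_def)

text \<open>Each step moves the integral by at most \<open>2 * B * \<epsilon>\<close>. This is what
  later replaces the hybrid laws by \<open>F\<close> in the limit.\<close>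

lemma hybrid_dist:
  "\<bar>(\<integral>x. f x \<partial>PiM UNIV (hybrid F G \<epsilon> (a + int m))) - expect F f\<bar> \<le> 2 * B * \<epsilon> * real m"
proof (induction m)
  case 0
  then show ?case by (simp add: hybrid_start)
next
  case (Suc m)
  have "\<bar>(\<integral>x. f x \<partial>PiM UNIV (hybrid F G \<epsilon> (a + int m + 1))) - (\<integral>x. f x \<partial>PiM UNIV (hybrid F G \<epsilon> (a + int m)))\<bar>
     \<le> \<epsilon> * (2 * B)"
    unfolding hybrid_step abs_mult
    using \<epsilon> hybrid_integral_bound[OF G, of "a + int m"] hybrid_integral_bound[OF F, of "a + int m"]
    by (intro mult_mono) auto
  moreover have "a + int (Suc m) = a + int m + 1" by simp
  ultimately show ?case using Suc by (simp add: algebra_simps)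
qed

text \<open>Telescoping gives an identity for every \<epsilon>, without remainder; the dominations
  uniform in \<epsilon> rest on it.\<close>

lemma expect_mixture_diff:
  "expect (mixture \<epsilon> F G) f - expect F f =
    \<epsilon> * (\<Sum>j<n. (\<integral>y. \<integral>x. f (x(a + int j := y)) \<partial>PiM UNIV (hybrid F G \<epsilon> (a + int j)) \<partial>G) -
         (\<integral>y. \<integral>x. f (x(a + int j := y)) \<partial>PiM UNIV (hybrid F G \<epsilon> (a + int j)) \<partial>F))"
proof -
  let ?V = "\<lambda>m. \<integral>x. f x \<partial>PiM UNIV (hybrid F G \<epsilon> (a + int m))"
  have "?V n - ?V 0 = (\<Sum>j<n. ?V (Suc j) - ?V j)" by (rule sum_lessThan_telescope[symmetric])
  moreover have "a + int (Suc j) = a + int j + 1" for j by simp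
  ultimately show ?thesis
    using hybrid_start hybrid_end by (simp only: hybrid_step sum_distrib_left of_nat_0 add_0_right)
qed

end

lemma depends_on_upd:
  assumes "depends_on (space (input_paths A)) K f" "y \<in> {0..A}"
  shows "depends_on (space (input_paths A)) K (\<lambda>x. f (x(i := y)))"
  unfolding depends_on_def
proof (intro ballI impI)
  fix u v assume "u \<in> space (input_paths A)" "v \<in> space (input_paths A)" "\<forall>k\<in>K. u k = v k"
  then show "f (u(i := y)) = f (v(i := y))"
    by (intro assms(1)[unfolded depends_on_def, rule_format] upd_in_space assms(2)) simp_all
qed

context
  fixes A B :: real and F :: "real measure" and f :: "(int \<Rightarrow> real) \<Rightarrow> real" and a :: int and n :: nat
  assumes F: "F \<in> input_laws A"
    and f: "f \<in> borel_measurable (input_paths A)" and B: "\<And>x. x \<in> space (input_paths A) \<Longrightarrow> \<bar>f x\<bar> \<le> B"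
begin

lemma replaced_bound: "y \<in> {0..A} \<Longrightarrow> \<bar>replaced F i f y\<bar> \<le> B"
  unfolding replaced_def
  by (intro integral_bounded_prob prob_PiM_laws[OF F] B upd_in_space)
    (simp_all add: space_PiM_laws[of "\<lambda>_. F", OF F])

lemma replaced_measurable: "replaced F i f \<in> borel_measurable (amplitudes A)"
  unfolding replaced_def[abs_def] by (rule measurable_integral_upd[OF F f])

lemma integral_replaced_self: "(\<integral>y. replaced F i f y \<partial>F) = expect F f"
proof -
  have "(\<lambda>_::int. F)(i := F) = (\<lambda>_. F)" by auto
  then show ?thesis
    using integral_upd[where M="\<lambda>_. F" and j=i, OF F F f B] by (simp add: replaced_def expect_def)
qed

lemma integral_expect_deriv:
  assumes G: "G \<in> input_laws A"
  shows "(\<integral>y. expect_deriv F a n f y \<partial>G) = (\<Sum>j<n. (\<integral>y. replaced F (a + int j) f y \<partial>G) - expect F f)"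
proof -
  interpret G: prob_space G by (rule prob_law[OF G])
  have "integrable G (replaced F i f)" for i
    by (rule integrable_law_bounded[OF G replaced_measurable replaced_bound])
  then show ?thesis
    unfolding expect_deriv_def by (subst Bochner_Integration.integral_sum) (simp_all add: G.prob_space)
qed

lemma expect_mixture_tendsto:
  assumes dep: "depends_on (space (input_paths A)) {a..<a + int n} f" and G: "G \<in> input_laws A"
  shows "((\<lambda>\<epsilon>. (expect (mixture \<epsilon> F G) f - expect F f) / \<epsilon>) \<longlongrightarrow> (\<integral>y. expect_deriv F a n f y \<partial>G)) (at_right 0)"
proof -
  let ?r = "\<lambda>\<epsilon> j y. \<integral>x. f (x(a + int j := y)) \<partial>PiM UNIV (hybrid F G \<epsilon> (a + int j))"
  have close: "\<bar>(\<integral>y. ?r \<epsilon> j y \<partial>H) - (\<integral>y. replaced F (a + int j) f y \<partial>H)\<bar> \<le> 2 * B * \<epsilon> * real j"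
    if H: "H \<in> input_laws A" and \<epsilon>: "0 \<le> \<epsilon>" "\<epsilon> \<le> 1" for H \<epsilon> j
  proof -
    have 1: "integrable H (?r \<epsilon> j)"
      by (rule integrable_law_bounded[OF H hybrid_inner_measurable[OF F G \<epsilon> f B dep] hybrid_inner_bound[OF F G \<epsilon> f B dep]])
    have 2: "integrable H (replaced F (a + int j) f)"
      by (rule integrable_law_bounded[OF H replaced_measurable replaced_bound])
    have "\<bar>\<integral>y. ?r \<epsilon> j y - replaced F (a + int j) f y \<partial>H\<bar> \<le> 2 * B * \<epsilon> * real j"
    proof (rule integral_bounded_prob[OF prob_law[OF H]])
      fix y assume "y \<in> space H"
      then have y: "y \<in> {0..A}" using space_law[OF H] by simp
      \<comment> \<open>With the coordinate frozen at \<open>y\<close> the integrand is again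
        bounded and local, so \<open>hybrid_dist\<close> applies to it.\<close>
      have "\<bar>?r \<epsilon> j y - expect F (\<lambda>x. f (x(a + int j := y)))\<bar> \<le> 2 * B * \<epsilon> * real j"
        by (rule hybrid_dist[OF F G \<epsilon> measurable_upd_const[OF f y] B[OF upd_in_space[OF _ y]] depends_on_upd[OF dep y]])
      then show "\<bar>?r \<epsilon> j y - replaced F (a + int j) f y\<bar> \<le> 2 * B * \<epsilon> * real j"
        by (simp add: expect_def replaced_def)
    qed
    then show ?thesis by (simp add: Bochner_Integration.integral_diff[OF 1 2])
  qed
  have lim: "((\<lambda>\<epsilon>. \<integral>y. ?r \<epsilon> j y \<partial>H) \<longlongrightarrow> (\<integral>y. replaced F (a + int j) f y \<partial>H)) (at_right 0)"
    if H: "H \<in> input_laws A" for H j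
  proof (rule Lim_null[THEN iffD2], rule Lim_null_comparison)
    show "\<forall>\<^sub>F \<epsilon> in at_right 0. norm ((\<integral>y. ?r \<epsilon> j y \<partial>H) - (\<integral>y. replaced F (a + int j) f y \<partial>H)) \<le> 2 * B * \<epsilon> * real j"
      using close[OF H] eventually_at_right_real[of 0 1]
      by (auto elim!: eventually_mono)
    show "((\<lambda>\<epsilon>. 2 * B * \<epsilon> * real j) \<longlongrightarrow> 0) (at_right 0)"
      by (auto intro!: tendsto_eq_intros)
  qed
  have "((\<lambda>\<epsilon>. \<Sum>j<n. (\<integral>y. ?r \<epsilon> j y \<partial>G) - (\<integral>y. ?r \<epsilon> j y \<partial>F)) \<longlongrightarrow>
     (\<Sum>j<n. (\<integral>y. replaced F (a + int j) f y \<partial>G) - (\<integral>y. replaced F (a + int j) f y \<partial>F))) (at_right 0)"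
    by (intro tendsto_sum tendsto_diff lim F G)
  \<comment> \<open>Integrating \<open>replaced\<close> against \<open>F\<close> itself gives back
    \<open>expect F f\<close>, the centring term of \<open>expect_deriv\<close>.\<close>
  then have "((\<lambda>\<epsilon>. \<Sum>j<n. (\<integral>y. ?r \<epsilon> j y \<partial>G) - (\<integral>y. ?r \<epsilon> j y \<partial>F)) \<longlongrightarrow>
     (\<integral>y. expect_deriv F a n f y \<partial>G)) (at_right 0)"
    by (simp add: integral_expect_deriv[OF G] integral_replaced_self)
  then show ?thesis
  proof (rule Lim_transform_eventually)
    have "(\<Sum>j<n. (\<integral>y. ?r \<epsilon> j y \<partial>G) - (\<integral>y. ?r \<epsilon> j y \<partial>F)) = (expect (mixture \<epsilon> F G) f - expect F f) / \<epsilon>"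
      if "\<epsilon> \<in> {0<..<1}" for \<epsilon>
      using that by (subst expect_mixture_diff[OF F G _ _ f B dep]) auto
    then show "\<forall>\<^sub>F \<epsilon> in at_right 0. (\<Sum>j<n. (\<integral>y. ?r \<epsilon> j y \<partial>G) - (\<integral>y. ?r \<epsilon> j y \<partial>F)) =
       (expect (mixture \<epsilon> F G) f - expect F f) / \<epsilon>"
      using eventually_at_right_real[of 0 1] by (auto elim!: eventually_mono)
  qed
qed

lemma continuous_on_replaced:
  assumes cont: "\<And>x. x \<in> space (input_paths A) \<Longrightarrow> continuous_on {0..A} (\<lambda>y. f (x(i := y)))"
  shows "continuous_on {0..A} (replaced F i f)"
proof (rule continuous_on_sequentiallyI)
  fix u :: "nat \<Rightarrow> real" and y assume u: "\<forall>m. u m \<in> {0..A}" "y \<in> {0..A}" "u \<longlonglongrightarrow> y"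
  have s: "sets (PF F) = sets (input_paths A)" by (rule sets_PiM_laws[OF F])
  have sp: "space (PF F) = space (input_paths A)" by (rule space_PiM_laws[OF F])
  have m: "(\<lambda>x. f (x(i := z))) \<in> borel_measurable (PF F)" if "z \<in> {0..A}" for z
    using measurable_upd_const[OF f that] by (simp add: measurable_cong_sets[OF s refl])
  show "(\<lambda>m. replaced F i f (u m)) \<longlonglongrightarrow> replaced F i f y"
    unfolding replaced_def
  proof (rule integral_dominated_convergence[where w="\<lambda>_. B"])
    interpret P: prob_space "PF F" by (rule prob_PiM_laws[OF F])
    show "integrable (PF F) (\<lambda>_. B)" by simp
    show "AE x in PF F. (\<lambda>m. f (x(i := u m))) \<longlonglongrightarrow> f (x(i := y))"
    proof (rule AE_I2)
      fix x assume "x \<in> space (PF F)"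
      then have "continuous_on {0..A} (\<lambda>y. f (x(i := y)))" using cont sp by simp
      then show "(\<lambda>m. f (x(i := u m))) \<longlonglongrightarrow> f (x(i := y))"
        using continuous_on_tendsto_compose[OF _ u(3,2)] u(1) by auto
    qed
    show "AE x in PF F. norm (f (x(i := u m))) \<le> B" for m
      using u(1) by (intro AE_I2) (auto simp: sp intro!: B upd_in_space)
  qed (use m u in auto)
qed

lemma continuous_on_expect_deriv:
  assumes cont: "\<And>x i. x \<in> space (input_paths A) \<Longrightarrow> continuous_on {0..A} (\<lambda>y. f (x(i := y)))"
  shows "continuous_on {0..A} (expect_deriv F a n f)"
  unfolding expect_deriv_def[abs_def]
  by (intro continuous_intros continuous_on_replaced cont)

end

text \<open>One continuous function represents the one-sided derivatives in all directions at once.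
  Point masses recover its values, and two-point laws or \<open>F\<close> itself may serve as
  directions too.\<close>

definition gateaux :: "real \<Rightarrow> real measure \<Rightarrow> (real measure \<Rightarrow> real) \<Rightarrow> (real \<Rightarrow> real) \<Rightarrow> bool" where
  "gateaux A F \<Psi> \<psi> \<longleftrightarrow> continuous_on {0..A} \<psi> \<and>
     (\<forall>G\<in>input_laws A. ((\<lambda>\<epsilon>. (\<Psi> (mixture \<epsilon> F G) - \<Psi> F) / \<epsilon>) \<longlongrightarrow> (\<integral>y. \<psi> y \<partial>G)) (at_right 0))"

lemma gateaux_add:
  assumes "gateaux A F \<Psi>1 \<psi>1" "gateaux A F \<Psi>2 \<psi>2"
  shows "gateaux A F (\<lambda>G. \<Psi>1 G + \<Psi>2 G) (\<lambda>y. \<psi>1 y + \<psi>2 y)"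
  unfolding gateaux_def
proof (intro conjI ballI)
  have c: "continuous_on {0..A} \<psi>1" "continuous_on {0..A} \<psi>2" using assms by (auto simp: gateaux_def)
  then show "continuous_on {0..A} (\<lambda>y. \<psi>1 y + \<psi>2 y)" by (intro continuous_intros)
  fix G assume G: "G \<in> input_laws A"
  have "((\<lambda>\<epsilon>. (\<Psi>1 (mixture \<epsilon> F G) - \<Psi>1 F) / \<epsilon> + (\<Psi>2 (mixture \<epsilon> F G) - \<Psi>2 F) / \<epsilon>) \<longlongrightarrow>
      (\<integral>y. \<psi>1 y \<partial>G) + (\<integral>y. \<psi>2 y \<partial>G)) (at_right 0)"
    using assms G by (intro tendsto_add) (auto simp: gateaux_def)
  then show "((\<lambda>\<epsilon>. (\<Psi>1 (mixture \<epsilon> F G) + \<Psi>2 (mixture \<epsilon> F G) - (\<Psi>1 F + \<Psi>2 F)) / \<epsilon>) \<longlongrightarrow>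
      (\<integral>y. \<psi>1 y + \<psi>2 y \<partial>G)) (at_right 0)"
    using integrable_law_continuous[OF G c(1)] integrable_law_continuous[OF G c(2)]
    by (simp add: add_divide_distrib[symmetric] algebra_simps)
qed

lemma gateaux_uminus:
  assumes "gateaux A F \<Psi> \<psi>"
  shows "gateaux A F (\<lambda>G. - \<Psi> G) (\<lambda>y. - \<psi> y)"
  unfolding gateaux_def
proof (intro conjI ballI)
  show "continuous_on {0..A} (\<lambda>y. - \<psi> y)"
    using assms by (intro continuous_intros) (auto simp: gateaux_def)
  fix G assume G: "G \<in> input_laws A"
  have "((\<lambda>\<epsilon>. - ((\<Psi> (mixture \<epsilon> F G) - \<Psi> F) / \<epsilon>)) \<longlongrightarrow> - (\<integral>y. \<psi> y \<partial>G)) (at_right 0)"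
    using assms G by (intro tendsto_minus) (auto simp: gateaux_def)
  then show "((\<lambda>\<epsilon>. (- \<Psi> (mixture \<epsilon> F G) - - \<Psi> F) / \<epsilon>) \<longlongrightarrow> (\<integral>y. - \<psi> y \<partial>G)) (at_right 0)"
    by (simp add: minus_divide_left)
qed

lemma gateaux_expect:
  assumes F: "F \<in> input_laws A" and f: "f \<in> borel_measurable (input_paths A)"
    and B: "\<And>x. x \<in> space (input_paths A) \<Longrightarrow> \<bar>f x\<bar> \<le> B"
    and dep: "depends_on (space (input_paths A)) {a..<a + int n} f"
    and cont: "\<And>x i. x \<in> space (input_paths A) \<Longrightarrow> continuous_on {0..A} (\<lambda>y. f (x(i := y)))"
  shows "gateaux A F (\<lambda>G. expect G f) (expect_deriv F a n f)"
  unfolding gateaux_def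
  using continuous_on_expect_deriv[OF F f B cont] expect_mixture_tendsto[OF F f B dep] by blast

section \<open>Derivatives of entropy series\<close>

text \<open>Dominated convergence within each length by \<open>e n\<close>, then Tannery's theorem
  over the lengths by \<open>\<kappa>\<close>. The dominations are separate because the integrals of
  the \<open>e n\<close> are not assumed summable.\<close>

lemma tannery_blocks:
  fixes u :: "nat \<Rightarrow> 'w \<Rightarrow> real" and S :: "nat \<Rightarrow> 'w set"
  assumes e: "\<And>n. integrable (count_space (S n)) (e n)"
    and ub: "\<And>m n w. w \<in> S n \<Longrightarrow> \<bar>u m w\<bar> \<le> e n w"
    and kap: "\<And>m n. (\<integral>w. \<bar>u m w\<bar> \<partial>count_space (S n)) \<le> \<kappa> n" "summable \<kappa>"
    and lim: "\<And>n w. w \<in> S n \<Longrightarrow> (\<lambda>m. u m w) \<longlonglongrightarrow> v w"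
  shows "summable (\<lambda>n. \<integral>w. v w \<partial>count_space (S n))"
    and "(\<lambda>m. \<Sum>n. \<integral>w. u m w \<partial>count_space (S n)) \<longlonglongrightarrow> (\<Sum>n. \<integral>w. v w \<partial>count_space (S n))"
proof -
  have 1: "(\<lambda>m. \<integral>w. u m w \<partial>count_space (S n)) \<longlonglongrightarrow> (\<integral>w. v w \<partial>count_space (S n))" for n
    by (rule integral_dominated_convergence[where w="e n"])
      (use e ub lim in \<open>auto intro!: AE_I2\<close>)
  have 2: "norm (\<integral>w. u m w \<partial>count_space (S n)) \<le> \<kappa> n" for m n
    unfolding real_norm_def by (rule order_trans[OF integral_abs_bound kap(1)])
  have "\<forall>\<^sub>F (n, m) in sequentially \<times>\<^sub>F sequentially. norm (\<integral>w. u m w \<partial>count_space (S n)) \<le> \<kappa> n"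
    using 2 by (intro always_eventually) auto
  note T = tannerys_theorem[OF 1 this kap(2)]
  show "summable (\<lambda>n. \<integral>w. v w \<partial>count_space (S n))"
    using T by (auto intro: summable_norm_cancel)
  show "(\<lambda>m. \<Sum>n. \<integral>w. u m w \<partial>count_space (S n)) \<longlonglongrightarrow> (\<Sum>n. \<integral>w. v w \<partial>count_space (S n))"
    using T by auto
qed

lemma summable_linear_geometric:
  fixes r :: real
  assumes "0 < r" "r < 1"
  shows "summable (\<lambda>n. (a + b * real n) * r ^ n)"
proof -
  have "summable (\<lambda>n. (a - b) * r ^ n + b * (real (Suc n) * r ^ n))"
    using assms geometric_deriv_sums[of r]
    by (intro summable_add summable_mult summable_geometric) (auto simp: sums_iff)
  then show ?thesis by (simp add: algebra_simps)
qed

section \<open>The function \<open>t ln t\<close> away from zero\<close>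

definition eta :: "real \<Rightarrow> real" where "eta t = t * ln t"

text \<open>On the interval from \<open>exp (- l)\<close> to 1 the derivative
  \<open>1 + ln t\<close> has absolute value at most \<open>1 + l\<close>. With \<open>l\<close> the
  cost of a word, changes of \<open>eta\<close> are controlled by changes of the
  probability.\<close>

lemma eta_lipschitz:
  assumes "exp (- l) \<le> s" "s \<le> 1" "exp (- l) \<le> t" "t \<le> 1" "l \<ge> 0"
  shows "\<bar>eta s - eta t\<bar> \<le> (1 + l) * \<bar>s - t\<bar>"
proof -
  have d: "(eta has_field_derivative (1 + ln x)) (at x within {exp (- l)..1})" if "x \<in> {exp (- l)..1}" for x
  proof -
    have "x > 0" using that exp_gt_zero[of "- l"] by (meson atLeastAtMost_iff less_le_trans)
    then show ?thesis unfolding eta_def[abs_def] by (auto intro!: derivative_eq_intros)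
  qed
  have b: "norm (1 + ln x) \<le> 1 + l" if "x \<in> {exp (- l)..1}" for x
  proof -
    have x0: "x > 0" using that exp_gt_zero[of "- l"] by (meson atLeastAtMost_iff less_le_trans)
    have "- l \<le> ln x" "ln x \<le> 0" using that x0 by (auto simp: ln_ge_iff)
    then show ?thesis using assms(5) by auto
  qed
  have "norm (eta s - eta t) \<le> (1 + l) * norm (s - t)"
    by (rule field_differentiable_bound[of "{exp (- l)..1}" eta "\<lambda>x. 1 + ln x"])
      (use d b assms in auto)
  then show ?thesis by simp
qed

lemma eta_abs_le:
  assumes "exp (- l) \<le> t" "t \<le> 1"
  shows "\<bar>eta t\<bar> \<le> t * l"
proof -
  have t: "t > 0" using assms(1) exp_gt_zero[of "- l"] by linarith
  have "- l \<le> ln t" "ln t \<le> 0" using assms t by (auto simp: ln_ge_iff)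
  moreover have "t * (- ln t) \<le> t * l" using calculation t by (intro mult_left_mono) auto
  ultimately show ?thesis using t by (simp add: eta_def abs_mult)
qed

context poisson_isi
begin

section \<open>Likelihoods averaged over product laws\<close>

lemma measurable_Z [measurable]: "(\<lambda>x. Z x k) \<in> borel_measurable paths"
proof -
  have [measurable]: "(\<lambda>x. x i) \<in> borel_measurable paths" for i :: int
  proof -
    have "(\<lambda>x. x i) \<in> paths \<rightarrow>\<^sub>M amplitudes A"
      unfolding input_paths_def by measurable
    then show ?thesis
      by (simp add: amplitudes_def measurable_restrict_space2_iff)
  qed
  show ?thesis unfolding intensity_def by measurable
qed

lemma measurable_lik [measurable]: "lik s w \<in> borel_measurable paths"
proof (induction w arbitrary: s)
  case (Cons a w)
  note [measurable] = Cons[of "s + 1"]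
  show ?case unfolding lik.simps[abs_def] pois_def by measurable
qed (simp add: lik.simps(1)[abs_def])

lemma Z_cong: "(\<And>k. i - int L \<le> k \<Longrightarrow> k \<le> i \<Longrightarrow> x k = y k) \<Longrightarrow> Z x i = Z y i"
  unfolding intensity_def by (intro arg_cong2[where f="(+)"] sum.cong refl arg_cong2[where f="(*)"]) auto

lemma lik_cong:
  "(\<And>k. s - int L \<le> k \<Longrightarrow> k < s + int (length w) \<Longrightarrow> x k = y k) \<Longrightarrow> lik s w x = lik s w y"
proof (induction w arbitrary: s)
  case (Cons a w)
  have "Z x s = Z y s" by (rule Z_cong) (use Cons(2) in auto)
  moreover have "lik (s + 1) w x = lik (s + 1) w y" by (rule Cons(1)) (use Cons(2) in auto)
  ultimately show ?case by simp
qed simp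

lemma depends_on_lik: "depends_on S {s - int L..<s - int L + int (L + length w)} (lik s w)"
  unfolding depends_on_def by (intro ballI impI lik_cong) auto

lemma continuous_on_Z_upd: "continuous_on T (\<lambda>y. Z (x(i := y)) k)"
proof -
  have "continuous_on T (\<lambda>y. (x(i := y)) j)" for j by (cases "j = i") (auto intro: continuous_intros)
  then show ?thesis unfolding intensity_def by (intro continuous_intros)
qed

lemma continuous_on_lik_upd: "continuous_on T (\<lambda>y. lik s w (x(i := y)))"
  by (induction w arbitrary: s) (auto simp: pois_def intro!: continuous_intros continuous_on_Z_upd)

text \<open>Tonelli: a bound that holds for every path survives averaging. The coordinates may have
  different laws, so that hybrids and families with one replaced coordinate are covered.\<close>

lemma nn_integral_family_mass:
  assumes M: "\<And>i. M i \<in> input_laws A"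
    and K: "\<And>x. x \<in> space paths \<Longrightarrow> mass \<Omega> x s n \<le> ennreal K"
  shows "(\<integral>\<^sup>+w. ennreal (indicator \<Omega> w * (Theta w * (\<integral>x. lik s w x \<partial>PiM UNIV M))) \<partial>Words n) \<le> ennreal K"
proof -
  let ?P = "PiM UNIV M" and ?W = "Words n"
  interpret P: prob_space ?P by (rule prob_PiM_laws[OF M])
  interpret W: sigma_finite_measure ?W by (rule sigma_finite_measure_count_space_countable) simp
  interpret PW: pair_sigma_finite ?W ?P ..
  have sp: "space ?P = space paths" by (rule space_PiM_laws[OF M])
  have m[measurable]: "lik s w \<in> borel_measurable ?P" for w
    using measurable_lik by (simp add: measurable_cong_sets[OF sets_PiM_laws[of M, OF M] refl])
  have "ennreal (indicator \<Omega> w * (Theta w * (\<integral>x. lik s w x \<partial>?P))) =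
     (\<integral>\<^sup>+x. indicator \<Omega> w * ennreal (wlik x s w) \<partial>?P)" for w
  proof -
    have "integrable ?P (lik s w)"
      by (rule integrable_bounded_prob[where B=1]) (use lik_nonneg lik_le_1 sp in \<open>auto simp: P.prob_space_axioms\<close>)
    then have "ennreal (\<integral>x. lik s w x \<partial>?P) = (\<integral>\<^sup>+x. ennreal (lik s w x) \<partial>?P)"
      by (intro nn_integral_eq_integral[symmetric] AE_I2) (auto simp: sp lik_nonneg)
    moreover have "0 \<le> (\<integral>x. lik s w x \<partial>?P)" by (intro Bochner_Integration.integral_nonneg lik_nonneg) (simp add: sp)
    moreover have "Theta w \<ge> 0" using Theta_ge_1[of w] by linarith
    ultimately have "ennreal (indicator \<Omega> w * (Theta w * (\<integral>x. lik s w x \<partial>?P))) =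
       indicator \<Omega> w * (ennreal (Theta w) * (\<integral>\<^sup>+x. ennreal (lik s w x) \<partial>?P))"
      by (simp add: ennreal_mult split: split_indicator)
    also have "\<dots> = (\<integral>\<^sup>+x. indicator \<Omega> w * (ennreal (Theta w) * ennreal (lik s w x)) \<partial>?P)"
      by (simp add: nn_integral_cmult)
    also have "\<dots> = (\<integral>\<^sup>+x. indicator \<Omega> w * ennreal (wlik x s w) \<partial>?P)"
      using \<open>Theta w \<ge> 0\<close> by (intro nn_integral_cong) (simp add: wlik_def sp lik_nonneg ennreal_mult mult_ac)
    finally show ?thesis .
  qed
  then have "(\<integral>\<^sup>+w. ennreal (indicator \<Omega> w * (Theta w * (\<integral>x. lik s w x \<partial>?P))) \<partial>?W) =
      (\<integral>\<^sup>+w. \<integral>\<^sup>+x. indicator \<Omega> w * ennreal (wlik x s w) \<partial>?P \<partial>?W)" by simp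
  also have "\<dots> = (\<integral>\<^sup>+x. \<integral>\<^sup>+w. indicator \<Omega> w * ennreal (wlik x s w) \<partial>?W \<partial>?P)"
  proof (rule PW.Fubini'[symmetric])
    have "(\<lambda>x. indicator \<Omega> w * ennreal (wlik x s w)) \<in> borel_measurable ?P" for w
      by (subst measurable_cong[where g="\<lambda>x. indicator \<Omega> w * ennreal (lik s w x * Theta w)"])
        (simp_all add: sp wlik_def)
    then show "(\<lambda>(w, x). indicator \<Omega> w * ennreal (wlik x s w)) \<in> borel_measurable (?W \<Otimes>\<^sub>M ?P)"
      by (intro measurable_pair_measure_countable1) simp_all
  qed
  also have "\<dots> \<le> (\<integral>\<^sup>+x. ennreal K \<partial>?P)"
    using K by (intro nn_integral_mono) (simp add: mass_def sp)
  also have "\<dots> = ennreal K" by (simp add: P.emeasure_space_1)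
  finally show ?thesis .
qed

context
  fixes M :: "int \<Rightarrow> real measure" assumes M: "\<And>i. M i \<in> input_laws A"
begin

lemma family_prob: "prob_space (PiM UNIV M)"
  by (rule prob_PiM_laws[OF M])

lemma family_space: "space (PiM UNIV M) = space paths"
  by (rule space_PiM_laws[OF M])

lemma family_measurable: "f \<in> borel_measurable paths \<Longrightarrow> f \<in> borel_measurable (PiM UNIV M)"
  by (simp add: measurable_cong_sets[OF sets_PiM_laws[of M, OF M] refl])

lemma family_integrable_lik: "integrable (PiM UNIV M) (lik s w)"
  by (rule integrable_bounded_prob[where B=1, OF family_prob])
    (use lik_nonneg lik_le_1 family_space family_measurable[OF measurable_lik] in auto)

lemma family_lik_nonneg: "0 \<le> (\<integral>x. lik s w x \<partial>PiM UNIV M)"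
  by (intro Bochner_Integration.integral_nonneg lik_nonneg) (simp add: family_space)

lemma family_lik_le_1: "(\<integral>x. lik s w x \<partial>PiM UNIV M) \<le> 1"
proof -
  interpret P: prob_space "PiM UNIV M" by (rule family_prob)
  have "(\<integral>x. lik s w x \<partial>PiM UNIV M) \<le> (\<integral>x. 1 \<partial>PiM UNIV M)"
    by (intro integral_mono family_integrable_lik) (simp_all add: family_space lik_le_1)
  then show ?thesis by (simp add: P.prob_space)
qed

lemma family_lik_lower: "exp (- Cost w) \<le> (\<integral>x. lik s w x \<partial>PiM UNIV M)"
proof -
  interpret P: prob_space "PiM UNIV M" by (rule family_prob)
  have "(\<integral>x. exp (- Cost w) \<partial>PiM UNIV M) \<le> (\<integral>x. lik s w x \<partial>PiM UNIV M)"
    by (intro integral_mono family_integrable_lik) (simp_all add: family_space lik_lower)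
  then show ?thesis by (simp add: P.prob_space)
qed

lemma family_lik_env: "Theta w * (\<integral>x. lik s w x \<partial>PiM UNIV M) \<le> env w"
proof -
  interpret P: prob_space "PiM UNIV M" by (rule family_prob)
  have "(\<integral>x. lik s w x * Theta w \<partial>PiM UNIV M) \<le> (\<integral>x. env w \<partial>PiM UNIV M)"
    using wlik_le_env[where s=s and w=w]
    by (intro integral_mono integrable_mult_left family_integrable_lik) (simp_all add: family_space wlik_def)
  then show ?thesis by (simp add: P.prob_space mult.commute)
qed

lemma integrable_family_mass:
  "integrable (Words n) (\<lambda>w. indicator \<Omega> w * (Theta w * (\<integral>x. lik s w x \<partial>PiM UNIV M)))"
proof (rule Bochner_Integration.integrable_bound[OF integrable_env[of n]])
  have "norm (indicator \<Omega> w * (Theta w * (\<integral>x. lik s w x \<partial>PiM UNIV M))) \<le> norm (env w)" for w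
  proof -
    have "0 \<le> Theta w * (\<integral>x. lik s w x \<partial>PiM UNIV M)"
      using Theta_ge_1[of w] family_lik_nonneg[of s w] by (intro mult_nonneg_nonneg) linarith+
    then show ?thesis using family_lik_env[of w s] env_nonneg[of w] by (auto simp: indicator_def)
  qed
  then show "AE w in Words n. norm (indicator \<Omega> w * (Theta w * (\<integral>x. lik s w x \<partial>PiM UNIV M))) \<le> norm (env w)"
    by simp
qed simp

lemma family_mass:
  assumes K: "\<And>x. x \<in> space paths \<Longrightarrow> mass \<Omega> x s n \<le> ennreal K" "K \<ge> 0"
  shows "(\<integral>w. indicator \<Omega> w * (Theta w * (\<integral>x. lik s w x \<partial>PiM UNIV M)) \<partial>Words n) \<le> K"
proof -
  have nn: "0 \<le> indicator \<Omega> w * (Theta w * (\<integral>x. lik s w x \<partial>PiM UNIV M))" for w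
    using Theta_ge_1[of w] family_lik_nonneg[of s w] by (intro mult_nonneg_nonneg) (auto simp: indicator_def)
  have "ennreal (\<integral>w. indicator \<Omega> w * (Theta w * (\<integral>x. lik s w x \<partial>PiM UNIV M)) \<partial>Words n) \<le> ennreal K"
    using nn_integral_family_mass[where M=M and s=s, OF M K(1)] nn
    by (subst nn_integral_eq_integral[OF integrable_family_mass, symmetric]) auto
  then show ?thesis using K(2) by (simp add: ennreal_le_iff)
qed

end

definition cost_factor :: real where "cost_factor = 1 + 2 / tau"

lemma cost_factor_pos: "cost_factor > 0" using tau(1) by (simp add: cost_factor_def add_pos_pos)

lemma Cost_cost_factor: "1 + Cost w \<le> cost_factor * Theta w"
  using Cost_le_Theta[of w] Cost_nonneg[of w] by (simp add: cost_factor_def)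

text \<open>The hypothesis on \<open>u\<close> is the common shape of the difference quotients of
  \<open>eta\<close> and of their limits. The envelope dominates word by word;
  \<open>family_mass\<close> bounds the sum over a whole length, with a linear factor from the
  \<open>L + n\<close> inputs that can be perturbed.\<close>

lemma blocks_bound:
  assumes M1: "\<And>j i. M1 j i \<in> input_laws A" and M2: "\<And>j i. M2 j i \<in> input_laws A"
    and u: "\<And>w. w \<in> words n \<Longrightarrow> \<bar>u w\<bar> \<le> indicator \<Omega> w * (cost_factor * (Theta w * (\<Sum>j<L + n.
       (\<integral>x. lik 0 w x \<partial>PiM UNIV (M1 j)) + (\<integral>x. lik 0 w x \<partial>PiM UNIV (M2 j)))))"
    and K: "\<And>x. x \<in> space paths \<Longrightarrow> mass \<Omega> x 0 n \<le> ennreal K" "K \<ge> 0"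
  shows "w \<in> words n \<Longrightarrow> \<bar>u w\<bar> \<le> cost_factor * (2 * real (L + n)) * env w"
    and "integrable (Words n) u"
    and "(\<integral>w. \<bar>u w\<bar> \<partial>Words n) \<le> cost_factor * (2 * real (L + n) * K)"
proof -
  let ?W = "Words n"
  define g where "g M w = indicator \<Omega> w * (Theta w * (\<integral>x. lik 0 w x \<partial>PiM UNIV M))" for M w
  have u': "\<bar>u w\<bar> \<le> cost_factor * (\<Sum>j<L + n. g (M1 j) w + g (M2 j) w)" if "w \<in> words n" for w
    using u[OF that] by (simp add: g_def sum_distrib_left algebra_simps)
  have env: "\<bar>u w\<bar> \<le> cost_factor * (2 * real (L + n)) * env w" if "w \<in> words n" for w
  proof -
    have "g M w \<le> env w" if "\<And>i. M i \<in> input_laws A" for M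
      using family_lik_env[of M w 0, OF that] env_nonneg[of w] by (auto simp: g_def indicator_def)
    then have "g (M1 j) w + g (M2 j) w \<le> 2 * env w" for j using M1 M2 by (metis add_mono mult_2)
    then have "(\<Sum>j<L + n. g (M1 j) w + g (M2 j) w) \<le> (\<Sum>j<L + n. 2 * env w)" by (intro sum_mono)
    then have "cost_factor * (\<Sum>j<L + n. g (M1 j) w + g (M2 j) w) \<le> cost_factor * (\<Sum>j<L + n. 2 * env w)"
      using cost_factor_pos by (intro mult_left_mono) auto
    then show ?thesis using u'[OF that] by (simp add: algebra_simps)
  qed
  then show "w \<in> words n \<Longrightarrow> \<bar>u w\<bar> \<le> cost_factor * (2 * real (L + n)) * env w" for w .
  show int: "integrable ?W u"
    by (rule Bochner_Integration.integrable_bound[OF integrable_mult_right[OF integrable_env[of n], of "cost_factor * (2 * real (L + n))"]])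
      (use env in \<open>auto intro!: AE_I2 intro: order_trans[OF _ abs_ge_self]\<close>)
  have gi: "integrable ?W (g M)" if "\<And>i. M i \<in> input_laws A" for M
    unfolding g_def[abs_def] by (rule integrable_family_mass[OF that])
  have gb: "(\<integral>w. g M w \<partial>?W) \<le> K" if "\<And>i. M i \<in> input_laws A" for M
    unfolding g_def by (rule family_mass[OF that K])
  have "(\<integral>w. \<bar>u w\<bar> \<partial>?W) \<le> (\<integral>w. cost_factor * (\<Sum>j<L + n. g (M1 j) w + g (M2 j) w) \<partial>?W)"
    using u' int by (intro integral_mono integrable_mult_right Bochner_Integration.integrable_sum
       Bochner_Integration.integrable_add gi M1 M2 integrable_abs) auto
  also have "\<dots> = cost_factor * (\<Sum>j<L + n. (\<integral>w. g (M1 j) w \<partial>?W) + (\<integral>w. g (M2 j) w \<partial>?W))"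
    using gi[OF M1] gi[OF M2] by simp
  also have "\<dots> \<le> cost_factor * (\<Sum>j<L + n. K + K)"
    using cost_factor_pos gb[OF M1] gb[OF M2] by (intro mult_left_mono sum_mono add_mono) auto
  finally show "(\<integral>w. \<bar>u w\<bar> \<partial>?W) \<le> cost_factor * (2 * real (L + n) * K)" by (simp add: algebra_simps)
qed


section \<open>Word probabilities and their derivatives\<close>

definition wprob :: "real measure \<Rightarrow> nat list \<Rightarrow> real" where
  "wprob F w = expect F (lik 0 w)"

definition eta_sum :: "nat list set \<Rightarrow> real measure \<Rightarrow> real" where
  "eta_sum \<Omega> F = (\<Sum>n. \<integral>w. indicator \<Omega> w * eta (wprob F w) \<partial>Words n)"

text \<open>The outputs at times 0 to \<open>length w - 1\<close> read the
  \<open>L + length w\<close> inputs from time \<open>- L\<close> on.\<close>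

definition wprob_deriv :: "real measure \<Rightarrow> nat list \<Rightarrow> real \<Rightarrow> real" where
  "wprob_deriv F w = expect_deriv F (- int L) (L + length w) (lik 0 w)"

definition eta_sum_deriv :: "nat list set \<Rightarrow> real measure \<Rightarrow> real \<Rightarrow> real" where
  "eta_sum_deriv \<Omega> F y = (\<Sum>n. \<integral>w. indicator \<Omega> w * ((1 + ln (wprob F w)) * wprob_deriv F w y) \<partial>Words n)"

lemma lik_abs_le_1: "x \<in> space paths \<Longrightarrow> \<bar>lik s w x\<bar> \<le> 1"
  using lik_nonneg lik_le_1 by simp

lemma depends_on_lik0: "depends_on S {- int L..<- int L + int (L + length w)} (lik 0 w)"
  using depends_on_lik[of S 0 w] by simp

text \<open>Freezing a coordinate at \<open>y\<close> is a product law with a point mass there, so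
  the bounds for arbitrary families also cover the derivative terms.\<close>

lemma replaced_eq_family:
  assumes F: "F \<in> input_laws A" and y: "y \<in> {0..A}"
  shows "replaced F i (lik s w) y = (\<integral>x. lik s w x \<partial>PiM UNIV ((\<lambda>_. F)(i := return (amplitudes A) y)))"
proof -
  have "(\<integral>x. lik s w x \<partial>PiM UNIV ((\<lambda>_. F)(i := return (amplitudes A) y))) =
     (\<integral>a. replaced F i (lik s w) a \<partial>return (amplitudes A) y)"
    unfolding replaced_def
    by (rule integral_upd[where M="\<lambda>_. F", OF F return_in_input_laws[OF y] measurable_lik lik_abs_le_1])
  also have "\<dots> = replaced F i (lik s w) y"
    using y replaced_measurable[OF F measurable_lik lik_abs_le_1]
    by (intro integral_return) (auto simp: amplitudes_def space_restrict_space)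
  finally show ?thesis ..
qed

lemma wprob_deriv_abs_le:
  assumes F: "F \<in> input_laws A" and y: "y \<in> {0..A}"
  shows "\<bar>wprob_deriv F w y\<bar> \<le> (\<Sum>j<L + length w.
     (\<integral>x. lik 0 w x \<partial>PiM UNIV ((\<lambda>_. F)(- int L + int j := return (amplitudes A) y))) +
     (\<integral>x. lik 0 w x \<partial>PF F))"
proof -
  have 1: "0 \<le> replaced F i (lik 0 w) y" for i
    unfolding replaced_eq_family[OF F y]
    by (rule family_lik_nonneg) (use F return_in_input_laws[OF y] in simp)
  have 2: "0 \<le> expect F (lik 0 w)"
    unfolding expect_def by (rule family_lik_nonneg[OF F])
  have "\<bar>wprob_deriv F w y\<bar> \<le> (\<Sum>j<L + length w. \<bar>replaced F (- int L + int j) (lik 0 w) y - expect F (lik 0 w)\<bar>)"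
    unfolding wprob_deriv_def expect_deriv_def by (rule sum_abs)
  also have "\<dots> \<le> (\<Sum>j<L + length w. replaced F (- int L + int j) (lik 0 w) y + expect F (lik 0 w))"
  proof (rule sum_mono)
    fix j
    show "\<bar>replaced F (- int L + int j) (lik 0 w) y - expect F (lik 0 w)\<bar>
        \<le> replaced F (- int L + int j) (lik 0 w) y + expect F (lik 0 w)"
      using 1[of "- int L + int j"] 2 by (simp add: abs_le_iff)
  qed
  finally show ?thesis by (simp only: replaced_eq_family[OF F y] expect_def)
qed

lemma wprob_bounds:
  assumes "F \<in> input_laws A"
  shows "exp (- Cost w) \<le> wprob F w" "wprob F w \<le> 1" "0 < wprob F w"
proof -
  show 1: "exp (- Cost w) \<le> wprob F w" unfolding wprob_def expect_def by (rule family_lik_lower[OF assms])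
  show "wprob F w \<le> 1" unfolding wprob_def expect_def by (rule family_lik_le_1[OF assms])
  show "0 < wprob F w" using 1 exp_gt_zero[of "- Cost w"] by linarith
qed

lemma abs_1_ln_wprob_le:
  assumes "F \<in> input_laws A"
  shows "\<bar>1 + ln (wprob F w)\<bar> \<le> cost_factor * Theta w"
proof -
  have "- Cost w \<le> ln (wprob F w)" "ln (wprob F w) \<le> 0"
    using wprob_bounds[OF assms, of w] by (auto simp: ln_ge_iff)
  then have "\<bar>1 + ln (wprob F w)\<bar> \<le> 1 + Cost w" using Cost_nonneg[of w] by auto
  then show ?thesis using Cost_cost_factor[of w] by linarith
qed

lemma continuous_on_wprob_deriv:
  "F \<in> input_laws A \<Longrightarrow> continuous_on {0..A} (wprob_deriv F w)"
  unfolding wprob_deriv_def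
  by (rule continuous_on_expect_deriv[OF _ measurable_lik lik_abs_le_1 continuous_on_lik_upd])

lemma wprob_mixture_tendsto:
  assumes F: "F \<in> input_laws A" and G: "G \<in> input_laws A"
  shows "((\<lambda>\<epsilon>. (wprob (mixture \<epsilon> F G) w - wprob F w) / \<epsilon>) \<longlongrightarrow> (\<integral>y. wprob_deriv F w y \<partial>G)) (at_right 0)"
  unfolding wprob_deriv_def wprob_def
  by (rule expect_mixture_tendsto[OF F measurable_lik lik_abs_le_1 depends_on_lik0 G])

lemma eta_wprob_mixture_tendsto:
  assumes F: "F \<in> input_laws A" and G: "G \<in> input_laws A"
  shows "((\<lambda>\<epsilon>. (eta (wprob (mixture \<epsilon> F G) w) - eta (wprob F w)) / \<epsilon>) \<longlongrightarrow>
     (1 + ln (wprob F w)) * (\<integral>y. wprob_deriv F w y \<partial>G)) (at_right 0)"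
proof -
  let ?g = "\<lambda>\<epsilon>. wprob (mixture \<epsilon> F G) w"
  have "(?g has_field_derivative (\<integral>y. wprob_deriv F w y \<partial>G)) (at 0 within {0<..})"
    using wprob_mixture_tendsto[OF F G, of w] by (simp add: has_field_derivative_iff mixture_0[OF F G])
  moreover have "(eta has_field_derivative (1 + ln (?g 0))) (at (?g 0))"
    using wprob_bounds(3)[OF F, of w] unfolding mixture_0[OF F G] eta_def[abs_def]
    by (auto intro!: derivative_eq_intros)
  ultimately have "((\<lambda>\<epsilon>. eta (?g \<epsilon>)) has_field_derivative ((1 + ln (?g 0)) * (\<integral>y. wprob_deriv F w y \<partial>G))) (at 0 within {0<..})"
    by (intro DERIV_chain2)
  then show ?thesis by (simp add: has_field_derivative_iff mixture_0[OF F G])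
qed

text \<open>The telescoped terms are differences of two nonnegative probabilities of
  \<open>w\<close>, bounded by their sum. Keeping probabilities in the bound, rather than a
  constant, is what makes it summable over words.\<close>

lemma wprob_mixture_diff_le:
  assumes F: "F \<in> input_laws A" and G: "G \<in> input_laws A" and \<epsilon>: "0 < \<epsilon>" "\<epsilon> < 1"
  shows "\<bar>wprob (mixture \<epsilon> F G) w - wprob F w\<bar> \<le> \<epsilon> * (\<Sum>j<L + length w.
     (\<integral>x. lik 0 w x \<partial>PiM UNIV ((hybrid F G \<epsilon> (- int L + int j))(- int L + int j := G))) +
     (\<integral>x. lik 0 w x \<partial>PiM UNIV ((hybrid F G \<epsilon> (- int L + int j))(- int L + int j := F))))"
proof -
  have \<epsilon>': "0 \<le> \<epsilon>" "\<epsilon> \<le> 1" using \<epsilon> by auto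
  have hl: "hybrid F G \<epsilon> i k \<in> input_laws A" for i k
    using mixture_in_input_laws[OF F G \<epsilon>'] F by (simp add: hybrid_def)
  let ?i = "\<lambda>j. - int L + int j"
  let ?J = "\<lambda>H j. \<integral>x. lik 0 w x \<partial>PiM UNIV ((hybrid F G \<epsilon> (?i j))(?i j := H))"
  have e: "(\<integral>y. \<integral>x. lik 0 w (x(?i j := y)) \<partial>PiM UNIV (hybrid F G \<epsilon> (?i j)) \<partial>H) = ?J H j"
    if "H \<in> input_laws A" for H j
    by (rule integral_upd[OF hl that measurable_lik lik_abs_le_1, symmetric])
  have nn: "0 \<le> ?J H j" if "H \<in> input_laws A" for H j
    by (rule family_lik_nonneg) (use that hl in auto)
  have d: "wprob (mixture \<epsilon> F G) w - wprob F w = \<epsilon> * (\<Sum>j<L + length w. ?J G j - ?J F j)"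
    unfolding wprob_def e[OF F, symmetric] e[OF G, symmetric]
    by (rule expect_mixture_diff[OF F G \<epsilon>' measurable_lik lik_abs_le_1 depends_on_lik0])
  have "\<bar>\<Sum>j<L + length w. ?J G j - ?J F j\<bar> \<le> (\<Sum>j<L + length w. \<bar>?J G j - ?J F j\<bar>)"
    by (rule sum_abs)
  also have "\<dots> \<le> (\<Sum>j<L + length w. ?J G j + ?J F j)"
  proof (rule sum_mono)
    fix j show "\<bar>?J G j - ?J F j\<bar> \<le> ?J G j + ?J F j"
      using nn[OF F, of j] nn[OF G, of j] by linarith
  qed
  finally have "\<epsilon> * \<bar>\<Sum>j<L + length w. ?J G j - ?J F j\<bar> \<le> \<epsilon> * (\<Sum>j<L + length w. ?J G j + ?J F j)"
    using \<epsilon> by (intro mult_left_mono) auto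
  then show ?thesis unfolding d abs_mult using \<epsilon> by simp
qed

section \<open>The series over a decaying set of words\<close>

context
  fixes \<Omega> C r
  assumes C: "0 \<le> C" and r: "0 < r" "r < 1"
    and mass: "\<And>x s n. x \<in> space paths \<Longrightarrow> mass \<Omega> x s n \<le> ennreal (C * r ^ n)"
begin

lemma summable_block_bounds: "summable (\<lambda>n. cost_factor * (2 * real (L + n) * (C * r ^ n)))"
proof -
  have "summable (\<lambda>n. (2 * cost_factor * C) * ((real L + 1 * real n) * r ^ n))"
    by (intro summable_mult summable_linear_geometric r)
  also have "(\<lambda>n. (2 * cost_factor * C) * ((real L + 1 * real n) * r ^ n)) = (\<lambda>n. cost_factor * (2 * real (L + n) * (C * r ^ n)))"
    by (simp add: fun_eq_iff algebra_simps)
  finally show ?thesis .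
qed

lemma Cr_nonneg: "0 \<le> C * r ^ n" using C r by simp

lemma integrable_env_cmult: "integrable (Words n) (\<lambda>w. c * env w)"
  using integrable_env by simp

lemma eta_wprob_block_bound:
  assumes F: "F \<in> input_laws A"
  shows "integrable (Words n) (\<lambda>w. indicator \<Omega> w * eta (wprob F w))"
    and "\<bar>\<integral>w. indicator \<Omega> w * eta (wprob F w) \<partial>Words n\<bar> \<le> cost_factor * (C * r ^ n)"
proof -
  let ?W = "Words n"
  have b: "\<bar>indicator \<Omega> w * eta (wprob F w)\<bar> \<le> cost_factor * (indicator \<Omega> w * (Theta w * (\<integral>x. lik 0 w x \<partial>PF F)))" for w
  proof -
    have "\<bar>eta (wprob F w)\<bar> \<le> wprob F w * Cost w" by (rule eta_abs_le[OF wprob_bounds(1,2)[OF F]])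
    also have "\<dots> \<le> wprob F w * (cost_factor * Theta w)"
      using Cost_cost_factor[of w] wprob_bounds(3)[OF F, of w] by (intro mult_left_mono) auto
    finally show ?thesis by (simp add: indicator_def wprob_def expect_def mult_ac)
  qed
  have i: "integrable ?W (\<lambda>w. cost_factor * (indicator \<Omega> w * (Theta w * (\<integral>x. lik 0 w x \<partial>PF F))))"
    by (intro integrable_mult_right integrable_family_mass[OF F])
  show int: "integrable ?W (\<lambda>w. indicator \<Omega> w * eta (wprob F w))"
    by (rule Bochner_Integration.integrable_bound[OF i])
      (use b in \<open>auto intro!: AE_I2 intro: order_trans[OF _ abs_ge_self]\<close>)
  have "\<bar>\<integral>w. indicator \<Omega> w * eta (wprob F w) \<partial>?W\<bar> \<le> (\<integral>w. \<bar>indicator \<Omega> w * eta (wprob F w)\<bar> \<partial>?W)"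
    by (rule integral_abs_bound)
  also have "\<dots> \<le> (\<integral>w. cost_factor * (indicator \<Omega> w * (Theta w * (\<integral>x. lik 0 w x \<partial>PF F))) \<partial>?W)"
    by (intro integral_mono integrable_abs int i b)
  also have "\<dots> \<le> cost_factor * (C * r ^ n)"
    using family_mass[where M="\<lambda>_. F" and s=0 and n=n, OF F mass Cr_nonneg] cost_factor_pos by simp
  finally show "\<bar>\<integral>w. indicator \<Omega> w * eta (wprob F w) \<partial>?W\<bar> \<le> cost_factor * (C * r ^ n)" .
qed

lemma summable_eta_sum:
  assumes F: "F \<in> input_laws A"
  shows "summable (\<lambda>n. \<integral>w. indicator \<Omega> w * eta (wprob F w) \<partial>Words n)"
proof (rule summable_comparison_test')
  show "summable (\<lambda>n. cost_factor * (C * r ^ n))" using r by (intro summable_mult summable_geometric) auto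
qed (use eta_wprob_block_bound(2)[OF F] in simp)

lemma eta_sum_quotient:
  assumes F: "F \<in> input_laws A" and G: "G \<in> input_laws A"
  shows "(eta_sum \<Omega> G - eta_sum \<Omega> F) / \<epsilon> =
    (\<Sum>n. \<integral>w. indicator \<Omega> w * ((eta (wprob G w) - eta (wprob F w)) / \<epsilon>) \<partial>Words n)"
proof -
  have "(eta_sum \<Omega> G - eta_sum \<Omega> F) / \<epsilon> = (\<Sum>n. ((\<integral>w. indicator \<Omega> w * eta (wprob G w) \<partial>Words n) -
     (\<integral>w. indicator \<Omega> w * eta (wprob F w) \<partial>Words n)) / \<epsilon>)"
    unfolding eta_sum_def using suminf_diff[OF summable_eta_sum[OF G] summable_eta_sum[OF F]]
      suminf_divide[OF summable_diff[OF summable_eta_sum[OF G] summable_eta_sum[OF F]]] by simp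
  also have "\<dots> = (\<Sum>n. \<integral>w. indicator \<Omega> w * ((eta (wprob G w) - eta (wprob F w)) / \<epsilon>) \<partial>Words n)"
    using eta_wprob_block_bound(1)[OF F] eta_wprob_block_bound(1)[OF G]
    by (simp add: right_diff_distrib diff_divide_distrib)
  finally show ?thesis .
qed

text \<open>Differentiation of the double series: for each length the summands are dominated word by word,
  and the sums over a length are dominated geometrically, uniformly in the input law.\<close>

lemma eta_sum_mixture_tendsto:
  assumes F: "F \<in> input_laws A" and G: "G \<in> input_laws A"
  shows "((\<lambda>\<epsilon>. (eta_sum \<Omega> (mixture \<epsilon> F G) - eta_sum \<Omega> F) / \<epsilon>) \<longlongrightarrow>
    (\<Sum>n. \<integral>w. indicator \<Omega> w * ((1 + ln (wprob F w)) * (\<integral>y. wprob_deriv F w y \<partial>G)) \<partial>Words n)) (at_right 0)"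
proof (rule tendsto_at_right_sequentially[of 0 1])
  \<comment> \<open>Sequences suffice for a one-sided limit, and the domination theorem is stated
    for sequences.\<close>
  fix S :: "nat \<Rightarrow> real"
  assume S: "\<And>m. 0 < S m" "\<And>m. S m < 1" "decseq S" "S \<longlonglongrightarrow> 0"
  let ?u = "\<lambda>m w. indicator \<Omega> w * ((eta (wprob (mixture (S m) F G) w) - eta (wprob F w)) / S m)"
  have M: "mixture (S m) F G \<in> input_laws A" for m
    using mixture_in_input_laws[OF F G] S(1,2)[of m] by auto
  define M1 where "M1 H m j = (hybrid F G (S m) (- int L + int j))(- int L + int j := H)" for H m and j :: nat
  have M1: "M1 H m j i \<in> input_laws A" if "H \<in> input_laws A" for H m j i
    using that M F by (simp add: M1_def hybrid_def)
  have u: "\<bar>?u m w\<bar> \<le> indicator \<Omega> w * (cost_factor * (Theta w * (\<Sum>j<L + n.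
       (\<integral>x. lik 0 w x \<partial>PiM UNIV (M1 G m j)) + (\<integral>x. lik 0 w x \<partial>PiM UNIV (M1 F m j)))))"
    (is "_ \<le> indicator \<Omega> w * (cost_factor * (Theta w * ?D))")
    if "w \<in> words n" for m n w
  proof -
    have l: "length w = n" using that by (simp add: words_def)
    have "\<bar>eta (wprob (mixture (S m) F G) w) - eta (wprob F w)\<bar> \<le> (1 + Cost w) * \<bar>wprob (mixture (S m) F G) w - wprob F w\<bar>"
      by (rule eta_lipschitz) (use wprob_bounds[OF M] wprob_bounds[OF F] Cost_nonneg in auto)
    \<comment> \<open>The factor \<open>S m\<close> cancels the denominator of the difference
      quotient and leaves a bound uniform in the step size.\<close>
    also have "\<dots> \<le> (cost_factor * Theta w) * (S m * ?D)"
    proof (rule mult_mono[OF Cost_cost_factor])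
      show "\<bar>wprob (mixture (S m) F G) w - wprob F w\<bar> \<le> S m * ?D"
        using wprob_mixture_diff_le[OF F G S(1,2), of m w] by (simp add: l M1_def)
      show "0 \<le> cost_factor * Theta w" using Cost_cost_factor[of w] Cost_nonneg[of w] by linarith
    qed simp
    finally have "\<bar>eta (wprob (mixture (S m) F G) w) - eta (wprob F w)\<bar> / S m \<le> cost_factor * (Theta w * ?D)"
      using S(1)[of m] by (simp add: field_simps)
    then show ?thesis using S(1)[of m] by (simp add: indicator_def)
  qed
  note bb = blocks_bound[OF M1[OF G] M1[OF F] u mass Cr_nonneg]
  have "(\<lambda>m. \<Sum>n. \<integral>w. ?u m w \<partial>Words n) \<longlonglongrightarrow>
    (\<Sum>n. \<integral>w. indicator \<Omega> w * ((1 + ln (wprob F w)) * (\<integral>y. wprob_deriv F w y \<partial>G)) \<partial>Words n)"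
  proof (rule tannery_blocks(2)[OF integrable_env_cmult bb(1) bb(3) summable_block_bounds])
    fix n w
    have "filterlim S (at_right 0) sequentially"
      using S(1) by (intro tendsto_imp_filterlim_at_right[OF S(4)] always_eventually) simp
    from filterlim_compose[OF eta_wprob_mixture_tendsto[OF F G, of w] this]
    show "(\<lambda>m. ?u m w) \<longlonglongrightarrow> indicator \<Omega> w * ((1 + ln (wprob F w)) * (\<integral>y. wprob_deriv F w y \<partial>G))"
      by (intro tendsto_mult tendsto_const)
  qed
  then show "(\<lambda>m. (eta_sum \<Omega> (mixture (S m) F G) - eta_sum \<Omega> F) / S m) \<longlonglongrightarrow>
    (\<Sum>n. \<integral>w. indicator \<Omega> w * ((1 + ln (wprob F w)) * (\<integral>y. wprob_deriv F w y \<partial>G)) \<partial>Words n)"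
    by (simp only: eta_sum_quotient[OF F M])
qed simp

lemma eta_sum_deriv_term_bound:
  assumes F: "F \<in> input_laws A" and y: "y \<in> {0..A}" and w: "w \<in> words n"
  shows "\<bar>indicator \<Omega> w * ((1 + ln (wprob F w)) * wprob_deriv F w y)\<bar> \<le>
    indicator \<Omega> w * (cost_factor * (Theta w * (\<Sum>j<L + n.
     (\<integral>x. lik 0 w x \<partial>PiM UNIV ((\<lambda>_. F)(- int L + int j := return (amplitudes A) y))) +
     (\<integral>x. lik 0 w x \<partial>PF F))))"
proof -
  have "\<bar>(1 + ln (wprob F w)) * wprob_deriv F w y\<bar> \<le> (cost_factor * Theta w) * (\<Sum>j<L + length w.
     (\<integral>x. lik 0 w x \<partial>PiM UNIV ((\<lambda>_. F)(- int L + int j := return (amplitudes A) y))) +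
     (\<integral>x. lik 0 w x \<partial>PF F))"
    unfolding abs_mult
    by (rule mult_mono[OF abs_1_ln_wprob_le[OF F] wprob_deriv_abs_le[OF F y]])
      (use Cost_cost_factor[of w] Cost_nonneg[of w] in auto)
  then show ?thesis using w by (simp add: indicator_def words_def mult.assoc)
qed

lemma eta_sum_deriv_block:
  assumes F: "F \<in> input_laws A" and y: "y \<in> {0..A}"
  shows "w \<in> words n \<Longrightarrow> \<bar>indicator \<Omega> w * ((1 + ln (wprob F w)) * wprob_deriv F w y)\<bar> \<le> cost_factor * (2 * real (L + n)) * env w"
    and "(\<integral>w. \<bar>indicator \<Omega> w * ((1 + ln (wprob F w)) * wprob_deriv F w y)\<bar> \<partial>Words n)
      \<le> cost_factor * (2 * real (L + n) * (C * r ^ n))"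
proof -
  have 1: "((\<lambda>_. F)(i := return (amplitudes A) y)) k \<in> input_laws A" for i k
    using F return_in_input_laws[OF y] by simp
  note bb = blocks_bound[where ?M1.0="\<lambda>j. (\<lambda>_. F)(- int L + int j := return (amplitudes A) y)" and ?M2.0="\<lambda>j _. F",
    OF 1 F eta_sum_deriv_term_bound[OF F y] mass Cr_nonneg]
  show "w \<in> words n \<Longrightarrow> \<bar>indicator \<Omega> w * ((1 + ln (wprob F w)) * wprob_deriv F w y)\<bar> \<le> cost_factor * (2 * real (L + n)) * env w"
    by (rule bb(1))
  show "(\<integral>w. \<bar>indicator \<Omega> w * ((1 + ln (wprob F w)) * wprob_deriv F w y)\<bar> \<partial>Words n)
      \<le> cost_factor * (2 * real (L + n) * (C * r ^ n))"
    by (rule bb(3))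
qed

lemma continuous_on_eta_sum_deriv:
  assumes F: "F \<in> input_laws A"
  shows "continuous_on {0..A} (eta_sum_deriv \<Omega> F)"
proof (rule continuous_on_sequentiallyI)
  fix u y assume u: "\<forall>m. u m \<in> {0..A}" "y \<in> {0..A}" "u \<longlonglongrightarrow> y"
  then have um: "u m \<in> {0..A}" for m by blast
  show "(\<lambda>m. eta_sum_deriv \<Omega> F (u m)) \<longlonglongrightarrow> eta_sum_deriv \<Omega> F y"
    unfolding eta_sum_deriv_def
  proof (rule tannery_blocks(2)[OF integrable_env_cmult eta_sum_deriv_block(1)[OF F um] eta_sum_deriv_block(2)[OF F um] summable_block_bounds])
    fix w
    have "(\<lambda>m. wprob_deriv F w (u m)) \<longlonglongrightarrow> wprob_deriv F w y"
      using continuous_on_tendsto_compose[OF continuous_on_wprob_deriv[OF F] u(3,2)] u(1) by auto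
    then show "(\<lambda>m. indicator \<Omega> w * ((1 + ln (wprob F w)) * wprob_deriv F w (u m))) \<longlonglongrightarrow>
        indicator \<Omega> w * ((1 + ln (wprob F w)) * wprob_deriv F w y)"
      by (intro tendsto_intros)
  qed
qed

text \<open>The limit found above depends on the direction \<open>G\<close> inside every term.
  Fubini within a length and domination over the lengths pull \<open>G\<close> out, giving one
  function integrated against \<open>G\<close>, as \<open>gateaux\<close> requires.\<close>

lemma integral_eta_sum_deriv:
  assumes F: "F \<in> input_laws A" and G: "G \<in> input_laws A"
  shows "(\<integral>y. eta_sum_deriv \<Omega> F y \<partial>G) =
    (\<Sum>n. \<integral>w. indicator \<Omega> w * ((1 + ln (wprob F w)) * (\<integral>y. wprob_deriv F w y \<partial>G)) \<partial>Words n)"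
proof -
  interpret G: prob_space G by (rule prob_law[OF G])
  have sp: "space G = {0..A}" by (rule space_law[OF G])
  let ?f = "\<lambda>w y. indicator \<Omega> w * ((1 + ln (wprob F w)) * wprob_deriv F w y)"
  have m: "wprob_deriv F w \<in> borel_measurable G" for w
    by (rule measurable_law[OF G continuous_on_measurable_amplitudes[OF continuous_on_wprob_deriv[OF F]]])
  have n: "(\<integral>y. (\<integral>w. ?f w y \<partial>Words n) \<partial>G) =
      (\<integral>w. indicator \<Omega> w * ((1 + ln (wprob F w)) * (\<integral>y. wprob_deriv F w y \<partial>G)) \<partial>Words n)"
    and int: "integrable G (\<lambda>y. \<integral>w. ?f w y \<partial>Words n)" for n
  proof -
    let ?W = "Words n"
    interpret W: sigma_finite_measure ?W by (rule sigma_finite_measure_count_space_countable) simp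
    interpret P: pair_sigma_finite ?W G ..
    have fm: "(\<lambda>(w, y). ?f w y) \<in> borel_measurable (?W \<Otimes>\<^sub>M G)"
      using m by (intro measurable_pair_measure_countable1) simp_all
    have env: "integrable (?W \<Otimes>\<^sub>M G) (\<lambda>(w, y). cost_factor * (2 * real (L + n)) * env w)"
    proof (rule P.Fubini_integrable)
      show "(\<lambda>(w, y). cost_factor * (2 * real (L + n)) * env w) \<in> borel_measurable (?W \<Otimes>\<^sub>M G)"
        by (intro measurable_pair_measure_countable1) simp_all
      show "integrable ?W (\<lambda>w. \<integral>y. norm (case (w, y) of (w, y) \<Rightarrow> cost_factor * (2 * real (L + n)) * env w) \<partial>G)"
        using integrable_env by (simp add: G.prob_space abs_mult)
    qed simp
    have i: "integrable (?W \<Otimes>\<^sub>M G) (\<lambda>(w, y). ?f w y)"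
      by (rule Bochner_Integration.integrable_bound[OF env fm])
        (use eta_sum_deriv_block(1)[OF F] sp in \<open>auto intro!: AE_I2 simp: space_pair_measure intro: order_trans[OF _ abs_ge_self]\<close>)
    show "(\<integral>y. (\<integral>w. ?f w y \<partial>?W) \<partial>G) =
      (\<integral>w. indicator \<Omega> w * ((1 + ln (wprob F w)) * (\<integral>y. wprob_deriv F w y \<partial>G)) \<partial>?W)"
      using P.Fubini_integral[OF i] by simp
    show "integrable G (\<lambda>y. \<integral>w. ?f w y \<partial>?W)"
      using P.integrable_snd[OF i] by simp
  qed
  have le: "norm (\<integral>w. ?f w y \<partial>Words n) \<le> cost_factor * (2 * real (L + n) * (C * r ^ n))"
    if "y \<in> {0..A}" for y n
    unfolding real_norm_def by (rule order_trans[OF integral_abs_bound eta_sum_deriv_block(2)[OF F that]])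
  have "(\<integral>y. eta_sum_deriv \<Omega> F y \<partial>G) = (\<Sum>n. \<integral>y. (\<integral>w. ?f w y \<partial>Words n) \<partial>G)"
    unfolding eta_sum_deriv_def
  proof (rule integral_suminf)
    show "AE y in G. summable (\<lambda>n. norm (\<integral>w. ?f w y \<partial>Words n))"
      using le by (intro AE_I2 summable_comparison_test'[OF summable_block_bounds]) (simp add: sp)
    show "summable (\<lambda>n. \<integral>y. norm (\<integral>w. ?f w y \<partial>Words n) \<partial>G)"
    proof (rule summable_comparison_test'[OF summable_block_bounds])
      fix n
      show "norm (\<integral>y. norm (\<integral>w. ?f w y \<partial>Words n) \<partial>G) \<le> cost_factor * (2 * real (L + n) * (C * r ^ n))"
        unfolding real_norm_def[of "integral\<^sup>L G _"]
        by (rule integral_bounded_prob[OF G.prob_space_axioms]) (use le sp in auto)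
    qed
  qed (rule int)
  then show ?thesis by (simp only: n)
qed

lemma gateaux_eta_sum_aux: "F \<in> input_laws A \<Longrightarrow> gateaux A F (eta_sum \<Omega>) (eta_sum_deriv \<Omega> F)"
  unfolding gateaux_def using continuous_on_eta_sum_deriv eta_sum_mixture_tendsto integral_eta_sum_deriv by simp

end

lemma gateaux_eta_sum: "decaying \<Omega> \<Longrightarrow> F \<in> input_laws A \<Longrightarrow> gateaux A F (eta_sum \<Omega>) (eta_sum_deriv \<Omega> F)"
  unfolding decaying_def using gateaux_eta_sum_aux by blast

lemma eta_sum_summable:
  assumes "decaying \<Omega>" "F \<in> input_laws A"
  shows "summable (\<lambda>n. \<integral>w. indicator \<Omega> w * eta (wprob F w) \<partial>Words n)"
  using assms summable_eta_sum unfolding decaying_def by blast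

end

section \<open>Regeneration and the entropy rate\<close>

text \<open>Stolz-Cesaro with denominators \<open>n\<close>: from \<open>N\<close> on the increments
  are within \<open>e / 2\<close> of \<open>l\<close>, and the initial error \<open>c\<close> is
  divided away.\<close>

lemma cesaro_diff:
  fixes a :: "nat \<Rightarrow> real"
  assumes "(\<lambda>n. a (Suc n) - a n) \<longlonglongrightarrow> l"
  shows "(\<lambda>n. a n / real n) \<longlonglongrightarrow> l"
proof (rule LIMSEQ_I)
  fix e :: real assume e: "e > 0"
  obtain N where N: "\<And>k. k \<ge> N \<Longrightarrow> norm (a (Suc k) - a k - l) < e / 2"
    using LIMSEQ_D[OF assms, of "e / 2"] e by auto
  define c where "c = \<bar>a N - real N * l\<bar>"
  have b: "\<bar>a (N + k) - real (N + k) * l\<bar> \<le> c + real k * (e / 2)" for k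
  proof (induction k)
    case (Suc k)
    have "\<bar>a (Suc (N + k)) - a (N + k) - l\<bar> < e / 2" using N[of "N + k"] by simp
    moreover have "real (N + Suc k) * l = real (N + k) * l + l"
      and "real (Suc k) * (e / 2) = real k * (e / 2) + e / 2"
      by (simp_all add: algebra_simps add_divide_distrib)
    ultimately show ?case using Suc unfolding add_Suc_right by linarith
  qed (simp add: c_def)
  obtain M :: nat where M: "real M > 2 * c / e" using reals_Archimedean2 by blast
  show "\<exists>n0. \<forall>n\<ge>n0. norm (a n / real n - l) < e"
  proof (intro exI[of _ "Suc (max N M)"] allI impI)
    fix n assume n: "n \<ge> Suc (max N M)"
    then have n0: "real n > 0" and nM: "real n > real M" and nN: "n \<ge> N" by simp_all
    have "2 * c / e < real n" using M nM by linarith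
    then have c: "c < real n * (e / 2)" using e by (simp add: field_simps)
    have "\<bar>a n - real n * l\<bar> \<le> c + real (n - N) * (e / 2)" using b[of "n - N"] nN by simp
    also have "\<dots> \<le> c + real n * (e / 2)" using e by (intro add_left_mono mult_right_mono) auto
    also have "\<dots> < real n * e" using c by simp
    finally have "\<bar>a n - real n * l\<bar> / real n < e" using n0 by (simp add: field_simps)
    moreover have "a n / real n - l = (a n - real n * l) / real n" using n0 by (simp add: field_simps)
    ultimately show "norm (a n / real n - l) < e" by (simp only: real_norm_def abs_divide abs_of_nat)
  qed
qed

section \<open>Summing out letters of a word\<close>

lemma integral_words_add:
  fixes g :: "nat list \<Rightarrow> real"
  assumes g: "integrable (Words (m + n)) g"
  shows "(\<integral>w. g w \<partial>Words (m + n)) =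
      (\<integral>u. \<integral>v. g (u @ v) \<partial>Words n \<partial>Words m)" (is ?a)
    and "(\<integral>w. g w \<partial>Words (m + n)) =
      (\<integral>v. \<integral>u. g (u @ v) \<partial>Words m \<partial>Words n)" (is ?b)
proof -
  let ?M = "Words m" and ?N = "Words n"
  interpret M: sigma_finite_measure ?M by (rule sigma_finite_measure_count_space_countable) simp
  interpret N: sigma_finite_measure ?N by (rule sigma_finite_measure_count_space_countable) simp
  interpret P: pair_sigma_finite ?M ?N ..
  have pm: "?M \<Otimes>\<^sub>M ?N = count_space (words m \<times> words n)" by (simp add: pair_measure_countable)
  have e: "(\<integral>w. g w \<partial>Words (m + n)) = (\<integral>(u, v). g (u @ v) \<partial>(?M \<Otimes>\<^sub>M ?N))"
    unfolding pm using integral_bij_count_space[OF bij_words_add[of m n], of g] by (simp add: split_beta')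
  have i: "integrable (?M \<Otimes>\<^sub>M ?N) (\<lambda>(u, v). g (u @ v))"
    unfolding pm using integrable_bij_count_space[OF bij_words_add[of m n], of g] g by (simp add: split_beta')
  show ?a unfolding e using P.integral_fst[OF i] by simp
  show ?b unfolding e using P.integral_snd[OF i] by simp
qed

lemma integral_words_drop:
  fixes p g q :: "nat list \<Rightarrow> real"
  assumes i: "integrable (Words (m + n)) (\<lambda>w. p w * g (drop m w))"
    and q: "\<And>v. v \<in> words n \<Longrightarrow> (\<integral>u. p (u @ v) \<partial>Words m) = q v"
  shows "(\<integral>w. p w * g (drop m w) \<partial>Words (m + n)) = (\<integral>v. q v * g v \<partial>Words n)"
proof -
  have "(\<integral>w. p w * g (drop m w) \<partial>Words (m + n)) =
     (\<integral>v. \<integral>u. p (u @ v) * g (drop m (u @ v)) \<partial>Words m \<partial>Words n)"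
    by (rule integral_words_add(2)[OF i])
  also have "\<dots> = (\<integral>v. \<integral>u. p (u @ v) * g v \<partial>Words m \<partial>Words n)"
    by (intro Bochner_Integration.integral_cong refl) (simp add: words_def)
  also have "\<dots> = (\<integral>v. q v * g v \<partial>Words n)"
    by (intro Bochner_Integration.integral_cong refl) (simp add: q)
  finally show ?thesis .
qed

lemma integral_words_take:
  fixes p g q :: "nat list \<Rightarrow> real"
  assumes i: "integrable (Words (m + n)) (\<lambda>w. p w * g (take m w))"
    and q: "\<And>u. u \<in> words m \<Longrightarrow> (\<integral>v. p (u @ v) \<partial>Words n) = q u"
  shows "(\<integral>w. p w * g (take m w) \<partial>Words (m + n)) = (\<integral>u. q u * g u \<partial>Words m)"
proof -
  have "(\<integral>w. p w * g (take m w) \<partial>Words (m + n)) =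
     (\<integral>u. \<integral>v. p (u @ v) * g (take m (u @ v)) \<partial>Words n \<partial>Words m)"
    by (rule integral_words_add(1)[OF i])
  also have "\<dots> = (\<integral>u. \<integral>v. p (u @ v) * g u \<partial>Words n \<partial>Words m)"
    by (intro Bochner_Integration.integral_cong refl) (simp add: words_def)
  also have "\<dots> = (\<integral>u. q u * g u \<partial>Words m)"
    by (intro Bochner_Integration.integral_cong refl) (simp add: q)
  finally show ?thesis .
qed

context poisson_isi
begin

section \<open>Stationarity and marginals of the output\<close>

lemma Z_shift: "Z x (k + s) = Z (\<lambda>i. x (i + s)) k"
  unfolding intensity_def by (simp add: algebra_simps)

lemma lik_shift: "lik (t + s) w x = lik t w (\<lambda>i. x (i + s))"
proof (induction w arbitrary: t)
  case (Cons a w)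
  have "lik (t + s + 1) w x = lik (t + 1) w (\<lambda>i. x (i + s))"
    using Cons[of "t + 1"] by (simp add: ac_simps)
  then show ?case by (simp add: Z_shift)
qed simp

context
  fixes F assumes F: "F \<in> input_laws A"
begin

text \<open>The inputs are i.i.d., so a shift of time does not change their law; the starting time 0
  in \<open>wprob\<close> is immaterial.\<close>

lemma expect_lik: "expect F (lik s w) = wprob F w"
proof -
  have "lik s w x = lik 0 w (\<lambda>i. x (i + s))" for x using lik_shift[of 0 s w x] by simp
  then show ?thesis
    using integral_shift_paths[OF F measurable_lik, of 0 w s] by (simp add: expect_def wprob_def)
qed

lemma wprob_Nil [simp]: "wprob F [] = 1"
proof -
  interpret P: prob_space "PF F" by (rule prob_PiM_laws[OF F])
  show ?thesis by (simp add: wprob_def expect_def P.prob_space)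
qed

lemma path_prob: "prob_space (PF F)"
  by (rule prob_PiM_laws[OF F])

lemma path_space: "space (PF F) = space paths"
  by (rule space_PiM_laws[OF F])

lemma path_measurable: "f \<in> borel_measurable paths \<Longrightarrow> f \<in> borel_measurable (PF F)"
  by (rule family_measurable[OF F])

lemma ennreal_wprob:
  "ennreal (wprob F (u @ v)) = (\<integral>\<^sup>+x. ennreal (lik s u x) * ennreal (lik (s + int (length u)) v x) \<partial>PF F)"
proof -
  have "ennreal (wprob F (u @ v)) = (\<integral>\<^sup>+x. ennreal (lik s (u @ v) x) \<partial>PF F)"
    unfolding expect_lik[of s, symmetric] expect_def
    by (intro nn_integral_eq_integral[symmetric] family_integrable_lik[OF F] AE_I2 lik_nonneg) (simp add: path_space)
  also have "\<dots> = (\<integral>\<^sup>+x. ennreal (lik s u x) * ennreal (lik (s + int (length u)) v x) \<partial>PF F)"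
    by (intro nn_integral_cong) (simp add: path_space lik_append lik_nonneg ennreal_mult)
  finally show ?thesis .
qed

lemma nn_integral_swap_words:
  assumes "\<And>w. (\<lambda>x. g w x) \<in> borel_measurable paths"
  shows "(\<integral>\<^sup>+w. \<integral>\<^sup>+x. g w x \<partial>PF F \<partial>Words n) =
    (\<integral>\<^sup>+x. \<integral>\<^sup>+w. g w x \<partial>Words n \<partial>PF F)"
proof -
  let ?W = "Words n"
  interpret P: prob_space "PF F" by (rule path_prob)
  interpret W: sigma_finite_measure ?W by (rule sigma_finite_measure_count_space_countable) simp
  interpret PW: pair_sigma_finite ?W "PF F" ..
  have "g w \<in> borel_measurable (PF F)" for w
    using assms by (simp add: measurable_cong_sets[OF sets_PiM_laws[of "\<lambda>_. F", OF F] refl])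
  then show ?thesis
    by (intro PW.Fubini'[symmetric] measurable_pair_measure_countable1) simp_all
qed

lemma nn_marginal_left: "(\<integral>\<^sup>+u. ennreal (wprob F (u @ v)) \<partial>Words m) = ennreal (wprob F v)"
proof -
  have "(\<integral>\<^sup>+u. ennreal (wprob F (u @ v)) \<partial>Words m) =
     (\<integral>\<^sup>+u. \<integral>\<^sup>+x. ennreal (lik 0 u x) * ennreal (lik (int m) v x) \<partial>PF F \<partial>Words m)"
    by (intro nn_integral_cong) (simp add: ennreal_wprob[of _ v 0] words_def)
  also have "\<dots> = (\<integral>\<^sup>+x. \<integral>\<^sup>+u. ennreal (lik 0 u x) * ennreal (lik (int m) v x) \<partial>Words m \<partial>PF F)"
    by (rule nn_integral_swap_words) simp
  also have "\<dots> = (\<integral>\<^sup>+x. ennreal (lik (int m) v x) \<partial>PF F)"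
    by (intro nn_integral_cong) (simp add: nn_integral_multc path_space nn_lik_1)
  also have "\<dots> = ennreal (wprob F v)"
    using ennreal_wprob[of "[]" v "int m"] by simp
  finally show ?thesis .
qed

lemma nn_marginal_right: "(\<integral>\<^sup>+v. ennreal (wprob F (u @ v)) \<partial>Words m) = ennreal (wprob F u)"
proof -
  have "(\<integral>\<^sup>+v. ennreal (wprob F (u @ v)) \<partial>Words m) =
     (\<integral>\<^sup>+v. \<integral>\<^sup>+x. ennreal (lik 0 u x) * ennreal (lik (int (length u)) v x) \<partial>PF F \<partial>Words m)"
    by (intro nn_integral_cong) (simp add: ennreal_wprob[of u _ 0])
  also have "\<dots> = (\<integral>\<^sup>+x. \<integral>\<^sup>+v. ennreal (lik 0 u x) * ennreal (lik (int (length u)) v x) \<partial>Words m \<partial>PF F)"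
    by (rule nn_integral_swap_words) simp
  also have "\<dots> = (\<integral>\<^sup>+x. ennreal (lik 0 u x) \<partial>PF F)"
    by (intro nn_integral_cong) (simp add: nn_integral_cmult path_space nn_lik_1)
  also have "\<dots> = ennreal (wprob F u)"
    using ennreal_wprob[of u "[]" 0] by simp
  finally show ?thesis .
qed

lemma wprob_nonneg: "0 \<le> wprob F w" using wprob_bounds(3)[OF F, of w] by simp

lemma marginal_left: "(\<integral>u. wprob F (u @ v) \<partial>Words m) = wprob F v"
  using nn_marginal_left[where v=v and m=m] by (subst integral_eq_nn_integral) (simp_all add: wprob_nonneg)

lemma marginal_right: "(\<integral>v. wprob F (u @ v) \<partial>Words m) = wprob F u"
  using nn_marginal_right[where u=u and m=m] by (subst integral_eq_nn_integral) (simp_all add: wprob_nonneg)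

lemma integrable_wprob_mult:
  assumes "\<And>w. w \<in> words n \<Longrightarrow> \<bar>g w\<bar> \<le> Cost w"
  shows "integrable (Words n) (\<lambda>w. wprob F w * g w)"
proof (rule Bochner_Integration.integrable_bound)
  show "integrable (Words n) (\<lambda>w. cost_factor * (indicator UNIV w * (Theta w * (\<integral>x. lik 0 w x \<partial>PF F))))"
    by (intro integrable_mult_right integrable_family_mass[OF F])
  have "norm (wprob F w * g w) \<le> norm (cost_factor * (indicator UNIV w * (Theta w * (\<integral>x. lik 0 w x \<partial>PF F))))"
    if "w \<in> words n" for w
  proof -
    have "\<bar>wprob F w * g w\<bar> \<le> wprob F w * (cost_factor * Theta w)"
      unfolding abs_mult using assms[OF that] Cost_cost_factor[of w] wprob_nonneg[of w] by (intro mult_mono) auto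
    then show ?thesis by (simp add: wprob_def expect_def mult_ac)
  qed
  then show "AE w in Words n. norm (wprob F w * g w) \<le>
      norm (cost_factor * (indicator UNIV w * (Theta w * (\<integral>x. lik 0 w x \<partial>PF F))))"
    unfolding AE_count_space by blast
qed simp

lemma integral_wprob_drop:
  assumes g: "\<And>w. w \<in> words n \<Longrightarrow> \<bar>g w\<bar> \<le> Cost w"
  shows "(\<integral>w. wprob F w * g (drop m w) \<partial>Words (m + n)) = (\<integral>v. wprob F v * g v \<partial>Words n)"
  by (rule integral_words_drop[OF _ marginal_left], rule integrable_wprob_mult, rule order_trans[OF g Cost_drop])
    (simp add: words_def)

lemma integral_wprob_take:
  assumes g: "\<And>w. w \<in> words m \<Longrightarrow> \<bar>g w\<bar> \<le> Cost w"
  shows "(\<integral>w. wprob F w * g (take m w) \<partial>Words (m + n)) = (\<integral>v. wprob F v * g v \<partial>Words m)"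
  by (rule integral_words_take[OF _ marginal_right], rule integrable_wprob_mult, rule order_trans[OF g Cost_take])
    (simp add: words_def)

lemma ln_wprob_abs_le: "\<bar>ln (wprob F w)\<bar> \<le> Cost w"
proof -
  have "- Cost w \<le> ln (wprob F w)" "ln (wprob F w) \<le> 0"
    using wprob_bounds[OF F, of w] by (simp_all add: ln_ge_iff)
  then show ?thesis by linarith
qed

end

section \<open>Factorisation across a run of zeros\<close>

definition cut_after :: "int \<Rightarrow> (int \<Rightarrow> real) \<Rightarrow> int \<Rightarrow> real" where
  "cut_after s x i = (if i < s then x i else 0)"

definition cut_before :: "int \<Rightarrow> (int \<Rightarrow> real) \<Rightarrow> int \<Rightarrow> real" where
  "cut_before s x i = (if i < s then 0 else x i)"

lemma zero_path: "(\<lambda>_. 0) \<in> space paths"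
  using A_nonneg by (simp add: space_input_paths)

lemma cut_in_space: "x \<in> space paths \<Longrightarrow> cut_after s x \<in> space paths" "x \<in> space paths \<Longrightarrow> cut_before s x \<in> space paths"
  using A_nonneg by (auto simp: space_input_paths cut_after_def cut_before_def)

lemma measurable_cut: "cut_after s \<in> paths \<rightarrow>\<^sub>M paths" "cut_before s \<in> paths \<rightarrow>\<^sub>M paths"
proof -
  have p: "(\<lambda>x. (x, \<lambda>_. 0)) \<in> paths \<rightarrow>\<^sub>M paths \<Otimes>\<^sub>M paths" using zero_path by (intro measurable_Pair2') simp
  have "(\<lambda>x i. if i \<in> {..<s} then fst (x, \<lambda>_::int. 0::real) i else snd (x, \<lambda>_. 0) i) \<in> paths \<rightarrow>\<^sub>M paths"
    by (rule measurable_compose[OF p measurable_merge_paths[where K="{..<s}"]])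
  moreover have "(\<lambda>x i. if i \<in> {..<s} then fst (x, \<lambda>_::int. 0::real) i else snd (x, \<lambda>_. 0) i) = cut_after s"
    by (auto simp: fun_eq_iff cut_after_def)
  ultimately show "cut_after s \<in> paths \<rightarrow>\<^sub>M paths" by simp
  have "(\<lambda>x i. if i \<in> {s..} then fst (x, \<lambda>_::int. 0::real) i else snd (x, \<lambda>_. 0) i) \<in> paths \<rightarrow>\<^sub>M paths"
    by (rule measurable_compose[OF p measurable_merge_paths[where K="{s..}"]])
  moreover have "(\<lambda>x i. if i \<in> {s..} then fst (x, \<lambda>_::int. 0::real) i else snd (x, \<lambda>_. 0) i) = cut_before s"
    by (auto simp: fun_eq_iff cut_before_def)
  ultimately show "cut_before s \<in> paths \<rightarrow>\<^sub>M paths" by simp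
qed

text \<open>The two cut paths add up to \<open>x\<close>, but the background \<open>lam0\<close> is
  then counted twice.\<close>

lemma Z_cut: "Z x k = Z (cut_after s x) k + Z (cut_before s x) k - lam0"
proof -
  have "(\<Sum>l=0..L. h l * x (k - int l)) =
    (\<Sum>l=0..L. h l * cut_after s x (k - int l) + h l * cut_before s x (k - int l))"
    by (intro sum.cong refl) (simp add: cut_after_def cut_before_def)
  then show ?thesis by (simp add: intensity_def sum.distrib)
qed

text \<open>A zero output has likelihood \<open>exp (- Z)\<close>, which turns the additive split of
  the intensity into a product. The constant \<open>exp (lam0 * n)\<close> compensates for the
  doubled background.\<close>

lemma lik_zeros_cut:
  "lik t (replicate n 0) x = exp (lam0 * real n) * (lik t (replicate n 0) (cut_after s x) * lik t (replicate n 0) (cut_before s x))"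
proof (induction n arbitrary: t)
  case (Suc n)
  have "exp (- Z x t) = exp lam0 * (exp (- Z (cut_after s x) t) * exp (- Z (cut_before s x) t))"
    by (simp only: exp_add[symmetric] Z_cut[of x t s]) (simp add: algebra_simps)
  moreover have "exp (lam0 * real (Suc n)) = exp lam0 * exp (lam0 * real n)"
    by (simp add: exp_add[symmetric] algebra_simps)
  ultimately show ?case
    unfolding replicate_Suc lik.simps pois_def by (simp only: Suc[of "t + 1"]) simp
qed simp

text \<open>Merging two independent copies of the path along \<open>K\<close> gives each factor its
  own copy.\<close>

lemma expect_mult_split:
  assumes F: "F \<in> input_laws A"
    and f: "f \<in> borel_measurable paths" "\<And>x. x \<in> space paths \<Longrightarrow> \<bar>f x\<bar> \<le> 1"
    and g: "g \<in> borel_measurable paths" "\<And>x. x \<in> space paths \<Longrightarrow> \<bar>g x\<bar> \<le> 1"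
    and df: "depends_on (space paths) K f" and dg: "depends_on (space paths) (- K) g"
  shows "expect F (\<lambda>x. f x * g x) = expect F f * expect F g"
proof -
  have m: "(\<lambda>x. f x * g x) \<in> borel_measurable paths" using f g by simp
  have b: "\<bar>f x * g x\<bar> \<le> 1" if "x \<in> space paths" for x
    unfolding abs_mult using f(2)[OF that] g(2)[OF that] by (intro mult_le_one) auto
  have "expect F (\<lambda>x. f x * g x) = (\<integral>x. \<integral>y. f (\<lambda>i. if i \<in> K then x i else y i) * g (\<lambda>i. if i \<in> K then x i else y i)
      \<partial>PF F \<partial>PF F)"
    using integral_merge[where K=K and ?M1.0="\<lambda>_. F" and ?M2.0="\<lambda>_. F", OF F F m b] by (simp add: expect_def)
  also have "\<dots> = (\<integral>x. \<integral>y. f x * g y \<partial>PF F \<partial>PF F)"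
  proof (intro Bochner_Integration.integral_cong refl)
    fix x y assume "x \<in> space (PF F)" "y \<in> space (PF F)"
    then have xy: "x \<in> space paths" "y \<in> space paths" by (simp_all add: path_space[OF F])
    have "f (\<lambda>i. if i \<in> K then x i else y i) = f x"
      by (intro df[unfolded depends_on_def, rule_format] merge_in_space xy) simp
    moreover have "g (\<lambda>i. if i \<in> K then x i else y i) = g y"
      by (intro dg[unfolded depends_on_def, rule_format] merge_in_space xy) simp
    ultimately show "f (\<lambda>i. if i \<in> K then x i else y i) * g (\<lambda>i. if i \<in> K then x i else y i) = f x * g y"
      by simp
  qed
  finally show ?thesis by (simp add: expect_def)
qed

text \<open>Cut the inputs at the time \<open>s\<close> of the first zero. The word \<open>p\<close>
  and the \<open>cut_after\<close> factor of the zeros read inputs before \<open>s\<close>;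
  \<open>q\<close> and the \<open>cut_before\<close> factor read inputs from \<open>s\<close> on,
  since the run covers the memory of the channel. The two sides are independent.\<close>

lemma wprob_zeros_factor:
  assumes F: "F \<in> input_laws A"
  shows "\<exists>a b. \<forall>p q. wprob F (p @ replicate (Suc L) 0 @ q) = a p * b q"
proof -
  let ?z = "replicate (Suc L) (0::nat)"
  let ?R = "int (Suc L)"
  define a where "a p = exp (lam0 * real (Suc L)) * expect F (\<lambda>x. lik 0 p x * lik (int (length p)) ?z (cut_after (int (length p)) x))" for p
  define b where "b q = expect F (\<lambda>x. lik 0 ?z (cut_before 0 x) * lik ?R q x)" for q
  have "wprob F (p @ ?z @ q) = a p * b q" for p q
  proof -
    define s where "s = int (length p)"
    define f where "f x = lik 0 p x * lik s ?z (cut_after s x)" for x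
    define g where "g x = lik s ?z (cut_before s x) * lik (s + ?R) q x" for x
    have e: "lik 0 (p @ ?z @ q) x = exp (lam0 * real (Suc L)) * (f x * g x)" for x
    proof -
      have "lik 0 (p @ ?z @ q) x = lik 0 p x * (lik s ?z x * lik (s + ?R) q x)"
        unfolding lik_append s_def by (simp del: replicate_Suc)
      then show ?thesis unfolding lik_zeros_cut[of s "Suc L" x s] f_def g_def by (simp only: mult_ac)
    qed
    have fm: "f \<in> borel_measurable paths" and gm: "g \<in> borel_measurable paths"
      unfolding f_def g_def
      by (intro borel_measurable_times measurable_lik measurable_compose[OF measurable_cut(1) measurable_lik]
        measurable_compose[OF measurable_cut(2) measurable_lik])+
    have fb: "\<bar>f x\<bar> \<le> 1" and gb: "\<bar>g x\<bar> \<le> 1" if "x \<in> space paths" for x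
      unfolding f_def g_def abs_mult
      by (intro mult_le_one lik_abs_le_1 that cut_in_space abs_ge_zero)+
    have fd: "depends_on (space paths) {..<s} f"
      unfolding depends_on_def f_def
    proof (intro ballI impI arg_cong2[where f="(*)"])
      fix x y :: "int \<Rightarrow> real" assume xy: "\<forall>k\<in>{..<s}. x k = y k"
      show "lik 0 p x = lik 0 p y" by (rule lik_cong) (use xy in \<open>auto simp: s_def\<close>)
      have "cut_after s x = cut_after s y" using xy by (auto simp: cut_after_def fun_eq_iff)
      then show "lik s ?z (cut_after s x) = lik s ?z (cut_after s y)" by simp
    qed
    have gd: "depends_on (space paths) (- {..<s}) g"
      unfolding depends_on_def g_def
    proof (intro ballI impI arg_cong2[where f="(*)"])
      fix x y :: "int \<Rightarrow> real" assume xy: "\<forall>k\<in>- {..<s}. x k = y k"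
      show "lik (s + ?R) q x = lik (s + ?R) q y" by (rule lik_cong) (use xy in auto)
      have "cut_before s x = cut_before s y" using xy by (auto simp: cut_before_def fun_eq_iff)
      then show "lik s ?z (cut_before s x) = lik s ?z (cut_before s y)" by simp
    qed
    \<comment> \<open>By stationarity the right factor may be computed as if the run started at time
      0, so \<open>b\<close> depends on \<open>q\<close> alone and not on the length of
      \<open>p\<close>.\<close>
    have gs: "expect F g = b q"
    proof -
      have "g x = (\<lambda>x. lik 0 ?z (cut_before 0 x) * lik ?R q x) (\<lambda>i. x (i + s))" for x
      proof -
        have "lik s ?z (cut_before s x) = lik 0 ?z (cut_before 0 (\<lambda>i. x (i + s)))"
          using lik_shift[of 0 s ?z "cut_before s x"]
          by (simp add: cut_before_def[abs_def] del: replicate_Suc)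
        moreover have "lik (s + ?R) q x = lik ?R q (\<lambda>i. x (i + s))"
          using lik_shift[of ?R s q x] by (simp only: add.commute)
        ultimately show ?thesis by (simp only: g_def)
      qed
      then have "expect F g = (\<integral>x. (\<lambda>x. lik 0 ?z (cut_before 0 x) * lik ?R q x) (\<lambda>i. x (i + s)) \<partial>PF F)"
        unfolding expect_def by (intro Bochner_Integration.integral_cong refl)
      also have "\<dots> = b q"
        unfolding b_def expect_def
        by (rule integral_shift_paths[OF F]) (intro borel_measurable_times measurable_lik
          measurable_compose[OF measurable_cut(2) measurable_lik])
      finally show ?thesis .
    qed
    have "wprob F (p @ ?z @ q) = exp (lam0 * real (Suc L)) * expect F (\<lambda>x. f x * g x)"
      unfolding wprob_def expect_def e by simp
    also have "expect F (\<lambda>x. f x * g x) = expect F f * expect F g"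
      by (rule expect_mult_split[OF F fm fb gm gb fd gd])
    finally show ?thesis unfolding gs a_def f_def[abs_def] s_def by (simp only: mult_ac)
  qed
  then show ?thesis by blast
qed

text \<open>A run of \<open>L + 1\<close> zeros has likelihood \<open>exp\<close> of a linear form in the inputs, hence makes past and
  future outputs conditionally independent.\<close>

lemma wprob_regen:
  assumes F: "F \<in> input_laws A" and m: "regen m"
  shows "wprob F (u @ m @ v) * wprob F m = wprob F (u @ m) * wprob F (m @ v)"
proof -
  obtain p q where pq: "m = p @ replicate (Suc L) 0 @ q" using m by (auto simp only: regen_def)
  obtain a b where ab: "\<And>p q. wprob F (p @ replicate (Suc L) 0 @ q) = a p * b q"
    using wprob_zeros_factor[OF F] by blast
  have "wprob F (u @ m @ v) = a (u @ p) * b (q @ v)" using ab[of "u @ p" "q @ v"] by (simp only: pq append_assoc)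
  moreover have "wprob F (u @ m) = a (u @ p) * b q" using ab[of "u @ p" q] by (simp only: pq append_assoc)
  moreover have "wprob F (m @ v) = a p * b (q @ v)" using ab[of p "q @ v"] by (simp only: pq append_assoc)
  moreover have "wprob F m = a p * b q" using ab[of p q] by (simp only: pq)
  ultimately show ?thesis by (simp only: mult_ac)
qed


section \<open>Second differences of the block entropies\<close>

lemma margins_iff:
  assumes "length w = i + k + j"
  shows "w \<in> margins i j P \<longleftrightarrow> take k (drop i w) \<in> P"
proof
  assume "w \<in> margins i j P"
  then obtain u m v where w: "w = u @ m @ v" "length u = i" "m \<in> P" "length v = j"
    unfolding margins_def by blast
  then have "length m = k" using assms by simp
  then show "take k (drop i w) \<in> P" using w by simp
next
  assume m: "take k (drop i w) \<in> P"
  have "w = take i w @ take k (drop i w) @ drop k (drop i w)" by (metis append_take_drop_id)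
  moreover have "length (take i w) = i" "length (drop k (drop i w)) = j" using assms by auto
  ultimately show "w \<in> margins i j P" using m unfolding margins_def by blast
qed

lemma margins_0: "margins 0 0 P = P"
  by (auto simp: margins_def)

definition block_eta :: "nat list set \<Rightarrow> real measure \<Rightarrow> nat \<Rightarrow> real" where
  "block_eta P F k = (\<integral>w. indicator P w * eta (wprob F w) \<partial>Words k)"

text \<open>Here \<open>i\<close> is the length of the subword inside the logarithm and
  \<open>j\<close> its offset. The integral always runs over words of length \<open>k + 2\<close>,
  so that four such terms can be combined pointwise.\<close>

definition info_part :: "real measure \<Rightarrow> nat \<Rightarrow> nat list set \<Rightarrow> nat \<Rightarrow> nat \<Rightarrow> real" where
  "info_part F k P i j = (\<integral>w. wprob F w * (indicator P (take k (drop 1 w)) * ln (wprob F (take i (drop j w))))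
     \<partial>Words (Suc (Suc k)))"

text \<open>The contribution of the middle words in \<open>P\<close> to the mutual information of the first and the
  last of \<open>k + 2\<close> outputs given the \<open>k\<close> outputs in between.\<close>

definition cond_info :: "real measure \<Rightarrow> nat \<Rightarrow> nat list set \<Rightarrow> real" where
  "cond_info F k P = info_part F k P (Suc (Suc k)) 0 + info_part F k P k 1
     - info_part F k P (Suc k) 1 - info_part F k P (Suc k) 0"

context
  fixes F assumes F: "F \<in> input_laws A"
begin

lemma ind_ln_le: "\<bar>indicator P w * ln (wprob F w)\<bar> \<le> Cost w"
  using ln_wprob_abs_le[OF F, of w] Cost_nonneg[of w] by (simp add: indicator_def)

lemma ind_ln_sub_le: "\<bar>indicator P m * ln (wprob F (take i (drop j w)))\<bar> \<le> Cost w"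
proof -
  have "\<bar>indicator P m * ln (wprob F (take i (drop j w)))\<bar> \<le> \<bar>ln (wprob F (take i (drop j w)))\<bar>"
    by (simp add: indicator_def)
  also have "\<dots> \<le> Cost (take i (drop j w))" by (rule ln_wprob_abs_le[OF F])
  also have "\<dots> \<le> Cost (drop j w)" by (rule Cost_take)
  also have "\<dots> \<le> Cost w" by (rule Cost_drop)
  finally show ?thesis .
qed

lemma info_part_integrable:
  "integrable (Words (Suc (Suc k)))
     (\<lambda>w. wprob F w * (indicator P (take k (drop 1 w)) * ln (wprob F (take i (drop j w)))))"
  by (rule integrable_wprob_mult[OF F ind_ln_sub_le])

lemma wprob_ind_ln_eq: "(\<integral>w. wprob F w * (indicator P w * ln (wprob F w)) \<partial>Words k) = block_eta P F k"
  unfolding block_eta_def by (simp add: eta_def mult_ac)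

text \<open>Each of the four integrands reads only a subword. Summing out the remaining letters,
  with stationarity when the first one is removed, leaves a sum of \<open>eta\<close> over shorter
  words.\<close>

lemma cond_info_expand:
  "cond_info F k P = block_eta (margins 1 1 P) F (Suc (Suc k)) + block_eta P F k
     - block_eta (margins 0 1 P) F (Suc k) - block_eta (margins 1 0 P) F (Suc k)"
proof -
  let ?W = "\<lambda>n. Words n"
  have 1: "info_part F k P (Suc (Suc k)) 0 = block_eta (margins 1 1 P) F (Suc (Suc k))"
    unfolding info_part_def wprob_ind_ln_eq[symmetric]
  proof (intro Bochner_Integration.integral_cong refl)
    fix w assume "w \<in> space (?W (Suc (Suc k)))"
    then have l: "length w = 1 + k + 1" by (simp add: words_def)
    then show "wprob F w * (indicator P (take k (drop 1 w)) * ln (wprob F (take (Suc (Suc k)) (drop 0 w)))) =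
       wprob F w * (indicator (margins 1 1 P) w * ln (wprob F w))"
      using margins_iff[OF l, of P] by (simp add: indicator_def)
  qed
  have 2: "info_part F k P k 1 = block_eta P F k"
  proof -
    have "(\<integral>w. wprob F w * (indicator P (take k (drop 1 w)) * ln (wprob F (take k (drop 1 w)))) \<partial>?W (1 + Suc k)) =
       (\<integral>v. wprob F v * (indicator P (take k v) * ln (wprob F (take k v))) \<partial>?W (Suc k))"
      by (rule integral_wprob_drop[OF F, where m=1 and n="Suc k" and g="\<lambda>v. indicator P (take k v) * ln (wprob F (take k v))"])
        (use ind_ln_sub_le[of P _ k 0] in simp)
    also have "(\<integral>v. wprob F v * (indicator P (take k v) * ln (wprob F (take k v))) \<partial>?W (k + 1)) =
       (\<integral>v. wprob F v * (indicator P v * ln (wprob F v)) \<partial>?W k)"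
      by (rule integral_wprob_take[OF F, where m=k and n=1 and g="\<lambda>v. indicator P v * ln (wprob F v)"]) (rule ind_ln_le)
    ultimately show ?thesis by (simp add: wprob_ind_ln_eq info_part_def)
  qed
  have 3: "info_part F k P (Suc k) 1 = block_eta (margins 0 1 P) F (Suc k)"
  proof -
    have "(\<integral>w. wprob F w * (indicator P (take k (drop 1 w)) * ln (wprob F (take (Suc k) (drop 1 w)))) \<partial>?W (1 + Suc k)) =
       (\<integral>v. wprob F v * (indicator P (take k v) * ln (wprob F (take (Suc k) v))) \<partial>?W (Suc k))"
      by (rule integral_wprob_drop[OF F, where m=1 and n="Suc k" and g="\<lambda>v. indicator P (take k v) * ln (wprob F (take (Suc k) v))"])
        (use ind_ln_sub_le[of P _ "Suc k" 0] in simp)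
    also have "\<dots> = block_eta (margins 0 1 P) F (Suc k)"
      unfolding wprob_ind_ln_eq[symmetric]
    proof (intro Bochner_Integration.integral_cong refl)
      fix v assume "v \<in> space (?W (Suc k))"
      then have l: "length v = 0 + k + 1" by (simp add: words_def)
      then show "wprob F v * (indicator P (take k v) * ln (wprob F (take (Suc k) v))) =
         wprob F v * (indicator (margins 0 1 P) v * ln (wprob F v))"
        using margins_iff[OF l, of P] by (simp add: indicator_def)
    qed
    finally show ?thesis by (simp add: info_part_def)
  qed
  have 4: "info_part F k P (Suc k) 0 = block_eta (margins 1 0 P) F (Suc k)"
  proof -
    have "(\<integral>w. wprob F w * (indicator P (take k (drop 1 w)) * ln (wprob F (take (Suc k) (drop 0 w)))) \<partial>?W (Suc k + 1)) =
      (\<integral>w. wprob F w * (indicator P (drop 1 (take (Suc k) w)) * ln (wprob F (take (Suc k) w))) \<partial>?W (Suc k + 1))"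
      by (intro Bochner_Integration.integral_cong refl) (simp add: words_def take_drop)
    also have "\<dots> = (\<integral>v. wprob F v * (indicator P (drop 1 v) * ln (wprob F v)) \<partial>?W (Suc k))"
      by (rule integral_wprob_take[OF F, where m="Suc k" and n=1 and g="\<lambda>v. indicator P (drop 1 v) * ln (wprob F v)"])
        (use ind_ln_sub_le[of P] words_def in \<open>metis (no_types, lifting) drop0 mem_Collect_eq order_refl take_all\<close>)
    also have "\<dots> = block_eta (margins 1 0 P) F (Suc k)"
      unfolding wprob_ind_ln_eq[symmetric]
    proof (intro Bochner_Integration.integral_cong refl)
      fix v assume "v \<in> space (?W (Suc k))"
      then have l: "length v = 1 + k + 0" by (simp add: words_def)
      then show "wprob F v * (indicator P (drop 1 v) * ln (wprob F v)) =
         wprob F v * (indicator (margins 1 0 P) v * ln (wprob F v))"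
        using margins_iff[OF l, of P] by (simp add: indicator_def)
    qed
    finally show ?thesis by (simp add: info_part_def)
  qed
  show ?thesis unfolding cond_info_def 1 2 3 4 ..
qed

text \<open>By \<open>wprob_regen\<close> the four logarithms cancel for each word separately,
  before any integration.\<close>

lemma cond_info_regen: "cond_info F k {w. regen w} = 0"
proof -
  let ?t = "\<lambda>i j w. wprob F w * (indicator {w. regen w} (take k (drop 1 w)) * ln (wprob F (take i (drop j w))))"
  have "cond_info F k {w. regen w} = (\<integral>w. ?t (Suc (Suc k)) 0 w + ?t k 1 w - ?t (Suc k) 1 w - ?t (Suc k) 0 w
      \<partial>Words (Suc (Suc k)))"
    unfolding cond_info_def info_part_def
    by (simp only: Bochner_Integration.integral_add Bochner_Integration.integral_diff
      Bochner_Integration.integrable_add Bochner_Integration.integrable_diff info_part_integrable)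
  also have "\<dots> = (\<integral>w. 0 \<partial>Words (Suc (Suc k)))"
  proof (intro Bochner_Integration.integral_cong refl)
    fix w assume "w \<in> space (Words (Suc (Suc k)))"
    then have l: "length w = Suc (Suc k)" by (simp add: words_def)
    define u m v where "u = take 1 w" and m: "m = take k (drop 1 w)" and "v = drop (Suc k) w"
    have d: "drop 1 w = m @ v"
      using append_take_drop_id[of k "drop 1 w"] by (simp add: m \<open>v = _\<close>)
    have "w = u @ drop 1 w" by (simp only: \<open>u = _\<close> append_take_drop_id)
    then have e: "w = u @ m @ v" by (simp only: d)
    have t: "take (Suc k) w = u @ m"
      using take_add[of 1 k w] by (simp add: \<open>u = _\<close> m)
    have "take (Suc (Suc k)) (drop 0 w) = w" "take (Suc k) (drop 1 w) = drop 1 w" using l by simp_all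
    then have w: "take (Suc (Suc k)) (drop 0 w) = u @ m @ v" "take (Suc k) (drop 1 w) = m @ v"
        "take (Suc k) (drop 0 w) = u @ m"
      unfolding d drop_0 t using e by simp_all
    have "ln (wprob F (u @ m @ v)) + ln (wprob F m) = ln (wprob F (m @ v)) + ln (wprob F (u @ m))" if "regen m"
    proof -
      have "ln (wprob F (u @ m @ v) * wprob F m) = ln (wprob F (u @ m) * wprob F (m @ v))"
        by (simp only: wprob_regen[OF F that])
      then show ?thesis using wprob_bounds(3)[OF F] by (simp add: ln_mult_pos)
    qed
    then have "indicator {w. regen w} m * (ln (wprob F (u @ m @ v)) + ln (wprob F m) - ln (wprob F (m @ v)) - ln (wprob F (u @ m))) = 0"
      by (simp add: indicator_def)
    then show "?t (Suc (Suc k)) 0 w + ?t k 1 w - ?t (Suc k) 1 w - ?t (Suc k) 0 w = 0"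
      unfolding w m[symmetric]
      by (simp only: distrib_left[symmetric] right_diff_distrib[symmetric] mult_zero_right)
  qed
  finally show ?thesis by simp
qed

lemma cond_info_not_regen: "cond_info F k UNIV = cond_info F k {w. \<not> regen w}"
proof -
  have "info_part F k UNIV i j = info_part F k {w. regen w} i j + info_part F k {w. \<not> regen w} i j" for i j
    unfolding info_part_def Bochner_Integration.integral_add[OF info_part_integrable info_part_integrable, symmetric]
    by (intro Bochner_Integration.integral_cong refl) (simp add: indicator_def)
  then show ?thesis using cond_info_regen[of k] by (simp add: cond_info_def)
qed

lemma block_eta_UNIV_margins: "block_eta (margins i j UNIV) F (i + k + j) = block_eta UNIV F (i + k + j)"
  unfolding block_eta_def
proof (intro Bochner_Integration.integral_cong refl)
  fix w assume "w \<in> space (Words (i + k + j))"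
  then have "length w = i + k + j" by (simp add: words_def)
  from margins_iff[OF this, of UNIV]
  show "indicator (margins i j UNIV) w * eta (wprob F w) = indicator UNIV w * eta (wprob F w)" by simp
qed

text \<open>For \<open>P = UNIV\<close> the two terms of length \<open>k + 1\<close> coincide and
  \<open>cond_info\<close> is the second difference; splitting \<open>UNIV\<close> by
  \<open>regen\<close> then discards all words whose middle has a run.\<close>

lemma second_difference:
  "block_eta UNIV F (Suc (Suc k)) + block_eta UNIV F k - 2 * block_eta UNIV F (Suc k) =
     block_eta (margins 1 1 {w. \<not> regen w}) F (Suc (Suc k)) + block_eta {w. \<not> regen w} F k
     - block_eta (margins 0 1 {w. \<not> regen w}) F (Suc k) - block_eta (margins 1 0 {w. \<not> regen w}) F (Suc k)"
  using cond_info_expand[of k UNIV] cond_info_expand[of k "{w. \<not> regen w}"] cond_info_not_regen[of k]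
    block_eta_UNIV_margins[of 1 1 k] block_eta_UNIV_margins[of 0 1 k] block_eta_UNIV_margins[of 1 0 k]
  by (simp add: margins_0)

text \<open>The index shift by \<open>i + j\<close> between second differences and series therefore
  drops only zero terms.\<close>

lemma block_eta_short: "n < i + j \<Longrightarrow> block_eta (margins i j P) F n = 0"
  unfolding block_eta_def
  by (rule integral_eq_zero_AE) (auto simp: margins_def words_def indicator_def AE_count_space)

lemma block_eta_margins_sums:
  assumes "decaying P"
  shows "(\<lambda>k. block_eta (margins i j P) F (k + (i + j))) sums eta_sum (margins i j P) F"
proof -
  have "summable (block_eta (margins i j P) F)"
    unfolding block_eta_def[abs_def] by (rule eta_sum_summable[OF decaying_margins[OF assms] F])
  then have "block_eta (margins i j P) F sums eta_sum (margins i j P) F"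
    unfolding eta_sum_def block_eta_def[symmetric] by (rule summable_sums)
  from sums_split_initial_segment[OF this, of "i + j"] show ?thesis
    by (simp add: block_eta_short)
qed

text \<open>The first increment of the block sums, which is the term of a single output, plus the
  sum of all second differences.\<close>

definition neg_entropy_rate :: real where
  "neg_entropy_rate = eta_sum (words 1) F + (eta_sum (margins 1 1 {w. \<not> regen w}) F + eta_sum {w. \<not> regen w} F
     - eta_sum (margins 0 1 {w. \<not> regen w}) F - eta_sum (margins 1 0 {w. \<not> regen w}) F)"

lemma block_eta_0: "block_eta UNIV F 0 = 0"
  unfolding block_eta_def words_0 by (simp add: lebesgue_integral_count_space_finite wprob_Nil[OF F] eta_def)

lemma eta_sum_words: "eta_sum (words n) F = block_eta UNIV F n"
proof -
  have "block_eta (words n) F k = 0" if "k \<noteq> n" for k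
    unfolding block_eta_def using that
    by (intro integral_eq_zero_AE) (auto simp: words_def indicator_def AE_count_space)
  then have "eta_sum (words n) F = (\<Sum>k\<in>{n}. block_eta (words n) F k)"
    unfolding eta_sum_def block_eta_def[symmetric] by (intro suminf_finite) auto
  also have "\<dots> = block_eta UNIV F n"
    unfolding block_eta_def by (simp, intro Bochner_Integration.integral_cong refl) simp
  finally show ?thesis .
qed

theorem block_eta_tendsto: "(\<lambda>n. block_eta UNIV F n / real n) \<longlonglongrightarrow> neg_entropy_rate"
proof (rule cesaro_diff)
  let ?B = "{w. \<not> regen w}"
  let ?J = "\<lambda>k. block_eta (margins 1 1 ?B) F (Suc (Suc k)) + block_eta ?B F k
     - block_eta (margins 0 1 ?B) F (Suc k) - block_eta (margins 1 0 ?B) F (Suc k)"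
  have "?J sums (eta_sum (margins 1 1 ?B) F + eta_sum ?B F - eta_sum (margins 0 1 ?B) F - eta_sum (margins 1 0 ?B) F)"
    using block_eta_margins_sums[OF decaying_not_regen, of 1 1] block_eta_margins_sums[OF decaying_not_regen, of 0 0]
      block_eta_margins_sums[OF decaying_not_regen, of 0 1] block_eta_margins_sums[OF decaying_not_regen, of 1 0]
    by (intro sums_add sums_diff) (simp_all add: margins_0)
  then have lim: "(\<lambda>n. \<Sum>k<n. ?J k) \<longlonglongrightarrow> eta_sum (margins 1 1 ?B) F + eta_sum ?B F - eta_sum (margins 0 1 ?B) F - eta_sum (margins 1 0 ?B) F"
    by (simp add: sums_def)
  \<comment> \<open>Summing the second differences recovers the increments. The block sum at length
    0 is 0, so the initial increment is the single-output term.\<close>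
  have "block_eta UNIV F (Suc n) - block_eta UNIV F n = eta_sum (words 1) F + (\<Sum>k<n. ?J k)" for n
  proof (induction n)
    case 0
    show ?case by (simp add: eta_sum_words block_eta_0)
  next
    case (Suc n)
    then show ?case using second_difference[of n] by simp
  qed
  then show "(\<lambda>n. block_eta UNIV F (Suc n) - block_eta UNIV F n) \<longlonglongrightarrow> neg_entropy_rate"
    unfolding neg_entropy_rate_def by (simp only:) (intro tendsto_add tendsto_const lim)
qed

end


section \<open>The entropy of the noise\<close>

text \<open>This is \<open>- \<phi>(z)\<close> at positive means. The series over \<open>eta\<close>
  is the form in which it arises from the log-likelihood, and the one to which the Weierstrass test
  applies.\<close>

definition neg_pois_entropy :: "real \<Rightarrow> real" where
  "neg_pois_entropy z = (\<Sum>m. eta (pois z m))"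

definition pois_bound :: "nat \<Rightarrow> real" where
  "pois_bound m = cost_const * exp zmax * (pois zmax m * 4 ^ m)"

lemma summable_pois_bound: "summable pois_bound"
  unfolding pois_bound_def[abs_def] using pois_weighted_sums[of zmax 4]
  by (intro summable_mult) (rule sums_summable)

lemma eta_pois_le:
  assumes "z \<in> {lam0..zmax}"
  shows "\<bar>eta (pois z m)\<bar> \<le> pois_bound m"
proof -
  have z: "lam0 \<le> z" "z \<le> zmax" "0 \<le> z" using assms lam0_pos by auto
  have e: "t ^ m / fact m = exp t * pois t m" for t :: real
    by (simp add: pois_def exp_minus)
  have "z ^ m * exp (- z) \<le> zmax ^ m * 1"
    using z by (intro mult_mono power_mono) auto
  then have "pois z m \<le> zmax ^ m / fact m"
    unfolding pois_def by (simp add: divide_right_mono)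
  then have p: "pois z m \<le> exp zmax * pois zmax m" unfolding e .
  have "\<bar>eta (pois z m)\<bar> \<le> pois z m * cost m"
    by (rule eta_abs_le[OF pois_lower[OF z(1,2)] pois_le_1[OF z(3)]])
  also have "\<dots> \<le> (exp zmax * pois zmax m) * cost m"
    using cost_pos[of m] by (intro mult_right_mono p) auto
  finally show ?thesis by (simp add: pois_bound_def cost_def mult_ac)
qed

lemma eta_pois_summable: "z \<in> {lam0..zmax} \<Longrightarrow> summable (\<lambda>m. \<bar>eta (pois z m)\<bar>)"
  by (rule summable_comparison_test'[OF summable_pois_bound]) (simp add: eta_pois_le)

lemma neg_pois_entropy_bound: "z \<in> {lam0..zmax} \<Longrightarrow> \<bar>neg_pois_entropy z\<bar> \<le> suminf pois_bound"
  unfolding neg_pois_entropy_def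
  by (rule order_trans[OF summable_rabs[OF eta_pois_summable] suminf_le[OF eta_pois_le eta_pois_summable summable_pois_bound]])

lemma continuous_on_neg_pois_entropy: "continuous_on {lam0..zmax} neg_pois_entropy"
proof -
  have "uniform_limit {lam0..zmax} (\<lambda>n z. \<Sum>m<n. eta (pois z m)) neg_pois_entropy sequentially"
    unfolding neg_pois_entropy_def
    by (rule Weierstrass_m_test[OF _ summable_pois_bound]) (simp add: eta_pois_le)
  moreover have "continuous_on {lam0..zmax} (\<lambda>z. eta (pois z m))" for m
  proof -
    have "pois z m \<noteq> 0" if "z \<in> {lam0..zmax}" for z
      using pois_lower[of z m] that exp_gt_zero[of "- cost m"] by (metis atLeastAtMost_iff not_less)
    then have "continuous_on {lam0..zmax} (\<lambda>z. z ^ m / fact m * exp (- z) * ln (z ^ m / fact m * exp (- z)))"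
      unfolding pois_def by (intro continuous_intros) auto
    then show ?thesis by (simp add: eta_def pois_def)
  qed
  ultimately show ?thesis
    by (intro uniform_limit_theorem[rotated]) (auto intro!: always_eventually continuous_on_sum)
qed

definition noise :: "real measure \<Rightarrow> real" where
  "noise F = expect F (\<lambda>x. neg_pois_entropy (Z x 0))"

lemma noise_integrand_measurable: "(\<lambda>x. neg_pois_entropy (Z x k)) \<in> borel_measurable paths"
  unfolding neg_pois_entropy_def eta_def pois_def by measurable

lemma gateaux_noise:
  assumes F: "F \<in> input_laws A"
  shows "gateaux A F noise (expect_deriv F (- int L) (Suc L) (\<lambda>x. neg_pois_entropy (Z x 0)))"
  unfolding noise_def[abs_def]
proof (rule gateaux_expect[OF F noise_integrand_measurable])
  show "\<bar>neg_pois_entropy (Z x 0)\<bar> \<le> suminf pois_bound" if "x \<in> space paths" for x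
    using Z_bounds[OF that, of 0] by (intro neg_pois_entropy_bound) simp
  show "depends_on (space paths) {- int L..<- int L + int (Suc L)} (\<lambda>x. neg_pois_entropy (Z x 0))"
    unfolding depends_on_def by (intro ballI impI arg_cong[where f=neg_pois_entropy] Z_cong) auto
  fix x i assume x: "x \<in> space paths"
  show "continuous_on {0..A} (\<lambda>y. neg_pois_entropy (Z (x(i := y)) 0))"
    by (rule continuous_on_compose2[OF continuous_on_neg_pois_entropy continuous_on_Z_upd])
      (use Z_bounds[OF upd_in_space[OF x]] in auto)
qed

lemma expect_neg_pois_entropy:
  assumes F: "F \<in> input_laws A"
  shows "expect F (\<lambda>x. neg_pois_entropy (Z x k)) = noise F"
  using integral_shift_paths[where s=k and f="\<lambda>x. neg_pois_entropy (Z x 0)", OF F noise_integrand_measurable] Z_shift[of _ 0 k]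
  by (simp add: noise_def expect_def)

section \<open>Conditional entropy of a block given the inputs\<close>

context
  fixes x assumes x: "x \<in> space paths"
begin

lemma lik_le_env: "lik s w x * Theta w \<le> env w"
  using wlik_le_env[OF x, of s w] by (simp add: wlik_def[OF x])

lemma integrable_lik_mult:
  assumes g: "\<And>w. w \<in> words n \<Longrightarrow> \<bar>g w\<bar> \<le> c * Cost w"
  shows "integrable (Words n) (\<lambda>w. lik s w x * g w)"
proof (rule Bochner_Integration.integrable_bound)
  show "integrable (Words n) (\<lambda>w. \<bar>c\<bar> * cost_factor * env w)"
    using integrable_env by simp
  have "norm (lik s w x * g w) \<le> norm (\<bar>c\<bar> * cost_factor * env w)" if "w \<in> words n" for w
  proof -
    have "\<bar>g w\<bar> \<le> \<bar>c\<bar> * (cost_factor * Theta w)"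
    proof -
      have "c * Cost w \<le> \<bar>c\<bar> * (cost_factor * Theta w)"
        using Cost_nonneg[of w] Cost_cost_factor[of w] by (intro mult_mono) auto
      then show ?thesis using g[OF that] by linarith
    qed
    then have "lik s w x * \<bar>g w\<bar> \<le> lik s w x * (\<bar>c\<bar> * (cost_factor * Theta w))"
      using lik_nonneg[OF x] by (intro mult_left_mono) auto
    also have "\<dots> \<le> \<bar>c\<bar> * cost_factor * env w"
      using mult_left_mono[OF lik_le_env[of s w], of "\<bar>c\<bar> * cost_factor"] cost_factor_pos by (simp add: mult_ac)
    finally show ?thesis using lik_nonneg[OF x, of s w] cost_factor_pos env_nonneg[of w] by (simp add: abs_mult)
  qed
  then show "AE w in Words n. norm (lik s w x * g w) \<le> norm (\<bar>c\<bar> * cost_factor * env w)"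
    unfolding AE_count_space by blast
qed simp

lemma integral_lik_1: "(\<integral>w. lik s w x \<partial>Words n) = 1"
  using nn_lik_1[where s=s and n=n, OF x] by (subst integral_eq_nn_integral) (simp_all add: lik_nonneg[OF x])

lemma integral_lik_take:
  assumes g: "\<And>w. w \<in> words m \<Longrightarrow> \<bar>g w\<bar> \<le> c * Cost w" and c: "c \<ge> 0"
  shows "(\<integral>w. lik s w x * g (take m w) \<partial>Words (m + n)) = (\<integral>u. lik s u x * g u \<partial>Words m)"
proof (rule integral_words_take)
  show "integrable (Words (m + n)) (\<lambda>w. lik s w x * g (take m w))"
    by (rule integrable_lik_mult, rule order_trans[OF g mult_left_mono[OF Cost_take c]]) (simp add: words_def)
qed (simp add: lik_append integral_lik_1)

lemma integral_lik_drop: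
  assumes g: "\<And>w. w \<in> words n \<Longrightarrow> \<bar>g w\<bar> \<le> Cost w"
  shows "(\<integral>w. lik s w x * g (drop m w) \<partial>Words (m + n)) = (\<integral>v. lik (s + int m) v x * g v \<partial>Words n)"
proof (rule integral_words_drop)
  have "Cost (drop m w) \<le> 1 * Cost w" for w using Cost_drop by simp
  then show "integrable (Words (m + n)) (\<lambda>w. lik s w x * g (drop m w))"
    by (intro integrable_lik_mult[where c=1] order_trans[OF g]) (simp add: words_def)
  fix v
  have "(\<integral>u. lik s (u @ v) x \<partial>Words m) = (\<integral>u. lik s u x * lik (s + int m) v x \<partial>Words m)"
    by (intro Bochner_Integration.integral_cong refl) (simp add: lik_append words_def)
  then show "(\<integral>u. lik s (u @ v) x \<partial>Words m) = lik (s + int m) v x" by (simp add: integral_lik_1)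
qed

lemma ln_lik_abs_le: "\<bar>ln (lik s w x)\<bar> \<le> Cost w"
proof -
  have "- Cost w \<le> ln (lik s w x)" "ln (lik s w x) \<le> 0"
    using lik_pos[OF x, of s w] lik_lower[OF x, of w s] lik_le_1[OF x, of s w] by (simp_all add: ln_ge_iff)
  then show ?thesis by linarith
qed

text \<open>The chain rule for conditionally independent outputs: the logarithm of the product
  splits into the first letter and the rest, and the letters not read are summed out.\<close>

lemma integral_lik_ln_lik:
  "(\<integral>w. lik s w x * ln (lik s w x) \<partial>Words n) = (\<Sum>k<n. neg_pois_entropy (Z x (s + int k)))"
proof (induction n arbitrary: s)
  case 0
  show ?case by (simp add: words_0 lebesgue_integral_count_space_finite)
next
  case (Suc n)
  have 1: "(\<integral>w. lik s w x * ln (lik s (take 1 w) x) \<partial>Words (1 + n)) = neg_pois_entropy (Z x s)"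
  proof -
    have "(\<integral>w. lik s w x * ln (lik s (take 1 w) x) \<partial>Words (1 + n)) =
        (\<integral>u. lik s u x * ln (lik s u x) \<partial>Words 1)"
      by (rule integral_lik_take[where c=1 and g="\<lambda>u. ln (lik s u x)"]) (simp_all add: ln_lik_abs_le)
    also have "\<dots> = (\<integral>a. eta (pois (Z x s) a) \<partial>count_space UNIV)"
      using integral_bij_count_space[OF bij_words_1, of "\<lambda>u. lik s u x * ln (lik s u x)"] by (simp add: eta_def)
    also have "\<dots> = neg_pois_entropy (Z x s)"
      unfolding neg_pois_entropy_def using eta_pois_summable[of "Z x s"] Z_bounds[OF x, of s]
      by (intro integral_count_space_nat) (simp add: integrable_count_space_nat_iff)
    finally show ?thesis .
  qed
  have 2: "(\<integral>w. lik s w x * ln (lik (s + 1) (drop 1 w) x) \<partial>Words (1 + n)) =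
      (\<Sum>k<n. neg_pois_entropy (Z x (s + 1 + int k)))"
    unfolding Suc[symmetric] using integral_lik_drop[where m=1 and g="\<lambda>v. ln (lik (s + 1) v x)" and s=s and n=n]
    by (simp add: ln_lik_abs_le)
  have "(\<integral>w. lik s w x * ln (lik s w x) \<partial>Words (1 + n)) =
    (\<integral>w. lik s w x * ln (lik s (take 1 w) x) + lik s w x * ln (lik (s + 1) (drop 1 w) x) \<partial>Words (1 + n))"
  proof (intro Bochner_Integration.integral_cong refl)
    fix w assume "w \<in> space (Words (1 + n))"
    then have "length (take 1 w) = 1" by (simp add: words_def)
    then have "lik s w x = lik s (take 1 w) x * lik (s + 1) (drop 1 w) x"
      using lik_append[of s "take 1 w" "drop 1 w" x] by (simp only: append_take_drop_id of_nat_1)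
    then have "ln (lik s w x) = ln (lik s (take 1 w) x) + ln (lik (s + 1) (drop 1 w) x)"
      using lik_pos[OF x] by (simp only: ln_mult_pos)
    then show "lik s w x * ln (lik s w x) = lik s w x * ln (lik s (take 1 w) x) + lik s w x * ln (lik (s + 1) (drop 1 w) x)"
      by (simp only: distrib_left)
  qed
  also have "\<dots> = neg_pois_entropy (Z x s) + (\<Sum>k<n. neg_pois_entropy (Z x (s + 1 + int k)))"
    unfolding 1[symmetric] 2[symmetric]
    by (intro Bochner_Integration.integral_add integrable_lik_mult[where c=1])
      (simp_all add: order_trans[OF ln_lik_abs_le Cost_take] order_trans[OF ln_lik_abs_le Cost_drop])
  also have "\<dots> = (\<Sum>k<Suc n. neg_pois_entropy (Z x (s + int k)))"
    unfolding sum.lessThan_Suc_shift by (simp add: ac_simps)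
  finally show ?case by simp
qed

end

end

section \<open>The mutual information of a block\<close>

text \<open>The blocks of the channel start at time 1 but lists at index 0, whence the offsets
  \<open>i - 1\<close> and \<open>1 + k\<close> below.\<close>

definition window :: "nat \<Rightarrow> (int \<Rightarrow> nat) \<Rightarrow> nat list" where
  "window n y = map y [1..int n]"

lemma window_in_words: "window n y \<in> words n"
  by (simp add: window_def words_def)

lemma window_nth: "k < n \<Longrightarrow> window n y ! k = y (1 + int k)"
  by (simp add: window_def)

lemma window_eq_iff:
  assumes "length w = n"
  shows "window n y = w \<longleftrightarrow> (\<forall>i\<in>{1..int n}. y i = w ! nat (i - 1))"
proof
  assume w: "window n y = w"
  show "\<forall>i\<in>{1..int n}. y i = w ! nat (i - 1)"
  proof
    fix i assume "i \<in> {1..int n}"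
    then have "nat (i - 1) < n" "1 + int (nat (i - 1)) = i" by auto
    then show "y i = w ! nat (i - 1)" using window_nth[of "nat (i - 1)" n y] w by simp
  qed
next
  assume a: "\<forall>i\<in>{1..int n}. y i = w ! nat (i - 1)"
  show "window n y = w"
  proof (rule nth_equalityI)
    show "length (window n y) = length w" using assms by (simp add: window_def)
    fix k assume "k < length (window n y)"
    then have k: "k < n" by (simp add: window_def)
    then have "1 + int k \<in> {1..int n}" by auto
    with a have "y (1 + int k) = w ! nat (1 + int k - 1)" by blast
    then show "window n y ! k = w ! k" using window_nth[OF k] by simp
  qed
qed

lemma window_restrict: "window n (restrict y {1..int n}) = window n y"
  by (simp add: window_def)

lemma measurable_map_paths:
  "set ks \<subseteq> J \<Longrightarrow> (\<lambda>y. map y ks) \<in> PiM J (\<lambda>_. count_space (UNIV :: nat set)) \<rightarrow>\<^sub>M count_space UNIV"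
proof (induction ks)
  case (Cons k ks)
  have 1: "(\<lambda>y. y k) \<in> PiM J (\<lambda>_. count_space (UNIV :: nat set)) \<rightarrow>\<^sub>M count_space UNIV"
    using Cons by (intro measurable_component_singleton) auto
  have 2: "(\<lambda>y. a # map y ks) \<in> PiM J (\<lambda>_. count_space (UNIV :: nat set)) \<rightarrow>\<^sub>M count_space UNIV" for a
    using measurable_compose[OF Cons(1), of "\<lambda>w. a # w" "count_space UNIV"] Cons(2) by simp
  have "(\<lambda>y. (\<lambda>a y. a # map y ks) (y k) y) \<in> PiM J (\<lambda>_. count_space (UNIV :: nat set)) \<rightarrow>\<^sub>M count_space UNIV"
    by (rule measurable_compose_countable[OF 2 1])
  then show ?case by simp
qed simp

lemma measurable_window: "window n \<in> output_paths \<rightarrow>\<^sub>M count_space UNIV"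
  unfolding output_paths_def window_def[abs_def] by (rule measurable_map_paths) simp

lemma measurable_window_block:
  "window n \<in> PiM {1..int n} (\<lambda>_. count_space (UNIV :: nat set)) \<rightarrow>\<^sub>M count_space UNIV"
  unfolding window_def[abs_def] by (rule measurable_map_paths) simp

context poisson_isi
begin

section \<open>Law of the output window given the inputs\<close>

lemma lik_prod: "lik s w x = (\<Prod>k<length w. pois (Z x (s + int k)) (w ! k))"
proof (induction w arbitrary: s)
  case (Cons a w)
  have "(\<Prod>k<Suc (length w). pois (Z x (s + int k)) ((a # w) ! k)) =
     pois (Z x s) a * (\<Prod>k<length w. pois (Z x (s + 1 + int k)) (w ! k))"
    by (subst prod.lessThan_Suc_shift) (simp add: ac_simps)
  then show ?case by (simp only: lik.simps Cons list.size add_Suc_right add_0_right)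
qed simp

lemma emeasure_output_kernel_window:
  assumes x: "x \<in> space paths" and w: "w \<in> words n"
  shows "emeasure (output_kernel L lam0 h x) {y. window n y = w} = ennreal (lik 1 w x)"
proof -
  interpret K: product_prob_space "\<lambda>k. measure_pmf (poisson_pmf (Z x k))" "UNIV :: int set"
    by (intro product_prob_spaceI prob_space_measure_pmf)
  have l: "length w = n" using w by (simp add: words_def)
  have "{y. window n y = w} = {y \<in> space (PiM UNIV (\<lambda>k. measure_pmf (poisson_pmf (Z x k)))).
      \<forall>i\<in>{1..int n}. y i \<in> {w ! nat (i - 1)}}"
    by (simp add: window_eq_iff[OF l] space_PiM)
  then have "emeasure (output_kernel L lam0 h x) {y. window n y = w} =
     (\<Prod>i\<in>{1..int n}. emeasure (measure_pmf (poisson_pmf (Z x i))) {w ! nat (i - 1)})"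
    unfolding output_kernel_def by (simp only:) (rule K.emeasure_PiM_Collect, auto)
  also have "\<dots> = (\<Prod>i\<in>{1..int n}. ennreal (pois (Z x i) (w ! nat (i - 1))))"
  proof (rule prod.cong[OF refl])
    fix i show "emeasure (measure_pmf (poisson_pmf (Z x i))) {w ! nat (i - 1)} = ennreal (pois (Z x i) (w ! nat (i - 1)))"
      using Z_bounds(1)[OF x, of i] lam0_pos by (simp add: emeasure_pmf_single pmf_poisson_pois del: pmf_poisson)
  qed
  also have "\<dots> = (\<Prod>k<n. ennreal (pois (Z x (1 + int k)) (w ! k)))"
    by (rule prod.reindex_bij_witness[of _ "\<lambda>k. 1 + int k" "\<lambda>i. nat (i - 1)"]) auto
  also have "\<dots> = ennreal (lik 1 w x)"
    by (simp add: lik_prod l prod_ennreal pois_nonneg Z_nonneg[OF x])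
  finally show ?thesis .
qed

text \<open>The window takes countably many values, so the integral is a sum over its fibres, whose
  probabilities are the likelihoods.\<close>

lemma nn_integral_output_kernel_window:
  assumes x: "x \<in> space paths"
  shows "(\<integral>\<^sup>+y. g (window n y) \<partial>output_kernel L lam0 h x) =
    (\<integral>\<^sup>+w. ennreal (lik 1 w x) * g w \<partial>Words n)"
proof -
  let ?K = "output_kernel L lam0 h x" and ?W = "Words n"
  interpret W: sigma_finite_measure ?W by (rule sigma_finite_measure_count_space_countable) simp
  interpret K: prob_space ?K
    unfolding output_kernel_def by (intro prob_space_PiM prob_space_measure_pmf)
  interpret P: pair_sigma_finite ?W ?K ..
  have mw: "window n \<in> ?K \<rightarrow>\<^sub>M count_space UNIV"
    using measurable_window by (simp cong: measurable_cong_sets)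
  have sp: "space ?K = UNIV" by (simp add: output_kernel_def space_PiM)
  have s: "{y. window n y = w} \<in> sets ?K" for w
    using measurable_sets[OF mw, of "{w}"] by (simp add: sp vimage_def)
  have "(\<integral>\<^sup>+y. g (window n y) \<partial>?K) = (\<integral>\<^sup>+y. \<integral>\<^sup>+w. g w * indicator {y. window n y = w} y \<partial>?W \<partial>?K)"
  proof (intro nn_integral_cong)
    fix y
    have "(\<integral>\<^sup>+w. g w * indicator {y. window n y = w} y \<partial>?W) = (\<integral>\<^sup>+w. g w * indicator {window n y} w \<partial>?W)"
      by (intro nn_integral_cong) (auto simp: indicator_def)
    also have "\<dots> = g (window n y)"
      using window_in_words[of n y] by (subst nn_integral_indicator_singleton) auto
    finally show "g (window n y) = (\<integral>\<^sup>+w. g w * indicator {y. window n y = w} y \<partial>?W)" ..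
  qed
  also have "\<dots> = (\<integral>\<^sup>+w. \<integral>\<^sup>+y. g w * indicator {y. window n y = w} y \<partial>?K \<partial>?W)"
    using s by (intro P.Fubini' measurable_pair_measure_countable1) simp_all
  also have "\<dots> = (\<integral>\<^sup>+w. ennreal (lik 1 w x) * g w \<partial>?W)"
    using s emeasure_output_kernel_window[OF x]
    by (intro nn_integral_cong) (simp add: nn_integral_cmult mult.commute)
  finally show ?thesis .
qed

section \<open>Joint law of the input path and the output window\<close>

context
  fixes F :: "real measure" assumes F: "F \<in> input_laws A"
begin

abbreviation SL :: "((int \<Rightarrow> real) \<times> (int \<Rightarrow> nat)) measure" where "SL \<equiv> stationary_law L lam0 h A F"

lemma sets_PF: "sets (PF F) = sets paths" by (rule sets_PiM_laws[OF F])
lemma space_PF: "space (PF F) = space paths" by (rule path_space[OF F])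

lemma sets_SL: "sets SL = sets (paths \<Otimes>\<^sub>M output_paths)"
  by (rule prob_space_stationary_law(2)[OF lam0_pos h_nonneg F])

lemma prob_SL: "prob_space SL"
  by (rule prob_space_stationary_law(1)[OF lam0_pos h_nonneg F])

lemma measurable_SL_window: "(\<lambda>\<omega>. (fst \<omega>, window n (snd \<omega>))) \<in> SL \<rightarrow>\<^sub>M paths \<Otimes>\<^sub>M count_space UNIV"
proof -
  have "(\<lambda>\<omega>. (fst \<omega>, window n (snd \<omega>))) \<in> paths \<Otimes>\<^sub>M output_paths \<rightarrow>\<^sub>M paths \<Otimes>\<^sub>M count_space UNIV"
    by (intro measurable_Pair measurable_fst measurable_compose[OF measurable_snd measurable_window])
  then show ?thesis by (simp only: measurable_cong_sets[OF sets_SL refl])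
qed

lemma nn_integral_SL:
  assumes g: "g \<in> borel_measurable (paths \<Otimes>\<^sub>M count_space UNIV)"
  shows "(\<integral>\<^sup>+\<omega>. g (fst \<omega>, window n (snd \<omega>)) \<partial>SL) =
    (\<integral>\<^sup>+x. \<integral>\<^sup>+w. ennreal (lik 1 w x) * g (x, w) \<partial>Words n \<partial>PF F)"
proof -
  let ?B = "paths \<Otimes>\<^sub>M output_paths"
  let ?N = "\<lambda>x. distr (output_kernel L lam0 h x) ?B (\<lambda>y. (x, y))"
  have "?N \<in> paths \<rightarrow>\<^sub>M prob_algebra ?B"
    by (rule measurable_distr_prob_space2[OF measurable_output_kernel[OF lam0_pos h_nonneg]]) measurable
  then have N: "?N \<in> PF F \<rightarrow>\<^sub>M subprob_algebra ?B"
    by (simp only: measurable_cong_sets[OF sets_PF refl]) (rule measurable_prob_algebraD)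
  have gm: "(\<lambda>\<omega>. g (fst \<omega>, window n (snd \<omega>))) \<in> borel_measurable ?B"
    using measurable_compose[OF measurable_SL_window g] by (simp only: measurable_cong_sets[OF sets_SL refl])
  have "(\<integral>\<^sup>+\<omega>. g (fst \<omega>, window n (snd \<omega>)) \<partial>SL) =
     (\<integral>\<^sup>+x. \<integral>\<^sup>+\<omega>. g (fst \<omega>, window n (snd \<omega>)) \<partial>?N x \<partial>PF F)"
    unfolding stationary_law_def by (rule nn_integral_bind[OF gm N])
  also have "\<dots> = (\<integral>\<^sup>+x. \<integral>\<^sup>+w. ennreal (lik 1 w x) * g (x, w) \<partial>Words n \<partial>PF F)"
  proof (intro nn_integral_cong)
    fix x assume "x \<in> space (PF F)"
    then have x: "x \<in> space paths" by (simp add: space_PF)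
    have "(\<lambda>y. (x, y)) \<in> output_kernel L lam0 h x \<rightarrow>\<^sub>M ?B"
      using measurable_Pair1'[OF x, of output_paths] by (simp add: measurable_cong_sets[OF sets_output_kernel refl])
    then have "(\<integral>\<^sup>+\<omega>. g (fst \<omega>, window n (snd \<omega>)) \<partial>?N x) = (\<integral>\<^sup>+y. g (x, window n y) \<partial>output_kernel L lam0 h x)"
      using gm by (simp add: nn_integral_distr)
    also have "\<dots> = (\<integral>\<^sup>+w. ennreal (lik 1 w x) * g (x, w) \<partial>Words n)"
      by (rule nn_integral_output_kernel_window[OF x])
    finally show "(\<integral>\<^sup>+\<omega>. g (fst \<omega>, window n (snd \<omega>)) \<partial>?N x) = (\<integral>\<^sup>+w. ennreal (lik 1 w x) * g (x, w) \<partial>Words n)" .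
  qed
  finally show ?thesis .
qed

lemma borel_measurable_paths_words:
  fixes g :: "_ \<Rightarrow> nat list \<Rightarrow> 'b::topological_space"
  assumes "\<And>w. (\<lambda>x. g x w) \<in> borel_measurable M"
  shows "(\<lambda>p. g (fst p) (snd p)) \<in> borel_measurable (M \<Otimes>\<^sub>M count_space UNIV)"
  by (rule measurable_compose_countable[OF measurable_compose[OF measurable_fst assms] measurable_snd])

text \<open>Integrals of logarithms are signed, and \<open>nn_integral_SL\<close> covers nonnegative
  functions only; a density with respect to a product measure gives both integrability and
  Fubini.\<close>

lemma window_law:
  "distr SL (PF F \<Otimes>\<^sub>M count_space UNIV) (\<lambda>\<omega>. (fst \<omega>, window n (snd \<omega>))) =
   density (PF F \<Otimes>\<^sub>M count_space UNIV) (\<lambda>p. ennreal (indicator (words n) (snd p) * lik 1 (snd p) (fst p)))"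
    (is "distr SL ?C ?f = density ?C ?d")
proof (rule measure_eqI)
  have sC: "sets ?C = sets (paths \<Otimes>\<^sub>M count_space UNIV)" by (intro sets_pair_measure_cong sets_PF refl)
  interpret W: sigma_finite_measure "count_space (UNIV :: nat list set)"
    by (rule sigma_finite_measure_count_space_countable) simp
  interpret P: prob_space "PF F" by (rule path_prob[OF F])
  interpret PW: pair_sigma_finite "PF F" "count_space (UNIV :: nat list set)" ..
  have dm: "?d \<in> borel_measurable ?C"
    using borel_measurable_paths_words[of "\<lambda>x w. ennreal (indicator (words n) w * lik 1 w x)" "PF F"] path_measurable[OF F measurable_lik]
    by simp
  show "sets (distr SL ?C ?f) = sets (density ?C ?d)" by simp
  fix B assume "B \<in> sets (distr SL ?C ?f)"
  then have B: "B \<in> sets ?C" by simp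
  have fm: "?f \<in> SL \<rightarrow>\<^sub>M ?C" using measurable_SL_window by (simp add: measurable_cong_sets[OF refl sC])
  have "emeasure (distr SL ?C ?f) B = (\<integral>\<^sup>+p. indicator B p \<partial>distr SL ?C ?f)"
    using B by simp
  also have "\<dots> = (\<integral>\<^sup>+\<omega>. indicator B (?f \<omega>) \<partial>SL)"
    by (rule nn_integral_distr[OF fm]) (use B in simp)
  also have "\<dots> = (\<integral>\<^sup>+x. \<integral>\<^sup>+w. ennreal (lik 1 w x) * indicator B (x, w) \<partial>Words n \<partial>PF F)"
    using B by (intro nn_integral_SL) (simp add: sC)
  also have "\<dots> = (\<integral>\<^sup>+x. \<integral>\<^sup>+w. ?d (x, w) * indicator B (x, w) \<partial>count_space UNIV \<partial>PF F)"
    by (intro nn_integral_cong, subst nn_integral_count_space_indicator) (auto intro!: nn_integral_cong simp: indicator_def)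
  also have "\<dots> = (\<integral>\<^sup>+p. ?d p * indicator B p \<partial>?C)"
    using B dm by (intro W.nn_integral_fst) simp
  also have "\<dots> = emeasure (density ?C ?d) B"
    using B dm by (simp add: emeasure_density)
  finally show "emeasure (distr SL ?C ?f) B = emeasure (density ?C ?d) B" .
qed

end


lemma nn_wlik_real:
  assumes x: "x \<in> space paths"
  shows "(\<integral>w. lik s w x * Cost w \<partial>Words n) \<le> cost_factor * mass_const ^ n"
proof -
  have i: "integrable (Words n) (\<lambda>w. wlik x s w)"
    by (rule Bochner_Integration.integrable_bound[OF integrable_env[of n]])
      (use wlik_le_env[OF x] wlik_nonneg[OF x] env_nonneg in auto)
  have "ennreal (\<integral>w. wlik x s w \<partial>Words n) \<le> ennreal (mass_const ^ n)"
    using nn_wlik_le[where s=s and n=n, OF x] wlik_nonneg[OF x]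
    by (subst nn_integral_eq_integral[OF i, symmetric]) auto
  then have b: "(\<integral>w. wlik x s w \<partial>Words n) \<le> mass_const ^ n"
    using mass_const_ge_1 by (simp add: ennreal_le_iff)
  have "(\<integral>w. lik s w x * Cost w \<partial>Words n) \<le> (\<integral>w. cost_factor * wlik x s w \<partial>Words n)"
  proof (rule integral_mono)
    show "integrable (Words n) (\<lambda>w. lik s w x * Cost w)"
      by (rule integrable_lik_mult[OF x, where c=1]) (simp add: Cost_nonneg)
    show "integrable (Words n) (\<lambda>w. cost_factor * wlik x s w)" using i by simp
    fix w
    have "lik s w x * Cost w \<le> lik s w x * (cost_factor * Theta w)"
      using Cost_cost_factor[of w] lik_nonneg[OF x, of s w] by (intro mult_left_mono) auto
    then show "lik s w x * Cost w \<le> cost_factor * wlik x s w" by (simp add: wlik_def[OF x] mult_ac)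
  qed
  also have "\<dots> \<le> cost_factor * mass_const ^ n" using b cost_factor_pos by simp
  finally show ?thesis .
qed

section \<open>Joint law of an input block and an output block\<close>

context
  fixes F :: "real measure" assumes F: "F \<in> input_laws A"
begin

text \<open>The inputs before time \<open>1\<close> are not part of the block; they are integrated out.\<close>

definition cond_wprob :: "nat \<Rightarrow> nat list \<Rightarrow> (int \<Rightarrow> real) \<Rightarrow> real" where
  "cond_wprob n w x = (\<integral>x'. lik 1 w (\<lambda>i. if i \<in> {1..int n} then x i else x' i) \<partial>PF F)"

abbreviation block_in :: "nat \<Rightarrow> (int \<Rightarrow> real) measure" where
  "block_in n \<equiv> PiM {1..int n} (\<lambda>_. amplitudes A)"
abbreviation block_out :: "nat \<Rightarrow> (int \<Rightarrow> nat) measure" where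
  "block_out n \<equiv> PiM {1..int n} (\<lambda>_. count_space UNIV)"

lemma merge_block_in_space:
  assumes "\<And>i. i \<in> {1..int n} \<Longrightarrow> x i \<in> {0..A}" "x' \<in> space paths"
  shows "(\<lambda>i. if i \<in> {1..int n} then x i else x' i) \<in> space paths"
  using assms by (auto simp: space_input_paths)

lemma space_block_in: "x \<in> space (block_in n) \<Longrightarrow> i \<in> {1..int n} \<Longrightarrow> x i \<in> {0..A}"
  by (auto simp: space_PiM amplitudes_def space_restrict_space)

lemma measurable_cond_wprob [measurable]: "cond_wprob n w \<in> borel_measurable (block_in n)"
proof -
  interpret P: prob_space "PF F" by (rule path_prob[OF F])
  have m: "(\<lambda>p i. if i \<in> {1..int n} then fst p i else snd p i) \<in> block_in n \<Otimes>\<^sub>M paths \<rightarrow>\<^sub>M paths"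
  proof -
    have "(\<lambda>p. if i \<in> {1..int n} then fst p i else snd p i) \<in> block_in n \<Otimes>\<^sub>M paths \<rightarrow>\<^sub>M amplitudes A" for i
    proof (cases "i \<in> {1..int n}")
      case True
      have "(\<lambda>p. fst p i) \<in> block_in n \<Otimes>\<^sub>M paths \<rightarrow>\<^sub>M amplitudes A"
        using True by (intro measurable_compose[OF measurable_fst measurable_component_singleton])
      then show ?thesis using True by simp
    next
      case False
      have "(\<lambda>p. snd p i) \<in> block_in n \<Otimes>\<^sub>M paths \<rightarrow>\<^sub>M amplitudes A"
        unfolding input_paths_def by (intro measurable_compose[OF measurable_snd measurable_component_singleton]) simp
      then show ?thesis by (simp only: False if_False)
    qed
    then show ?thesis
      unfolding input_paths_def
      by (intro measurable_PiM_single') (auto simp: space_pair_measure space_PiM PiE_iff)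
  qed
  have pm: "sets (block_in n \<Otimes>\<^sub>M PF F) = sets (block_in n \<Otimes>\<^sub>M paths)"
    by (intro sets_pair_measure_cong refl sets_PF[OF F])
  have "(\<lambda>p. lik 1 w (\<lambda>i. if i \<in> {1..int n} then fst p i else snd p i)) \<in> borel_measurable (block_in n \<Otimes>\<^sub>M PF F)"
    using measurable_compose[OF m measurable_lik] by (simp only: measurable_cong_sets[OF pm refl])
  then show ?thesis
    unfolding cond_wprob_def[abs_def] by (intro P.borel_measurable_lebesgue_integral) (simp add: split_beta')
qed

lemma measurable_merge_const:
  assumes "x \<in> space paths"
  shows "(\<lambda>x' i. if i \<in> K then x i else x' i) \<in> paths \<rightarrow>\<^sub>M paths"
  using measurable_compose[OF measurable_Pair1'[OF assms] measurable_merge_paths[of K]] by (simp cong: if_cong)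

lemma cond_wprob_restrict: "cond_wprob n w (restrict x {1..int n}) = cond_wprob n w x"
  unfolding cond_wprob_def
  by (intro Bochner_Integration.integral_cong refl arg_cong[where f="lik 1 w"]) auto

lemma expect_merge_bounds:
  assumes x: "x \<in> space paths"
  shows "exp (- Cost w) \<le> (\<integral>x'. lik s w (\<lambda>i. if i \<in> K then x i else x' i) \<partial>PF F)" (is ?a)
    and "(\<integral>x'. lik s w (\<lambda>i. if i \<in> K then x i else x' i) \<partial>PF F) \<le> 1" (is ?b)
    and "ennreal (\<integral>x'. lik s w (\<lambda>i. if i \<in> K then x i else x' i) \<partial>PF F) =
      (\<integral>\<^sup>+x'. ennreal (lik s w (\<lambda>i. if i \<in> K then x i else x' i)) \<partial>PF F)" (is ?c)
proof -
  interpret P: prob_space "PF F" by (rule path_prob[OF F])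
  have sp: "x' \<in> space (PF F) \<Longrightarrow> (\<lambda>i. if i \<in> K then x i else x' i) \<in> space paths" for x'
    using merge_in_space[OF x] by (simp add: space_PF[OF F])
  have m: "(\<lambda>x'. lik s w (\<lambda>i. if i \<in> K then x i else x' i)) \<in> borel_measurable (PF F)"
    by (rule path_measurable[OF F measurable_compose[OF measurable_merge_const[OF x] measurable_lik]])
  have i: "integrable (PF F) (\<lambda>x'. lik s w (\<lambda>i. if i \<in> K then x i else x' i))"
    by (rule integrable_bounded_prob[where B=1, OF P.prob_space_axioms m]) (rule lik_abs_le_1[OF sp])
  have "(\<integral>x'. exp (- Cost w) \<partial>PF F) \<le> (\<integral>x'. lik s w (\<lambda>i. if i \<in> K then x i else x' i) \<partial>PF F)"
    by (intro integral_mono i) (simp_all add: lik_lower[OF sp])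
  then show ?a by (simp add: P.prob_space)
  have "(\<integral>x'. lik s w (\<lambda>i. if i \<in> K then x i else x' i) \<partial>PF F) \<le> (\<integral>x'. 1 \<partial>PF F)"
    by (intro integral_mono i) (simp_all add: lik_le_1[OF sp])
  then show ?b by (simp add: P.prob_space)
  show ?c
    by (intro nn_integral_eq_integral[symmetric] i AE_I2 lik_nonneg sp)
qed

text \<open>Outputs after time \<open>L\<close> read no input before time 1, so their likelihood is
  the same on both sides and cancels. The logarithms of the first \<open>min L n\<close> letters
  both lie between minus their cost and 0, hence differ by at most that cost.\<close>

lemma cond_wprob_close:
  assumes x: "x \<in> space paths" and w: "w \<in> words n"
  shows "\<bar>ln (cond_wprob n w x) - ln (lik 1 w x)\<bar> \<le> Cost (take (min L n) w)"
proof -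
  define m where "m = min L n"
  let ?I = "{1..int n}"
  let ?e = "\<integral>x'. lik 1 (take m w) (\<lambda>i. if i \<in> ?I then x i else x' i) \<partial>PF F"
  have l: "length w = n" "length (take m w) = m" using w by (auto simp: words_def m_def)
  have d: "lik (1 + int m) (drop m w) (\<lambda>i. if i \<in> ?I then x i else x' i) = lik (1 + int m) (drop m w) x" for x'
  proof (cases "L \<le> n")
    case True
    show ?thesis by (rule lik_cong) (use True l in \<open>auto simp: m_def\<close>)
  next
    case False
    then show ?thesis using l by (simp add: m_def)
  qed
  have s: "lik 1 w y = lik 1 (take m w) y * lik (1 + int m) (drop m w) y" for y
    using lik_append[of 1 "take m w" "drop m w" y] by (simp only: append_take_drop_id l)
  have c: "cond_wprob n w x = ?e * lik (1 + int m) (drop m w) x"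
    unfolding cond_wprob_def s d by simp
  have b: "\<bar>ln t\<bar> \<le> Cost (take m w) \<and> ln t \<le> 0 \<and> t > 0" if "exp (- Cost (take m w)) \<le> t" "t \<le> 1" for t
  proof -
    have "t > 0" using that(1) exp_gt_zero[of "- Cost (take m w)"] by linarith
    moreover from this have "- Cost (take m w) \<le> ln t" "ln t \<le> 0" using that by (simp_all add: ln_ge_iff)
    ultimately show ?thesis by linarith
  qed
  have e: "\<bar>ln ?e\<bar> \<le> Cost (take m w) \<and> ln ?e \<le> 0 \<and> ?e > 0"
    by (rule b[OF expect_merge_bounds(1,2)[OF x]])
  have t: "\<bar>ln (lik 1 (take m w) x)\<bar> \<le> Cost (take m w) \<and> ln (lik 1 (take m w) x) \<le> 0 \<and> lik 1 (take m w) x > 0"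
    by (rule b[OF lik_lower[OF x] lik_le_1[OF x]])
  have "ln (cond_wprob n w x) = ln ?e + ln (lik (1 + int m) (drop m w) x)"
    unfolding c using e lik_pos[OF x] by (simp add: ln_mult_pos)
  moreover have "ln (lik 1 w x) = ln (lik 1 (take m w) x) + ln (lik (1 + int m) (drop m w) x)"
    unfolding s[of x] using lik_pos[OF x] by (simp only: ln_mult_pos)
  ultimately show ?thesis using e t unfolding m_def by linarith
qed

lemma cond_wprob_pos: "x \<in> space paths \<Longrightarrow> cond_wprob n w x > 0"
  using expect_merge_bounds(1)[where x=x and w=w and s=1 and K="{1..int n}"] exp_gt_zero[of "- Cost w"] unfolding cond_wprob_def by linarith

lemma ln_cond_wprob_le: "x \<in> space paths \<Longrightarrow> \<bar>ln (cond_wprob n w x)\<bar> \<le> Cost w"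
proof -
  assume x: "x \<in> space paths"
  have "- Cost w \<le> ln (cond_wprob n w x)" "ln (cond_wprob n w x) \<le> 0"
    using expect_merge_bounds(1,2)[where w=w and s=1 and K="{1..int n}", OF x] cond_wprob_pos[OF x, of n w]
    by (simp_all add: cond_wprob_def ln_ge_iff)
  then show ?thesis by linarith
qed

text \<open>The inverse of \<open>window\<close>: mutual information lives on functions on
  \<open>{1..int n}\<close>, the sums on lists.\<close>

definition word_path :: "nat \<Rightarrow> nat list \<Rightarrow> int \<Rightarrow> nat" where
  "word_path n w = restrict (\<lambda>i. w ! nat (i - 1)) {1..int n}"

lemma word_path_window: "word_path n (window n y) = restrict y {1..int n}"
  unfolding word_path_def restrict_def using window_eq_iff[of "window n y" n y]
  by (auto simp: window_def fun_eq_iff)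

lemma word_path_space: "word_path n w \<in> space (block_out n)"
  by (simp add: word_path_def space_PiM)

lemma window_word_path: "w \<in> words n \<Longrightarrow> window n (word_path n w) = w"
  by (simp add: window_eq_iff words_def word_path_def)

lemma measurable_restrict_paths: "(\<lambda>x. restrict x {1..int n}) \<in> paths \<rightarrow>\<^sub>M block_in n"
  unfolding input_paths_def by (rule measurable_restrict_subset) simp

lemma measurable_block_section:
  assumes "G \<in> borel_measurable (block_in n \<Otimes>\<^sub>M block_out n)"
  shows "(\<lambda>x. G (restrict x {1..int n}, word_path n w)) \<in> borel_measurable paths"
  by (rule measurable_compose[OF measurable_restrict_paths measurable_compose[OF measurable_Pair2'[OF word_path_space] assms]])

lemma nn_integral_block:
  assumes G: "G \<in> borel_measurable (block_in n \<Otimes>\<^sub>M block_out n)"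
  shows "(\<integral>\<^sup>+\<omega>. G (restrict (fst \<omega>) {1..int n}, restrict (snd \<omega>) {1..int n}) \<partial>SL F) =
    (\<integral>\<^sup>+x. \<integral>\<^sup>+w. ennreal (lik 1 w x) * G (restrict x {1..int n}, word_path n w) \<partial>Words n \<partial>PF F)"
  using nn_integral_SL[where n=n, OF F borel_measurable_paths_words[where
    g="\<lambda>x w. G (restrict x {1..int n}, word_path n w)", OF F measurable_block_section[OF G]]]
  by (simp add: word_path_window)

lemma measurable_SL_in: "(\<lambda>\<omega>. restrict (fst \<omega>) {1..int n}) \<in> SL F \<rightarrow>\<^sub>M block_in n"
  using measurable_compose[OF measurable_fst measurable_restrict_paths]
  by (simp add: measurable_cong_sets[OF sets_SL[OF F] refl])

lemma measurable_SL_out: "(\<lambda>\<omega>. restrict (snd \<omega>) {1..int n}) \<in> SL F \<rightarrow>\<^sub>M block_out n"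
proof -
  have "(\<lambda>y. restrict y {1..int n}) \<in> output_paths \<rightarrow>\<^sub>M block_out n"
    unfolding output_paths_def by (rule measurable_restrict_subset) simp
  from measurable_compose[OF measurable_snd this] show ?thesis
    by (simp add: measurable_cong_sets[OF sets_SL[OF F] refl])
qed

lemma nn_integral_block_in:
  assumes "G \<in> borel_measurable (block_in n)"
  shows "(\<integral>\<^sup>+x. G x \<partial>distr (SL F) (block_in n) (\<lambda>\<omega>. restrict (fst \<omega>) {1..int n})) =
    (\<integral>\<^sup>+x. G (restrict x {1..int n}) \<partial>PF F)"
proof -
  have "(\<integral>\<^sup>+x. G x \<partial>distr (SL F) (block_in n) (\<lambda>\<omega>. restrict (fst \<omega>) {1..int n})) =
     (\<integral>\<^sup>+\<omega>. G (restrict (fst \<omega>) {1..int n}) \<partial>SL F)"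
    by (rule nn_integral_distr[OF measurable_SL_in]) (use assms in simp)
  also have "\<dots> = (\<integral>\<^sup>+x. \<integral>\<^sup>+w. ennreal (lik 1 w x) * G (restrict x {1..int n}) \<partial>Words n \<partial>PF F)"
    using nn_integral_block[where n=n, OF measurable_compose[OF measurable_fst assms]] by simp
  also have "\<dots> = (\<integral>\<^sup>+x. G (restrict x {1..int n}) \<partial>PF F)"
    by (intro nn_integral_cong) (simp add: nn_integral_multc nn_lik_1 space_PF[OF F])
  finally show ?thesis .
qed

lemma nn_integral_block_out:
  assumes "G \<in> borel_measurable (block_out n)"
  shows "(\<integral>\<^sup>+y. G y \<partial>distr (SL F) (block_out n) (\<lambda>\<omega>. restrict (snd \<omega>) {1..int n})) =
    (\<integral>\<^sup>+w. ennreal (wprob F w) * G (word_path n w) \<partial>Words n)"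
proof -
  have "(\<integral>\<^sup>+y. G y \<partial>distr (SL F) (block_out n) (\<lambda>\<omega>. restrict (snd \<omega>) {1..int n})) =
     (\<integral>\<^sup>+\<omega>. G (restrict (snd \<omega>) {1..int n}) \<partial>SL F)"
    by (rule nn_integral_distr[OF measurable_SL_out]) (use assms in simp)
  also have "\<dots> = (\<integral>\<^sup>+x. \<integral>\<^sup>+w. ennreal (lik 1 w x) * G (word_path n w) \<partial>Words n \<partial>PF F)"
    using nn_integral_block[where n=n, OF measurable_compose[OF measurable_snd assms]] by simp
  also have "\<dots> = (\<integral>\<^sup>+w. \<integral>\<^sup>+x. ennreal (lik 1 w x) * G (word_path n w) \<partial>PF F \<partial>Words n)"
    by (rule nn_integral_swap_words[OF F, symmetric]) simp
  also have "\<dots> = (\<integral>\<^sup>+w. ennreal (wprob F w) * G (word_path n w) \<partial>Words n)"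
    using ennreal_wprob[OF F, of "[]" _ 1] path_measurable[OF F measurable_lik]
    by (intro nn_integral_cong) (simp add: nn_integral_multc)
  finally show ?thesis .
qed

text \<open>The density of the joint block law with respect to the product of its marginals:
  conditional over unconditional probability of the word.\<close>

definition block_density :: "nat \<Rightarrow> (int \<Rightarrow> real) \<times> (int \<Rightarrow> nat) \<Rightarrow> real" where
  "block_density n p = cond_wprob n (window n (snd p)) (fst p) / wprob F (window n (snd p))"

lemma measurable_block_density: "block_density n \<in> borel_measurable (block_in n \<Otimes>\<^sub>M block_out n)"
proof -
  have "(\<lambda>p. (\<lambda>w p. cond_wprob n w (fst p) / wprob F w) (window n (snd p)) p) \<in> borel_measurable (block_in n \<Otimes>\<^sub>M block_out n)"
  proof (rule measurable_compose_countable[OF _ measurable_compose[OF measurable_snd measurable_window_block]])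
    fix w
    show "(\<lambda>p. cond_wprob n w (fst p) / wprob F w) \<in> borel_measurable (block_in n \<Otimes>\<^sub>M block_out n)"
      using measurable_compose[OF measurable_fst measurable_cond_wprob] by (intro borel_measurable_divide) simp_all
  qed
  then show ?thesis by (simp add: block_density_def[abs_def])
qed

lemma cond_wprob_nonneg:
  assumes "x \<in> space (block_in n)"
  shows "0 \<le> cond_wprob n w x"
  unfolding cond_wprob_def
  by (intro Bochner_Integration.integral_nonneg lik_nonneg merge_block_in_space space_block_in[OF assms])
    (simp_all add: space_PF[OF F])

lemma block_joint_law:
  "distr (SL F) (block_in n \<Otimes>\<^sub>M block_out n) (\<lambda>\<omega>. (restrict (fst \<omega>) {1..int n}, restrict (snd \<omega>) {1..int n})) =
   density (distr (SL F) (block_in n) (\<lambda>\<omega>. restrict (fst \<omega>) {1..int n}) \<Otimes>\<^sub>M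
            distr (SL F) (block_out n) (\<lambda>\<omega>. restrict (snd \<omega>) {1..int n})) (\<lambda>p. ennreal (block_density n p))"
  (is "distr _ ?S ?f = density (?X \<Otimes>\<^sub>M ?Y) ?d")
proof (rule measure_eqI)
  let ?I = "{1..int n}"
  interpret S: prob_space "SL F" by (rule prob_SL[OF F])
  interpret Y: prob_space ?Y by (rule S.prob_space_distr[OF measurable_SL_out])
  have sXY: "sets (?X \<Otimes>\<^sub>M ?Y) = sets ?S" by (intro sets_pair_measure_cong) simp_all
  show "sets (distr (SL F) ?S ?f) = sets (density (?X \<Otimes>\<^sub>M ?Y) ?d)" using sXY by simp
  fix B assume "B \<in> sets (distr (SL F) ?S ?f)"
  then have B: "B \<in> sets ?S" by simp
  have iB: "(indicator B :: _ \<Rightarrow> ennreal) \<in> borel_measurable ?S" using B by simp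
  have fm: "?f \<in> SL F \<rightarrow>\<^sub>M ?S" by (intro measurable_Pair measurable_SL_in measurable_SL_out)
  have dm: "?d \<in> borel_measurable ?S" using measurable_block_density by simp
  let ?J = "\<lambda>w. \<integral>\<^sup>+x. ennreal (cond_wprob n w x) * indicator B (restrict x ?I, word_path n w) \<partial>PF F"
  have secm: "(\<lambda>x. indicator B (restrict x ?I, word_path n w) :: ennreal) \<in> borel_measurable paths" for w
    by (rule measurable_block_section[OF iB])
  have cpm: "(\<lambda>x. cond_wprob n w x) \<in> borel_measurable paths" for w
    using measurable_compose[OF measurable_restrict_paths measurable_cond_wprob, of n w] by (simp add: cond_wprob_restrict)
  have "emeasure (distr (SL F) ?S ?f) B = (\<integral>\<^sup>+p. indicator B p \<partial>distr (SL F) ?S ?f)" using B by simp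
  also have "\<dots> = (\<integral>\<^sup>+\<omega>. indicator B (?f \<omega>) \<partial>SL F)" by (rule nn_integral_distr[OF fm]) (use iB in simp)
  also have "\<dots> = (\<integral>\<^sup>+x. \<integral>\<^sup>+w. ennreal (lik 1 w x) * indicator B (restrict x ?I, word_path n w) \<partial>Words n \<partial>PF F)"
    by (rule nn_integral_block[OF iB])
  also have "\<dots> = (\<integral>\<^sup>+w. \<integral>\<^sup>+x. ennreal (lik 1 w x) * indicator B (restrict x ?I, word_path n w) \<partial>PF F \<partial>Words n)"
    using secm by (intro nn_integral_swap_words[OF F, symmetric]) simp
  also have "\<dots> = (\<integral>\<^sup>+w. ?J w \<partial>Words n)"
  proof (rule nn_integral_cong)
    fix w
    \<comment> \<open>The path is split into the block and an independent copy outside it. The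
      indicator reads the block only, so averaging over the copy turns the likelihood into
      \<open>cond_wprob\<close>.\<close>
    have "(\<integral>\<^sup>+x. ennreal (lik 1 w x) * indicator B (restrict x ?I, word_path n w) \<partial>PF F) =
      (\<integral>\<^sup>+x. \<integral>\<^sup>+x'. ennreal (lik 1 w (\<lambda>i. if i \<in> ?I then x i else x' i)) *
         indicator B (restrict (\<lambda>i. if i \<in> ?I then x i else x' i) ?I, word_path n w) \<partial>PF F \<partial>PF F)"
      using nn_integral_merge[where K="?I" and ?M1.0="\<lambda>_. F" and ?M2.0="\<lambda>_. F"
          and f="\<lambda>x. ennreal (lik 1 w x) * indicator B (restrict x ?I, word_path n w)", OF F F] secm by simp
    also have "\<dots> = ?J w"
    proof (rule nn_integral_cong)
      fix x assume "x \<in> space (PF F)"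
      then have x: "x \<in> space paths" by (simp add: space_PF[OF F])
      have r: "restrict (\<lambda>i. if i \<in> ?I then x i else x' i) ?I = restrict x ?I" for x' by auto
      have "(\<integral>\<^sup>+x'. ennreal (lik 1 w (\<lambda>i. if i \<in> ?I then x i else x' i)) *
         indicator B (restrict (\<lambda>i. if i \<in> ?I then x i else x' i) ?I, word_path n w) \<partial>PF F) =
         (\<integral>\<^sup>+x'. ennreal (lik 1 w (\<lambda>i. if i \<in> ?I then x i else x' i)) \<partial>PF F) * indicator B (restrict x ?I, word_path n w)"
        unfolding r
        by (intro nn_integral_multc measurable_compose[OF path_measurable[OF F measurable_compose[OF measurable_merge_const[OF x] measurable_lik]] measurable_ennreal])
      then show "(\<integral>\<^sup>+x'. ennreal (lik 1 w (\<lambda>i. if i \<in> ?I then x i else x' i)) *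
         indicator B (restrict (\<lambda>i. if i \<in> ?I then x i else x' i) ?I, word_path n w) \<partial>PF F) =
         ennreal (cond_wprob n w x) * indicator B (restrict x ?I, word_path n w)"
        unfolding cond_wprob_def expect_merge_bounds(3)[OF x] .
    qed
    finally show "(\<integral>\<^sup>+x. ennreal (lik 1 w x) * indicator B (restrict x ?I, word_path n w) \<partial>PF F) = ?J w" .
  qed
  also have "\<dots> = (\<integral>\<^sup>+x. \<integral>\<^sup>+w. ennreal (cond_wprob n w x) * indicator B (restrict x ?I, word_path n w) \<partial>Words n \<partial>PF F)"
    using secm cpm by (intro nn_integral_swap_words[OF F]) simp
  \<comment> \<open>The output marginal supplies the weight \<open>wprob F w\<close>, which cancels
    the denominator of the density.\<close>
  also have "\<dots> = (\<integral>\<^sup>+x. (\<integral>\<^sup>+y. ?d (x, y) * indicator B (x, y) \<partial>?Y) \<partial>?X)"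
  proof -
    have dBm: "(\<lambda>p. ?d p * indicator B p) \<in> borel_measurable ?S" using dm iB by simp
    have o: "(\<integral>\<^sup>+y. ?d (x, y) * indicator B (x, y) \<partial>?Y) =
      (\<integral>\<^sup>+w. ennreal (cond_wprob n w x) * indicator B (x, word_path n w) \<partial>Words n)"
      if x: "x \<in> space (block_in n)" for x
    proof -
      have "(\<integral>\<^sup>+y. ?d (x, y) * indicator B (x, y) \<partial>?Y) =
         (\<integral>\<^sup>+w. ennreal (wprob F w) * (?d (x, word_path n w) * indicator B (x, word_path n w)) \<partial>Words n)"
        by (rule nn_integral_block_out[OF measurable_compose[OF measurable_Pair1'[OF x] dBm]])
      also have "\<dots> = (\<integral>\<^sup>+w. ennreal (cond_wprob n w x) * indicator B (x, word_path n w) \<partial>Words n)"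
      proof (intro nn_integral_cong)
        fix w assume "w \<in> space (Words n)"
        then have w: "w \<in> words n" by simp
        have "ennreal (wprob F w) * ?d (x, word_path n w) = ennreal (wprob F w * (cond_wprob n w x / wprob F w))"
          using wprob_bounds(3)[OF F, of w] cond_wprob_nonneg[OF x, of w]
          by (simp add: block_density_def window_word_path[OF w] ennreal_mult[symmetric])
        also have "\<dots> = ennreal (cond_wprob n w x)" using wprob_bounds(3)[OF F, of w] by simp
        finally show "ennreal (wprob F w) * (?d (x, word_path n w) * indicator B (x, word_path n w)) =
           ennreal (cond_wprob n w x) * indicator B (x, word_path n w)" by (simp only: mult.assoc[symmetric])
      qed
      finally show ?thesis .
    qed
    have im: "(\<lambda>x. \<integral>\<^sup>+y. ?d (x, y) * indicator B (x, y) \<partial>?Y) \<in> borel_measurable (block_in n)"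
    proof -
      have "(\<lambda>p. ?d p * indicator B p) \<in> borel_measurable (block_in n \<Otimes>\<^sub>M ?Y)"
        using dBm by (simp cong: measurable_cong_sets sets_pair_measure_cong)
      then show ?thesis by (intro Y.borel_measurable_nn_integral) (simp add: split_beta')
    qed
    have "(\<integral>\<^sup>+x. (\<integral>\<^sup>+y. ?d (x, y) * indicator B (x, y) \<partial>?Y) \<partial>?X) =
      (\<integral>\<^sup>+x. (\<integral>\<^sup>+y. ?d (restrict x ?I, y) * indicator B (restrict x ?I, y) \<partial>?Y) \<partial>PF F)"
      by (rule nn_integral_block_in[OF im])
    also have "\<dots> = (\<integral>\<^sup>+x. \<integral>\<^sup>+w. ennreal (cond_wprob n w x) * indicator B (restrict x ?I, word_path n w) \<partial>Words n \<partial>PF F)"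
      using measurable_space[OF measurable_restrict_paths, of _ n]
      by (intro nn_integral_cong) (simp add: o space_PF[OF F] cond_wprob_restrict)
    finally show ?thesis ..
  qed
  also have "\<dots> = (\<integral>\<^sup>+p. ?d p * indicator B p \<partial>(?X \<Otimes>\<^sub>M ?Y))"
    using dm iB by (intro Y.nn_integral_fst) (simp add: measurable_cong_sets[OF sXY refl])
  also have "\<dots> = emeasure (density (?X \<Otimes>\<^sub>M ?Y) ?d) B"
    using dm B by (simp add: emeasure_density measurable_cong_sets[OF sXY refl] sXY)
  finally show "emeasure (distr (SL F) ?S ?f) B = emeasure (density (?X \<Otimes>\<^sub>M ?Y) ?d) B" .
qed

end


section \<open>From block information to the information rate\<close>

context
  fixes F :: "real measure" assumes F: "F \<in> input_laws A"
begin

text \<open>Integrability comes from the cost bound through the envelope. Integrating over words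
  first serves the noise term; integrating over paths first serves the output entropy.\<close>

lemma integral_SL:
  fixes g :: "(int \<Rightarrow> real) \<Rightarrow> nat list \<Rightarrow> real"
  assumes m: "\<And>w. (\<lambda>x. g x w) \<in> borel_measurable paths"
    and b: "\<And>x w. x \<in> space paths \<Longrightarrow> w \<in> words n \<Longrightarrow> \<bar>g x w\<bar> \<le> Cost w"
  shows "integrable (SL F) (\<lambda>\<omega>. g (fst \<omega>) (window n (snd \<omega>)))" (is ?i)
    and "(\<integral>\<omega>. g (fst \<omega>) (window n (snd \<omega>)) \<partial>SL F) = (\<integral>x. \<integral>w. lik 1 w x * g x w \<partial>Words n \<partial>PF F)" (is ?a)
    and "(\<integral>\<omega>. g (fst \<omega>) (window n (snd \<omega>)) \<partial>SL F) = (\<integral>w. \<integral>x. lik 1 w x * g x w \<partial>PF F \<partial>Words n)" (is ?b)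
proof -
  let ?U = "count_space (UNIV :: nat list set)"
  let ?C = "PF F \<Otimes>\<^sub>M ?U"
  let ?f = "\<lambda>\<omega>. (fst \<omega>, window n (snd \<omega>))"
  let ?d = "\<lambda>p. indicator (words n) (snd p) * lik 1 (snd p) (fst p) :: real"
  let ?g = "\<lambda>p. g (fst p) (snd p)"
  interpret U: sigma_finite_measure ?U by (rule sigma_finite_measure_count_space_countable) simp
  interpret P: prob_space "PF F" by (rule path_prob[OF F])
  interpret PU: pair_sigma_finite "PF F" ?U ..
  have sC: "sets ?C = sets (paths \<Otimes>\<^sub>M ?U)" by (intro sets_pair_measure_cong sets_PF[OF F] refl)
  have fm: "?f \<in> SL F \<rightarrow>\<^sub>M ?C" using measurable_SL_window[OF F] by (simp add: measurable_cong_sets[OF refl sC])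
  have gm: "?g \<in> borel_measurable ?C"
    by (rule borel_measurable_paths_words[OF F path_measurable[OF F m]])
  have dm: "?d \<in> borel_measurable ?C"
    using borel_measurable_paths_words[where g="\<lambda>x w. indicator (words n) w * lik 1 w x :: real", OF F, of "PF F"]
      path_measurable[OF F measurable_lik] by simp
  have dg: "AE p in ?C. 0 \<le> ?d p"
    by (rule AE_I2) (auto simp: space_pair_measure space_PF[OF F] intro!: mult_nonneg_nonneg lik_nonneg)
  have law: "distr (SL F) ?C ?f = density ?C (\<lambda>p. ennreal (?d p))" by (rule window_law[OF F])
  have env: "integrable ?C (\<lambda>(x, w). cost_factor * (indicator (words n) w * env w))"
  proof (rule PU.Fubini_integrable)
    show "(\<lambda>(x, w). cost_factor * (indicator (words n) w * env w)) \<in> borel_measurable ?C"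
      using borel_measurable_paths_words[where g="\<lambda>x w. cost_factor * (indicator (words n) w * env w)", OF F, of "PF F"]
      by (simp add: split_beta')
    have "set_integrable ?U (words n) env"
      using integrable_env[of n] abs_summable_on_altdef[of env "words n"] by (simp add: abs_summable_on_def)
    then show "AE x in PF F. integrable ?U (\<lambda>w. case (x, w) of (x, w) \<Rightarrow> cost_factor * (indicator (words n) w * env w))"
      by (simp add: set_integrable_def)
  qed simp
  have bound: "\<bar>?d p * ?g p\<bar> \<le> cost_factor * (indicator (words n) (snd p) * env (snd p))" if "p \<in> space ?C" for p
  proof (cases "snd p \<in> words n")
    case True
    let ?x = "fst p" and ?w = "snd p"
    have x: "?x \<in> space paths" using that by (auto simp: space_pair_measure space_PF[OF F])
    have "\<bar>lik 1 ?w ?x * ?g p\<bar> \<le> lik 1 ?w ?x * (cost_factor * Theta ?w)"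
      unfolding abs_mult using b[OF x True] Cost_cost_factor[of ?w] lik_nonneg[OF x, of 1 ?w] by (intro mult_mono) auto
    also have "\<dots> \<le> cost_factor * env ?w"
      using mult_left_mono[OF lik_le_env[OF x, of 1 ?w], of cost_factor] cost_factor_pos by (simp add: mult_ac)
    finally show ?thesis using True by simp
  qed simp
  have int: "integrable ?C (\<lambda>p. ?d p * ?g p)"
  proof (rule Bochner_Integration.integrable_bound[OF env])
    show "(\<lambda>p. ?d p * ?g p) \<in> borel_measurable ?C" by (rule borel_measurable_times[OF dm gm])
    show "AE p in ?C. norm (?d p * ?g p) \<le> norm (case p of (x, w) \<Rightarrow> cost_factor * (indicator (words n) w * env w))"
      using bound by (intro AE_I2) (simp add: split_beta' order_trans[OF _ abs_ge_self])
  qed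
  have "integrable (density ?C (\<lambda>p. ennreal (?d p))) ?g"
    by (subst integrable_real_density[OF dm dg gm]) (rule int)
  then have dI: "integrable (distr (SL F) ?C ?f) ?g" unfolding law .
  show ?i using integrable_distr[OF fm dI] by simp
  have "(\<integral>\<omega>. g (fst \<omega>) (window n (snd \<omega>)) \<partial>SL F) = (\<integral>p. ?g p \<partial>distr (SL F) ?C ?f)"
    using integral_distr[OF fm gm] by simp
  also have "\<dots> = (\<integral>p. ?d p * ?g p \<partial>?C)"
    unfolding law by (rule integral_real_density[OF dm dg gm])
  finally have e: "(\<integral>\<omega>. g (fst \<omega>) (window n (snd \<omega>)) \<partial>SL F) = (\<integral>p. ?d p * ?g p \<partial>?C)" .
  have res: "(\<integral>w. indicator (words n) w * f w \<partial>?U) = (\<integral>w. f w \<partial>Words n)" for f :: "nat list \<Rightarrow> real"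
    using infsetsum_altdef[of f "words n"] by (simp add: infsetsum_def set_lebesgue_integral_def)
  have "(\<integral>p. ?d p * ?g p \<partial>?C) = (\<integral>x. \<integral>w. indicator (words n) w * (lik 1 w x * g x w) \<partial>?U \<partial>PF F)"
    using PU.integral_fst'[OF int] by (simp add: mult_ac)
  then show ?a unfolding e res .
  have "(\<integral>p. ?d p * ?g p \<partial>?C) = (\<integral>w. \<integral>x. indicator (words n) w * (lik 1 w x * g x w) \<partial>PF F \<partial>?U)"
    using PU.integral_snd[of "\<lambda>x w. ?d (x, w) * ?g (x, w)"] int by (simp add: mult_ac split_beta')
  also have "\<dots> = (\<integral>w. indicator (words n) w * (\<integral>x. lik 1 w x * g x w \<partial>PF F) \<partial>?U)" by simp
  finally show ?b unfolding e res .
qed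

text \<open>A divergence with a density is the mean of its logarithm under the joint law. Both word
  probabilities are positive, so the logarithm of the quotient splits.\<close>

lemma block_information_eq:
  "block_information L lam0 h A F n =
    (\<integral>\<omega>. ln (cond_wprob F n (window n (snd \<omega>)) (fst \<omega>)) - ln (wprob F (window n (snd \<omega>))) \<partial>SL F)"
proof -
  let ?I = "{1..int n}"
  let ?X = "distr (SL F) (block_in n) (\<lambda>\<omega>. restrict (fst \<omega>) ?I)"
  let ?Y = "distr (SL F) (block_out n) (\<lambda>\<omega>. restrict (snd \<omega>) ?I)"
  let ?f = "\<lambda>\<omega>. (restrict (fst \<omega>) ?I, restrict (snd \<omega>) ?I)"
  let ?S = "block_in n \<Otimes>\<^sub>M block_out n"
  let ?d = "block_density F n"
  interpret S: prob_space "SL F" by (rule prob_SL[OF F])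
  interpret X: prob_space ?X by (rule S.prob_space_distr[OF measurable_SL_in[OF F]])
  interpret Y: prob_space ?Y by (rule S.prob_space_distr[OF measurable_SL_out[OF F]])
  interpret XY: pair_prob_space ?X ?Y ..
  have sXY: "sets (?X \<Otimes>\<^sub>M ?Y) = sets ?S" by (intro sets_pair_measure_cong) simp_all
  have dm: "?d \<in> borel_measurable (?X \<Otimes>\<^sub>M ?Y)"
    using measurable_block_density[OF F] by (simp add: measurable_cong_sets[OF sXY refl])
  have nn: "AE p in ?X \<Otimes>\<^sub>M ?Y. 0 \<le> ?d p"
    by (rule AE_I2) (auto simp: space_pair_measure block_density_def[OF F]
      intro!: divide_nonneg_pos cond_wprob_nonneg[OF F] wprob_bounds[OF F])
  have lm: "(\<lambda>p. ln (?d p)) \<in> borel_measurable ?S"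
    using measurable_block_density[OF F] by measurable
  have fm: "?f \<in> SL F \<rightarrow>\<^sub>M ?S" by (intro measurable_Pair measurable_SL_in[OF F] measurable_SL_out[OF F])
  have "block_information L lam0 h A F n = KL_divergence (exp 1) (?X \<Otimes>\<^sub>M ?Y) (distr (SL F) ?S ?f)"
    unfolding block_information_def S.mutual_information_def ..
  also have "\<dots> = (\<integral>p. ?d p * log (exp 1) (?d p) \<partial>(?X \<Otimes>\<^sub>M ?Y))"
    unfolding block_joint_law[OF F] by (rule XY.KL_density[OF _ dm nn]) simp
  also have "\<dots> = (\<integral>p. ?d p * ln (?d p) \<partial>(?X \<Otimes>\<^sub>M ?Y))" by (simp add: log_def)
  also have "\<dots> = (\<integral>p. ln (?d p) \<partial>density (?X \<Otimes>\<^sub>M ?Y) (\<lambda>p. ennreal (?d p)))"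
    using lm by (intro integral_real_density[symmetric] dm nn) (simp add: measurable_cong_sets[OF sXY refl])
  also have "\<dots> = (\<integral>p. ln (?d p) \<partial>distr (SL F) ?S ?f)" unfolding block_joint_law[OF F] ..
  also have "\<dots> = (\<integral>\<omega>. ln (?d (?f \<omega>)) \<partial>SL F)" by (rule integral_distr[OF fm lm])
  also have "\<dots> = (\<integral>\<omega>. ln (cond_wprob F n (window n (snd \<omega>)) (fst \<omega>)) - ln (wprob F (window n (snd \<omega>))) \<partial>SL F)"
  proof (intro Bochner_Integration.integral_cong refl)
    fix \<omega> assume "\<omega> \<in> space (SL F)"
    then have "fst \<omega> \<in> space paths"
      using sets_eq_imp_space_eq[OF sets_SL[OF F]] by (auto simp: space_pair_measure)
    then show "ln (?d (?f \<omega>)) = ln (cond_wprob F n (window n (snd \<omega>)) (fst \<omega>)) - ln (wprob F (window n (snd \<omega>)))"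
      using cond_wprob_pos[OF F] wprob_bounds(3)[OF F]
      by (simp add: block_density_def[OF F] window_restrict cond_wprob_restrict[OF F] ln_divide_pos)
  qed
  finally show ?thesis .
qed

text \<open>Replacing the conditional law given the block by that given the whole path costs at most
  the mean cost of the first \<open>min L n\<close> letters, whatever \<open>n\<close> is. With the
  full path, the noise term is exactly \<open>n\<close> times that of one output.\<close>

lemma block_information_close:
  "\<bar>block_information L lam0 h A F n - (real n * noise F - block_eta UNIV F n)\<bar> \<le> cost_factor * mass_const ^ L"
proof -
  interpret P: prob_space "PF F" by (rule path_prob[OF F])
  let ?m = "min L n"
  let ?c = "\<lambda>\<omega>. ln (cond_wprob F n (window n (snd \<omega>)) (fst \<omega>))"
  let ?l = "\<lambda>\<omega>. ln (lik 1 (window n (snd \<omega>)) (fst \<omega>))"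
  let ?p = "\<lambda>\<omega>. ln (wprob F (window n (snd \<omega>)))"
  let ?t = "\<lambda>\<omega>. Cost (take ?m (window n (snd \<omega>)))"
  have cpm: "(\<lambda>x. cond_wprob F n w x) \<in> borel_measurable paths" for w
    using measurable_compose[OF measurable_restrict_paths[OF F] measurable_cond_wprob[OF F], of n w] by (simp add: cond_wprob_restrict[OF F])
  have c: "integrable (SL F) ?c"
    by (rule integral_SL(1)[where g="\<lambda>x w. ln (cond_wprob F n w x)"])
      (use cpm ln_cond_wprob_le[OF F] in \<open>auto intro: borel_measurable_ln\<close>)
  have l: "integrable (SL F) ?l" "(\<integral>\<omega>. ?l \<omega> \<partial>SL F) = real n * noise F"
  proof -
    have m: "(\<lambda>x. ln (lik 1 w x)) \<in> borel_measurable paths" for w by measurable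
    show "integrable (SL F) ?l"
      by (rule integral_SL(1)[where g="\<lambda>x w. ln (lik 1 w x)"]) (use m ln_lik_abs_le in auto)
    have "(\<integral>\<omega>. ?l \<omega> \<partial>SL F) = (\<integral>x. \<integral>w. lik 1 w x * ln (lik 1 w x) \<partial>Words n \<partial>PF F)"
      by (rule integral_SL(2)[where g="\<lambda>x w. ln (lik 1 w x)"]) (use m ln_lik_abs_le in auto)
    also have "\<dots> = (\<integral>x. (\<Sum>k<n. neg_pois_entropy (Z x (1 + int k))) \<partial>PF F)"
      by (intro Bochner_Integration.integral_cong refl integral_lik_ln_lik) (simp add: space_PF[OF F])
    also have "\<dots> = (\<Sum>k<n. expect F (\<lambda>x. neg_pois_entropy (Z x (1 + int k))))"
      unfolding expect_def
    proof (rule Bochner_Integration.integral_sum)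
      fix k
      show "integrable (PF F) (\<lambda>x. neg_pois_entropy (Z x (1 + int k)))"
        by (rule integrable_bounded_prob[OF P.prob_space_axioms path_measurable[OF F noise_integrand_measurable]])
          (use Z_bounds in \<open>auto simp: space_PF[OF F] intro!: neg_pois_entropy_bound\<close>)
    qed
    also have "\<dots> = real n * noise F" by (simp add: expect_neg_pois_entropy[OF F])
    finally show "(\<integral>\<omega>. ?l \<omega> \<partial>SL F) = real n * noise F" .
  qed
  have p: "integrable (SL F) ?p" "(\<integral>\<omega>. ?p \<omega> \<partial>SL F) = block_eta UNIV F n"
  proof -
    show "integrable (SL F) ?p"
      by (rule integral_SL(1)[where g="\<lambda>x w. ln (wprob F w)"]) (simp_all add: ln_wprob_abs_le[OF F])
    have "(\<integral>\<omega>. ?p \<omega> \<partial>SL F) = (\<integral>w. \<integral>x. lik 1 w x * ln (wprob F w) \<partial>PF F \<partial>Words n)"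
      by (rule integral_SL(3)[where g="\<lambda>x w. ln (wprob F w)"]) (simp_all add: ln_wprob_abs_le[OF F])
    also have "\<dots> = (\<integral>w. wprob F w * ln (wprob F w) \<partial>Words n)"
      using expect_lik[OF F, of 1] by (simp add: expect_def)
    finally show "(\<integral>\<omega>. ?p \<omega> \<partial>SL F) = block_eta UNIV F n" by (simp add: block_eta_def eta_def)
  qed
  have t: "integrable (SL F) ?t" "(\<integral>\<omega>. ?t \<omega> \<partial>SL F) \<le> cost_factor * mass_const ^ L"
  proof -
    show "integrable (SL F) ?t"
      by (rule integral_SL(1)[where g="\<lambda>x w. Cost (take ?m w)"]) (use Cost_take Cost_nonneg in auto)
    have "(\<integral>\<omega>. ?t \<omega> \<partial>SL F) = (\<integral>x. \<integral>w. lik 1 w x * Cost (take ?m w) \<partial>Words n \<partial>PF F)"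
      by (rule integral_SL(2)[where g="\<lambda>x w. Cost (take ?m w)"]) (use Cost_take Cost_nonneg in auto)
    also have "\<bar>\<dots>\<bar> \<le> cost_factor * mass_const ^ L"
    proof (rule integral_bounded_prob[OF P.prob_space_axioms])
      fix x assume "x \<in> space (PF F)"
      then have x: "x \<in> space paths" by (simp add: space_PF[OF F])
      have n: "?m + (n - ?m) = n" by simp
      have "(\<integral>w. lik 1 w x * Cost (take ?m w) \<partial>Words n) =
          (\<integral>u. lik 1 u x * Cost u \<partial>count_space (words ?m))"
        using integral_lik_take[where m="?m" and n="n - ?m" and c=1 and g=Cost and s=1, OF x] Cost_nonneg unfolding n by simp
      moreover have "\<dots> \<le> cost_factor * mass_const ^ ?m" by (rule nn_wlik_real[OF x])
      moreover have "cost_factor * mass_const ^ ?m \<le> cost_factor * mass_const ^ L"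
        using cost_factor_pos mass_const_ge_1 by (intro mult_left_mono power_increasing) auto
      moreover have "0 \<le> (\<integral>u. lik 1 u x * Cost u \<partial>count_space (words ?m))"
        by (intro Bochner_Integration.integral_nonneg mult_nonneg_nonneg lik_nonneg[OF x] Cost_nonneg)
      ultimately show "\<bar>\<integral>w. lik 1 w x * Cost (take ?m w) \<partial>Words n\<bar> \<le> cost_factor * mass_const ^ L" by linarith
    qed
    finally show "(\<integral>\<omega>. ?t \<omega> \<partial>SL F) \<le> cost_factor * mass_const ^ L" by linarith
  qed
  have "block_information L lam0 h A F n - (real n * noise F - block_eta UNIV F n) = (\<integral>\<omega>. ?c \<omega> - ?l \<omega> \<partial>SL F)"
    unfolding block_information_eq using c l p by simp
  moreover have "\<bar>\<integral>\<omega>. ?c \<omega> - ?l \<omega> \<partial>SL F\<bar> \<le> (\<integral>\<omega>. ?t \<omega> \<partial>SL F)"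
  proof (rule order_trans[OF integral_abs_bound integral_mono])
    show "integrable (SL F) (\<lambda>\<omega>. \<bar>?c \<omega> - ?l \<omega>\<bar>)" using c l by simp
    fix \<omega> assume "\<omega> \<in> space (SL F)"
    then have "fst \<omega> \<in> space paths"
      using sets_eq_imp_space_eq[OF sets_SL[OF F]] by (auto simp: space_pair_measure)
    then show "\<bar>?c \<omega> - ?l \<omega>\<bar> \<le> ?t \<omega>" by (rule cond_wprob_close[OF F _ window_in_words])
  qed (rule t)
  ultimately show ?thesis using t(2) by linarith
qed

text \<open>After division by \<open>n\<close> the boundary error vanishes and the block sums
  converge; existence of the limit is part of the argument, as \<open>lim\<close> alone does not
  provide it.\<close>

lemma information_rate_eq: "information_rate L lam0 h A F = noise F - neg_entropy_rate F"
proof -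
  have e: "(\<lambda>n. (block_information L lam0 h A F n - (real n * noise F - block_eta UNIV F n)) / real n) \<longlonglongrightarrow> 0"
  proof (rule Lim_null_comparison)
    show "\<forall>\<^sub>F n in sequentially. norm ((block_information L lam0 h A F n - (real n * noise F - block_eta UNIV F n)) / real n)
        \<le> cost_factor * mass_const ^ L / real n"
      using block_information_close by (intro always_eventually allI) (simp add: divide_right_mono)
    show "(\<lambda>n. cost_factor * mass_const ^ L / real n) \<longlonglongrightarrow> 0" by (rule lim_const_over_n)
  qed
  have "(\<lambda>n. (block_information L lam0 h A F n - (real n * noise F - block_eta UNIV F n)) / real n +
      (noise F - block_eta UNIV F n / real n)) \<longlonglongrightarrow> 0 + (noise F - neg_entropy_rate F)"
    by (intro tendsto_add e tendsto_diff tendsto_const block_eta_tendsto[OF F])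
  moreover have "\<forall>\<^sub>F n in sequentially. (block_information L lam0 h A F n - (real n * noise F - block_eta UNIV F n)) / real n +
      (noise F - block_eta UNIV F n / real n) = block_information L lam0 h A F n / real n"
    using eventually_gt_at_top[of 0] by eventually_elim (simp add: field_simps)
  ultimately have "(\<lambda>n. block_information L lam0 h A F n / real n) \<longlonglongrightarrow> noise F - neg_entropy_rate F"
    using tendsto_cong by fastforce
  then show ?thesis unfolding information_rate_def by (rule limI)
qed

end

lemma gateaux_information_rate:
  assumes F: "F \<in> input_laws A"
  shows "\<exists>\<psi>. gateaux A F (information_rate L lam0 h A) \<psi>"
proof -
  let ?B = "{w. \<not> regen w}"
  have e: "\<exists>\<psi>. gateaux A F (eta_sum \<Omega>) \<psi>" if "decaying \<Omega>" for \<Omega>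
    using gateaux_eta_sum[OF that F] by blast
  obtain a where a: "gateaux A F (eta_sum (words 1)) a" using e[OF decaying_words] by blast
  obtain b where b: "gateaux A F (eta_sum (margins 1 1 ?B)) b" using e[OF decaying_margins[OF decaying_not_regen]] by blast
  obtain c where c: "gateaux A F (eta_sum ?B) c" using e[OF decaying_not_regen] by blast
  obtain d where d: "gateaux A F (eta_sum (margins 0 1 ?B)) d" using e[OF decaying_margins[OF decaying_not_regen]] by blast
  obtain f where f: "gateaux A F (eta_sum (margins 1 0 ?B)) f" using e[OF decaying_margins[OF decaying_not_regen]] by blast
  note g = gateaux_add[OF gateaux_noise[OF F] gateaux_uminus[OF gateaux_add[OF a
    gateaux_add[OF gateaux_add[OF gateaux_add[OF b c] gateaux_uminus[OF d]] gateaux_uminus[OF f]]]]]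
  let ?R = "\<lambda>G. noise G + - (eta_sum (words 1) G + (eta_sum (margins 1 1 ?B) G + eta_sum ?B G + - eta_sum (margins 0 1 ?B) G + - eta_sum (margins 1 0 ?B) G))"
  \<comment> \<open>The series representation holds for input laws only, so derivatives are
    transferred for \<epsilon> between 0 and 1, where the mixtures are input laws.\<close>
  have R: "?R G = information_rate L lam0 h A G" if "G \<in> input_laws A" for G
    unfolding information_rate_eq[OF that] neg_entropy_rate_def[OF that] by simp
  obtain \<psi> where \<psi>: "gateaux A F ?R \<psi>" using g by blast
  have "gateaux A F (information_rate L lam0 h A) \<psi>"
    unfolding gateaux_def
  proof (intro conjI ballI)
    show "continuous_on {0..A} \<psi>" using \<psi> by (simp add: gateaux_def)
    fix G assume G: "G \<in> input_laws A"
    have "((\<lambda>\<epsilon>. (?R (mixture \<epsilon> F G) - ?R F) / \<epsilon>) \<longlongrightarrow> (\<integral>y. \<psi> y \<partial>G)) (at_right 0)"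
      using \<psi> G unfolding gateaux_def by blast
    then show "((\<lambda>\<epsilon>. (information_rate L lam0 h A (mixture \<epsilon> F G) - information_rate L lam0 h A F) / \<epsilon>) \<longlongrightarrow> (\<integral>y. \<psi> y \<partial>G)) (at_right 0)"
    proof (rule Lim_transform_eventually)
      show "\<forall>\<^sub>F \<epsilon> in at_right 0. (?R (mixture \<epsilon> F G) - ?R F) / \<epsilon> =
        (information_rate L lam0 h A (mixture \<epsilon> F G) - information_rate L lam0 h A F) / \<epsilon>"
        using eventually_at_right_real[of 0 1, OF zero_less_one]
      proof eventually_elim
        case (elim \<epsilon>)
        have "mixture \<epsilon> F G \<in> input_laws A" by (rule mixture_in_input_laws[OF F G]) (use elim in auto)
        then show ?case by (simp only: R[OF F] R)
      qed
    qed
  qed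
  then show ?thesis by blast
qed

end

section \<open>Multipliers\<close>

text \<open>Points \<open>x < P\<close> require \<open>lam \<le> - \<psi> x / (P - x)\<close>,
  points \<open>y > P\<close> require \<open>lam \<ge> \<psi> y / (y - P)\<close>, and
  \<open>two\<close> says that every lower bound is below every upper bound. The infimum of the
  upper bounds works; \<open>0 < P\<close> ensures that there is one, from \<open>x = 0\<close>, and
  \<open>low\<close> makes them nonnegative.\<close>

lemma linear_majorant:
  fixes \<psi> :: "real \<Rightarrow> real"
  assumes P: "0 < P" and A: "0 \<le> A"
    and low: "\<And>x. 0 \<le> x \<Longrightarrow> x \<le> A \<Longrightarrow> x \<le> P \<Longrightarrow> \<psi> x \<le> 0"
    and two: "\<And>x y. 0 \<le> x \<Longrightarrow> x < P \<Longrightarrow> P < y \<Longrightarrow> y \<le> A \<Longrightarrow> (y - P) * \<psi> x + (P - x) * \<psi> y \<le> 0"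
  shows "\<exists>lam\<ge>0. \<forall>x\<in>{0..A}. \<psi> x \<le> lam * (x - P)"
proof -
  define S where "S = (\<lambda>x. - \<psi> x / (P - x)) ` {x. 0 \<le> x \<and> x \<le> A \<and> x < P}"
  define lam where "lam = Inf S"
  have S0: "S \<noteq> {}" using P A by (auto simp: S_def intro!: exI[of _ 0])
  have lb: "s \<ge> 0" if s: "s \<in> S" for s
  proof -
    obtain x where x: "0 \<le> x" "x \<le> A" "x < P" "s = - \<psi> x / (P - x)" using s by (auto simp: S_def)
    show ?thesis unfolding x(4) by (rule divide_nonneg_pos) (use x low[of x] in auto)
  qed
  have bdd: "bdd_below S" by (rule bdd_belowI[of _ 0]) (rule lb)
  have lam: "lam \<ge> 0" unfolding lam_def by (rule cInf_greatest[OF S0 lb])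
  have "\<psi> x \<le> lam * (x - P)" if x: "0 \<le> x" "x \<le> A" for x
  proof (cases x P rule: linorder_cases)
    case less
    then have "- \<psi> x / (P - x) \<in> S" using x by (auto simp: S_def)
    then have "lam \<le> - \<psi> x / (P - x)" unfolding lam_def by (rule cInf_lower[OF _ bdd])
    then show ?thesis using less by (simp add: field_simps)
  next
    case equal
    then show ?thesis using low[OF x] by simp
  next
    case greater
    have "\<psi> x / (x - P) \<le> lam"
      unfolding lam_def
    proof (rule cInf_greatest[OF S0])
      fix s assume "s \<in> S"
      then obtain u where u: "0 \<le> u" "u < P" "s = - \<psi> u / (P - u)" by (auto simp: S_def)
      have "(x - P) * \<psi> u + (P - u) * \<psi> x \<le> 0" by (rule two[OF u(1,2) greater x(2)])
      then have "\<psi> x * (P - u) \<le> (- \<psi> u) * (x - P)" by (simp add: algebra_simps)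
      then show "\<psi> x / (x - P) \<le> s"
        unfolding u(3) using u greater by (simp add: pos_divide_le_eq) (simp add: field_simps)
    qed
    then show ?thesis using greater by (simp add: field_simps)
  qed
  then show ?thesis using lam by auto
qed

text \<open>If the function were positive at a support point, it would be positive on a relatively
  open neighbourhood of positive measure, and its integral could not vanish.\<close>

lemma integral_eq_0_closed_support:
  assumes F: "F \<in> input_laws A" and cont: "continuous_on {0..A} \<phi>"
    and nn: "\<And>x. x \<in> {0..A} \<Longrightarrow> 0 \<le> \<phi> x" and z: "(\<integral>x. \<phi> x \<partial>F) = 0"
    and x: "x \<in> closed_support F"
  shows "\<phi> x = (0 :: real)"
proof (rule ccontr)
  assume "\<phi> x \<noteq> 0"
  have sp: "space F = {0..A}" by (rule space_law[OF F])
  have x0: "x \<in> {0..A}" using x sp by (auto simp: closed_support_def)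
  then have pos: "\<phi> x > 0" using nn[OF x0] \<open>\<phi> x \<noteq> 0\<close> by simp
  have "\<exists>U. open U \<and> U \<inter> {0..A} = \<phi> -` {0<..} \<inter> {0..A}"
    by (rule cont[unfolded continuous_on_open_invariant, rule_format]) (rule open_greaterThan)
  then obtain U where U: "open U" "U \<inter> {0..A} = \<phi> -` {0<..} \<inter> {0..A}" by blast
  have "x \<in> \<phi> -` {0<..} \<inter> {0..A}" using pos x0 by simp
  then have xU: "x \<in> U" unfolding U(2)[symmetric] by simp
  have posU: "\<phi> y > 0" if "y \<in> U \<inter> {0..A}" for y
    using that unfolding U(2) by simp
  have e: "emeasure F (U \<inter> space F) > 0" using x xU U(1) by (simp add: closed_support_def)
  have "AE x in F. 0 \<le> \<phi> x" by (intro AE_I2 nn) (simp add: sp)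
  then have "AE x in F. \<phi> x = 0"
    using integral_nonneg_eq_0_iff_AE[OF integrable_law_continuous[OF F cont]] z by simp
  then have "AE x in F. x \<notin> U \<inter> space F"
  proof eventually_elim
    case (elim y)
    then show ?case using posU[of y] sp by auto
  qed
  moreover have "U \<inter> space F \<in> sets F"
    using U(1) unfolding sp sets_law[OF F] amplitudes_def by (auto simp: sets_restrict_space)
  ultimately have "emeasure F (U \<inter> space F) = 0"
    using AE_iff_null_sets[of "U \<inter> space F" F] by (simp add: null_sets_def)
  then show False using e by simp
qed

lemma integral_return_law:
  fixes \<psi> :: "real \<Rightarrow> real"
  assumes "y \<in> {0..A}" "continuous_on {0..A} \<psi>"
  shows "(\<integral>x. \<psi> x \<partial>return (amplitudes A) y) = \<psi> y"
  using assms continuous_on_measurable_amplitudes[OF assms(2)]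
  by (intro integral_return) (auto simp: amplitudes_def space_restrict_space)

lemma integral_mixture_continuous:
  fixes \<psi> :: "real \<Rightarrow> real"
  assumes "F \<in> input_laws A" "G \<in> input_laws A" "0 \<le> \<epsilon>" "\<epsilon> \<le> 1" "continuous_on {0..A} \<psi>"
  shows "(\<integral>x. \<psi> x \<partial>mixture \<epsilon> F G) = (1 - \<epsilon>) * (\<integral>x. \<psi> x \<partial>F) + \<epsilon> * (\<integral>x. \<psi> x \<partial>G)"
proof -
  have "compact (\<psi> ` {0..A})" by (intro compact_continuous_image assms compact_Icc)
  then obtain B where "\<forall>z\<in>\<psi> ` {0..A}. norm z \<le> B"
    using compact_imp_bounded bounded_iff by metis
  then have "\<And>y. y \<in> {0..A} \<Longrightarrow> \<bar>\<psi> y\<bar> \<le> B" by simp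
  then show ?thesis
    by (rule integral_mixture[OF assms(1-4) continuous_on_measurable_amplitudes[OF assms(5)]])
qed

section \<open>Optimality conditions at a maximiser\<close>

theorem lemma6:
  fixes L :: nat and lam0 A Pavg :: real and h :: "nat \<Rightarrow> real" and Fstar :: "real measure"
  assumes "lam0 > 0"
    and "h 0 > 0"
    and "\<forall>l\<le>L. h l \<ge> 0"
    and "(\<Sum>l=0..L. h l) = 1"
    and "A \<ge> 0"
    and "Pavg > 0"
    and "Fstar \<in> admissible_laws A Pavg"
    and "\<forall>F\<in>admissible_laws A Pavg.
           information_rate L lam0 h A F \<le> information_rate L lam0 h A Fstar"
  shows "\<exists>lam gam :: real. lam \<ge> 0 \<and>
           (\<forall>x\<in>{0..A}. influence L lam0 h A Fstar x - lam * x \<le> gam) \<and>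
           (\<forall>x\<in>closed_support Fstar. influence L lam0 h A Fstar x - lam * x = gam) \<and>
           lam * ((\<integral>x. x \<partial>Fstar) - Pavg) = 0"
proof -
  interpret poisson_isi L lam0 A h
    using assms(1,3,4,5) by unfold_locales auto
  let ?R = "information_rate L lam0 h A"
  have F: "Fstar \<in> input_laws A" and mean: "(\<integral>x. x \<partial>Fstar) \<le> Pavg"
    using assms(7) by (auto simp: admissible_laws_def)
  obtain \<psi> where \<psi>: "gateaux A Fstar ?R \<psi>" using gateaux_information_rate[OF F] by blast
  have cont: "continuous_on {0..A} \<psi>" using \<psi> by (simp add: gateaux_def)
  have lim: "((\<lambda>\<epsilon>. (?R (mixture \<epsilon> Fstar G) - ?R Fstar) / \<epsilon>) \<longlongrightarrow> (\<integral>y. \<psi> y \<partial>G)) (at_right 0)"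
    if "G \<in> input_laws A" for G
    using \<psi> that by (simp add: gateaux_def)
  \<comment> \<open>Testing the directional derivative on a point mass; one-sided derivatives at 0
    are unique, so \<open>vector_derivative\<close> returns this value.\<close>
  have infl: "influence L lam0 h A Fstar x = \<psi> x" if x: "x \<in> {0..A}" for x
  proof -
    have r: "return (amplitudes A) x \<in> input_laws A" by (rule return_in_input_laws[OF x])
    have "((\<lambda>\<epsilon>. ?R (mixture \<epsilon> Fstar (return (amplitudes A) x))) has_field_derivative \<psi> x) (at_right 0)"
      using lim[OF r] by (simp add: has_field_derivative_iff mixture_0[OF F r] integral_return_law[OF x cont])
    then show ?thesis
      unfolding influence_def
      by (intro vector_derivative_within) (simp_all add: has_real_derivative_iff_has_vector_derivative)
  qed
  have id: "continuous_on {0..A} (\<lambda>x. x)" by (rule continuous_on_id)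
  \<comment> \<open>The mean is affine along the mixture, so moving towards a law of admissible mean
    stays admissible, and no difference quotient is positive.\<close>
  have le0: "(\<integral>y. \<psi> y \<partial>G) \<le> 0" if G: "G \<in> input_laws A" and m: "(\<integral>x. x \<partial>G) \<le> Pavg" for G
  proof (rule tendsto_upperbound[OF lim[OF G]])
    show "\<forall>\<^sub>F \<epsilon> in at_right 0. (?R (mixture \<epsilon> Fstar G) - ?R Fstar) / \<epsilon> \<le> 0"
      using eventually_at_right_real[of 0 1, OF zero_less_one]
    proof eventually_elim
      case (elim \<epsilon>)
      then have \<epsilon>: "0 \<le> \<epsilon>" "\<epsilon> \<le> 1" by auto
      have "(\<integral>x. x \<partial>mixture \<epsilon> Fstar G) = (1 - \<epsilon>) * (\<integral>x. x \<partial>Fstar) + \<epsilon> * (\<integral>x. x \<partial>G)"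
        by (rule integral_mixture_continuous[OF F G \<epsilon> id])
      also have "\<dots> \<le> (1 - \<epsilon>) * Pavg + \<epsilon> * Pavg"
        using \<epsilon> mean m by (intro add_mono mult_left_mono) auto
      also have "\<dots> = Pavg" by (simp add: algebra_simps)
      finally have "mixture \<epsilon> Fstar G \<in> admissible_laws A Pavg"
        using mixture_in_input_laws[OF F G \<epsilon>] by (simp add: admissible_laws_def)
      then have "?R (mixture \<epsilon> Fstar G) \<le> ?R Fstar" using assms(8) by blast
      then show ?case using \<epsilon> by (simp add: divide_nonpos_nonneg)
    qed
  qed simp
  \<comment> \<open>Mixing a law with itself changes nothing. This fixes the centring of
    \<open>\<psi>\<close>.\<close>
  have self: "(\<integral>y. \<psi> y \<partial>Fstar) = 0"
  proof (rule tendsto_unique[OF _ lim[OF F]])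
    have "\<forall>\<^sub>F \<epsilon> in at_right 0. 0 = (?R (mixture \<epsilon> Fstar Fstar) - ?R Fstar) / \<epsilon>"
      using eventually_at_right_real[of 0 1, OF zero_less_one]
    proof eventually_elim
      case (elim \<epsilon>)
      then have "mixture \<epsilon> Fstar Fstar = Fstar" by (intro mixture_self[OF F]) auto
      then show ?case by simp
    qed
    then show "((\<lambda>\<epsilon>. (?R (mixture \<epsilon> Fstar Fstar) - ?R Fstar) / \<epsilon>) \<longlongrightarrow> 0) (at_right 0)"
      by (rule Lim_transform_eventually[OF tendsto_const])
  qed simp
  have "\<exists>lam\<ge>0. \<forall>x\<in>{0..A}. \<psi> x \<le> lam * (x - Pavg)"
  proof (rule linear_majorant[OF assms(6,5)])
    fix x assume "0 \<le> x" "x \<le> A" and xP: "x \<le> Pavg"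
    then have x: "x \<in> {0..A}" by simp
    show "\<psi> x \<le> 0"
      using le0[OF return_in_input_laws[OF x]] xP
      by (simp add: integral_return_law[OF x cont] integral_return_law[OF x id])
  next
    fix x y assume xy: "0 \<le> x" "x < Pavg" "Pavg < y" "y \<le> A"
    then have x: "x \<in> {0..A}" and y: "y \<in> {0..A}" by auto
    \<comment> \<open>The weight for which the two-point law on \<open>x\<close> and
      \<open>y\<close> has mean exactly \<open>Pavg\<close>.\<close>
    define \<theta> where "\<theta> = (Pavg - x) / (y - x)"
    have \<theta>: "0 \<le> \<theta>" "\<theta> \<le> 1" using xy by (auto simp: \<theta>_def)
    let ?G = "mixture \<theta> (return (amplitudes A) x) (return (amplitudes A) y)"
    note rx = return_in_input_laws[OF x] and ry = return_in_input_laws[OF y]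
    have G: "?G \<in> input_laws A" by (rule mixture_in_input_laws[OF rx ry \<theta>])
    have "(\<integral>x. x \<partial>?G) = (1 - \<theta>) * x + \<theta> * y"
      by (simp add: integral_mixture_continuous[OF rx ry \<theta> id] integral_return_law[OF x id] integral_return_law[OF y id])
    also have "\<dots> = x + \<theta> * (y - x)" by (simp add: algebra_simps)
    also have "\<dots> = Pavg" using xy by (simp add: \<theta>_def)
    finally have "(\<integral>y. \<psi> y \<partial>?G) \<le> 0" by (intro le0[OF G]) simp
    then have "(1 - \<theta>) * \<psi> x + \<theta> * \<psi> y \<le> 0"
      by (simp add: integral_mixture_continuous[OF rx ry \<theta> cont] integral_return_law[OF x cont] integral_return_law[OF y cont])
    then have "(y - x) * ((1 - \<theta>) * \<psi> x + \<theta> * \<psi> y) \<le> 0"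
      using xy by (intro mult_nonneg_nonpos) auto
    moreover have t: "(y - x) * \<theta> = Pavg - x" using xy by (simp add: \<theta>_def)
    moreover have "(y - x) * (1 - \<theta>) = y - Pavg" using t by (simp add: right_diff_distrib)
    ultimately show "(y - Pavg) * \<psi> x + (Pavg - x) * \<psi> y \<le> 0"
      by (simp only: distrib_left mult.assoc[symmetric])
  qed
  then obtain lam where lam: "lam \<ge> 0" and le: "\<And>x. x \<in> {0..A} \<Longrightarrow> \<psi> x \<le> lam * (x - Pavg)" by blast
  let ?\<phi> = "\<lambda>x. lam * (x - Pavg) - \<psi> x"
  have c\<phi>: "continuous_on {0..A} ?\<phi>" by (intro continuous_intros cont)
  interpret P: prob_space Fstar by (rule prob_law[OF F])
  have I\<phi>: "(\<integral>x. ?\<phi> x \<partial>Fstar) = lam * ((\<integral>x. x \<partial>Fstar) - Pavg)"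
    using integrable_law_continuous[OF F id] integrable_law_continuous[OF F cont] self by (simp add: P.prob_space)
  moreover have "0 \<le> (\<integral>x. ?\<phi> x \<partial>Fstar)"
    by (intro Bochner_Integration.integral_nonneg) (simp add: space_law[OF F] le)
  moreover have "lam * ((\<integral>x. x \<partial>Fstar) - Pavg) \<le> 0" using lam mean by (intro mult_nonneg_nonpos) auto
  \<comment> \<open>The integral is nonnegative because the line majorises \<open>\<psi>\<close>,
    and nonpositive because the mean of \<open>Fstar\<close> is at most \<open>Pavg\<close>.\<close>
  ultimately have z: "(\<integral>x. ?\<phi> x \<partial>Fstar) = 0" and slack: "lam * ((\<integral>x. x \<partial>Fstar) - Pavg) = 0" by linarith+
  \<comment> \<open>The majorising line vanishes at \<open>Pavg\<close>, so its intercept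
    \<open>- (lam * Pavg)\<close> is the required constant.\<close>
  have supp: "\<psi> x - lam * x = - (lam * Pavg)" if "x \<in> closed_support Fstar" for x
    using integral_eq_0_closed_support[OF F c\<phi> _ z that] le by (simp add: algebra_simps)
  have supp_sub: "x \<in> {0..A}" if "x \<in> closed_support Fstar" for x
    using that space_law[OF F] by (auto simp: closed_support_def)
  show ?thesis
  proof (intro exI conjI ballI)
    show "lam \<ge> 0" by (rule lam)
    show "influence L lam0 h A Fstar x - lam * x \<le> - (lam * Pavg)" if "x \<in> {0..A}" for x
      using le[OF that] infl[OF that] by (simp add: algebra_simps)
    show "influence L lam0 h A Fstar x - lam * x = - (lam * Pavg)" if "x \<in> closed_support Fstar" for x
      using supp[OF that] infl[OF supp_sub[OF that]] by simp
    show "lam * ((\<integral>x. x \<partial>Fstar) - Pavg) = 0" by (rule slack)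
  qed
qed

end
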